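(* Let $X_1,\dots,X_n$ be i.i.d. zero-mean random vectors in $\mathbb{R}^d$ with $\mathbb{E}[X_i\otimes X_i]=\mathbf{S}$, and suppose that for some $\kappa\ge 1$ it holds $\mathbb{E}^{1/4}[\langle X_i,u\rangle^4]\le \kappa\,\mathbb{E}^{1/2}[\langle X_i,u\rangle^2]$ for all $u\in\mathbb{R}^d$. Let $\delta\in(0,1]$, $0<\lambda\le\|\mathbf{S}\|\le L$, $q:=\lceil\log_2(L/\lambda)\rceil+1$, and assume that $$n\ \ge\ 96^2\,\kappa^4\,q\,\mathrm{df}_\lambda(\mathbf{S})\log(4qd/\delta).$$ Then the output $\widehat{\mathbf{S}}$ of Algorithm A (defined in the context), run on $X_1,\dots,X_n$ with parameters $\delta,\lambda,L$ and truncation level $$\theta=\theta_*:=2\kappa^2\sqrt{\frac{n\,\mathrm{df}_\lambda(\mathbf{S})}{q\log(4qd/\delta)}},$$ satisfies, with probability at least $1-\delta$, $$\left\|\mathbf{S}_\lambda^{-1/2}(\widehat{\mathbf{S}}-\mathbf{S})\mathbf{S}_\lambda^{-1/2}\right\|\ \le\ 48\,\kappa^2\sqrt{\frac{\mathrm{df}_\lambda(\mathbf{S})\log(4d/\delta)}{n}}.$$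
   Context: Notation: $\|\cdot\|$ is the spectral norm of a matrix and the Euclidean norm of a vector; $x\otimes x=xx^\top$; $\mathbb{E}^{1/p}[\cdot]=(\mathbb{E}[\cdot])^{1/p}$, with powers inside the bracket taken before expectation; $\mathbf{A}_\mu:=\mathbf{A}+\mu\mathbf{I}$ for a square matrix $\mathbf{A}$ and $\mu\ge 0$; $\mathrm{df}_\lambda(\mathbf{S}):=\mathrm{Tr}(\mathbf{S}\mathbf{S}_\lambda^{-1})$. For $\theta>0$ let $\rho_\theta(x)=\min(x^2,\theta)/x^2$ for $x\neq0$ and $\rho_\theta(0)=1$ (the value at $0$ is immaterial). Algorithm A (inputs: $X_1,\dots,X_n\in\mathbb{R}^d$, $\delta\in(0,1]$, regularization level $\lambda\le\|\mathbf{S}\|$, $L\ge\|\mathbf{S}\|$, truncation level $\theta>0$; the parameters are deterministic): 1. Set $\lambda_0=L$, $T=\lceil\log_2(L/\lambda)\rceil$, $m=\lfloor n/(2(T+1))\rfloor$. 2. Set $\widehat{\mathbf{S}}^{(0)}=\frac1m\sum_{i=1}^m\rho_\theta(\|X_i\|/\sqrt{L})\,X_i\otimes X_i$. 3. For $t=0,\dots,T-1$: take the new batch $X^{(t+1)}_i=X_{m(t+1)+i}$, $i=1,\dots,m$; let $\mathbf{R}_t$ be the lower-triangular Cholesky factor with $\mathbf{R}_t\mathbf{R}_t^\top=\widehat{\mathbf{S}}^{(t)}_{\lambda_t}=\widehat{\mathbf{S}}^{(t)}+\lambda_t\mathbf{I}$; set $\alpha^{(t+1)}_i=\rho_\theta(\|\mathbf{R}_t^{-1}X^{(t+1)}_i\|)$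 and $\widehat{\mathbf{S}}^{(t+1)}=\frac1m\sum_{i=1}^m\alpha_i^{(t+1)}X_i^{(t+1)}\otimes X_i^{(t+1)}$; set $\lambda_{t+1}=\lambda_t/2$. 4. Set $r=n-m(T+1)$ and $\theta_T=2\theta(T+1)^{1/2}\left(1+\frac{\log(T+1)}{\log(4d/\delta)}\right)^{1/2}$. Take the remaining sample $X^\star_i=X_{n-r+i}$, $i=1,\dots,r$; let $\mathbf{R}_T$ be the Cholesky factor of $\widehat{\mathbf{S}}^{(T)}_{\lambda_T}$; set $\alpha^\star_i=\rho_{\theta_T}(\|\mathbf{R}_T^{-1}X^\star_i\|)$. 5. Output $\widehat{\mathbf{S}}=\frac1r\sum_{i=1}^r\alpha_i^\star X_i^\star\otimes X_i^\star$. *)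

theory Defs
  imports "HOL-Probability.Probability"
begin

text \<open>Square matrices have type \<open>real^'d^'d\<close>, with \<open>d = CARD('d)\<close>.  The class \<open>linorder\<close> on
  the index type gives a meaning to ``lower triangular''.\<close>

text \<open>The type-class \<open>norm\<close> on \<open>real^'d^'d\<close> is the Frobenius norm, hence the separate constant.\<close>

definition spectral_norm :: "real^'d^'d \<Rightarrow> real" where
  "spectral_norm A = onorm (\<lambda>v. A *v v)"

definition outer :: "real^'d \<Rightarrow> real^'d^'d" where
  "outer x = (\<chi> i j. x $ i * x $ j)"

definition reg :: "real \<Rightarrow> real^'d^'d \<Rightarrow> real^'d^'d" where
  "reg \<mu> A = A + \<mu> *\<^sub>R mat 1"

definition df :: "real \<Rightarrow> real^'d^'d \<Rightarrow> real" where
  "df lam S = trace (S ** matrix_inv (reg lam S))"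

definition psd :: "real^'d^'d \<Rightarrow> bool" where
  "psd A \<longleftrightarrow> transpose A = A \<and> (\<forall>x. 0 \<le> x \<bullet> (A *v x))"

text \<open>Meaningful for positive semidefinite, respectively positive definite, \<open>A\<close>.\<close>

definition psd_sqrt :: "real^'d^'d \<Rightarrow> real^'d^'d" where
  "psd_sqrt A = (THE B. psd B \<and> B ** B = A)"

definition inv_sqrt :: "real^'d^'d \<Rightarrow> real^'d^'d" where
  "inv_sqrt A = matrix_inv (psd_sqrt A)"

text \<open>For positive definite \<open>A\<close>; the positive diagonal is the usual normalization that makes the
  lower-triangular factor unique.\<close>

definition cholesky :: "real^'d::{finite,linorder}^'d::{finite,linorder} \<Rightarrow> real^'d::{finite,linorder}^'d::{finite,linorder}" where
  "cholesky A = (THE R. (\<forall>i j. i < j \<longrightarrow> R $ i $ j = 0) \<and> (\<forall>i. 0 < R $ i $ i) \<and> R ** transpose R = A)"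

definition trunc_weight :: "real \<Rightarrow> real \<Rightarrow> real" where
  "trunc_weight \<theta> x = (if x = 0 then 1 else min (x\<^sup>2) \<theta> / x\<^sup>2)"

text \<open>The sample is \<open>x 1, \<dots>, x n\<close>.  A batch of size \<open>k\<close> at offset \<open>s\<close> consists of
  \<open>x (s + 1), \<dots>, x (s + k)\<close>; its points are truncated after whitening by the Cholesky factor of \<open>A\<close>.\<close>

definition trunc_cov ::
  "real \<Rightarrow> real^'d::{finite,linorder}^'d::{finite,linorder} \<Rightarrow> nat \<Rightarrow> nat \<Rightarrow> (nat \<Rightarrow> real^'d::{finite,linorder}) \<Rightarrow> real^'d::{finite,linorder}^'d::{finite,linorder}" where
  "trunc_cov \<theta> A k s x =
     (1 / real k) *\<^sub>R (\<Sum>i=1..k. trunc_weight \<theta> (norm (matrix_inv (cholesky A) *v x (s + i)))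
                                 *\<^sub>R outer (x (s + i)))"

primrec reg_level :: "real \<Rightarrow> nat \<Rightarrow> real" where
  "reg_level L 0 = L"
| "reg_level L (Suc t) = reg_level L t / 2"

primrec cov_iter ::
  "real \<Rightarrow> real \<Rightarrow> nat \<Rightarrow> (nat \<Rightarrow> real^'d::{finite,linorder}) \<Rightarrow> nat \<Rightarrow> real^'d::{finite,linorder}^'d::{finite,linorder}" where
  "cov_iter \<theta> L m x 0 =
     (1 / real m) *\<^sub>R (\<Sum>i=1..m. trunc_weight \<theta> (norm (x i) / sqrt L) *\<^sub>R outer (x i))"
| "cov_iter \<theta> L m x (Suc t) =
     trunc_cov \<theta> (reg (reg_level L t) (cov_iter \<theta> L m x t)) m (m * (t + 1)) x"

definition num_rounds :: "real \<Rightarrow> real \<Rightarrow> nat" where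
  "num_rounds lam L = nat \<lceil>log 2 (L / lam)\<rceil>"

definition final_level :: "real \<Rightarrow> nat \<Rightarrow> nat \<Rightarrow> real \<Rightarrow> real" where
  "final_level \<delta> d T \<theta> =
     2 * \<theta> * sqrt (real (T + 1)) * sqrt (1 + ln (real (T + 1)) / ln (4 * real d / \<delta>))"

definition algorithm_A ::
  "nat \<Rightarrow> real \<Rightarrow> real \<Rightarrow> real \<Rightarrow> real \<Rightarrow> (nat \<Rightarrow> real^'d::{finite,linorder}) \<Rightarrow> real^'d::{finite,linorder}^'d::{finite,linorder}" where
  "algorithm_A n \<delta> lam L \<theta> x =
     (let T = num_rounds lam L;
          m = n div (2 * (T + 1));
          r = n - m * (T + 1)
      in trunc_cov (final_level \<delta> CARD('d) T \<theta>) (reg (reg_level L T) (cov_iter \<theta> L m x T)) r (n - r) x)"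

end

theory Submission
  imports Defs
begin

text \<open>
  The proof whitens, truncates and recurses.  Fix a positive definite matrix \<open>A\<close> with
  \<open>S + \<mu> I \<le> 2 A\<close> (as quadratic forms) and let \<open>K A K\<^sup>T = I\<close>.  The truncated terms
  \<open>Y = \<rho>(\<bar>K X\<bar>) (K X)(K X)\<^sup>T\<close> lie between \<open>0\<close> and \<open>\<theta> I\<close>, and the kurtosis bound gives
  \<open>E Y\<^sup>2 \<le> \<kappa>\<^sup>4 tr(H) \<bar>H\<bar> \<le> v\<close> with \<open>H = K S K\<^sup>T\<close>; here \<open>\<bar>H\<bar> \<le> 2\<close>, and \<open>tr H\<close> is at most twice the effective
  dimension of \<open>S\<close> at level \<open>\<mu>\<close> (lemma \<open>trace_whitened_le_df\<close>).  A matrix Bernstein inequality bounds the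
  fluctuation of the average of \<open>b\<close> such terms by \<open>\<theta> l / b + v / \<theta>\<close>, except with probability
  \<open>2 d exp (- l)\<close>, and truncation costs a further bias of at most \<open>v / \<theta>\<close>.  In the original coordinates
  one batch therefore estimates \<open>S\<close> up to \<open>e A\<close>, with \<open>e = \<theta> l / b + 2 v / \<theta>\<close>
  (lemma \<open>whitened_truncated_covariance_deviation\<close>).

  The iteration keeps the invariant \<open>S + \<mu> I \<le> 2 A\<close> and \<open>2 A \<le> 3 (S + \<mu> I)\<close>.  It holds for \<open>A = L I\<close>,
  \<open>\<mu> = L\<close>, because \<open>S \<le> L I\<close>; and if \<open>e \<le> 1/6\<close>, replacing \<open>A\<close> by the regularized new estimate
  restores it with \<open>\<mu>\<close> halved, since \<open>(1/6) (3/2) 2 = 1/2\<close> (lemma \<open>refinement_step\<close>).  Every batch is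
  independent of the matrix that whitens it, so a Fubini argument reduces each round to the case of a fixed
  \<open>A\<close> (lemma \<open>batch_deviation\<close>).  The prescribed \<open>\<theta>\<close> and the lower bound on \<open>n\<close> make
  \<open>e \<le> 1/8\<close> in the rounds, and the larger final level balances the two terms of \<open>e\<close> for the
  logarithm without \<open>q\<close>; both computations are instances of lemma \<open>truncation_tradeoff\<close>.  The final
  error is \<open>(3/2) 12 \<kappa>\<^sup>2\<close> times the rate, well inside the constant \<open>48\<close>.  The
  failure probabilities \<open>\<delta>/(2 q)\<close> of the \<open>q\<close> preliminary batches and \<open>\<delta>/2\<close> of the last one add up to \<open>\<delta>\<close>.

  The matrix Bernstein inequality is proved by the Ahlswede-Winter argument: the Golden-Thompson inequality
  peels one independent summand at a time off the trace of the exponential of the sum.  Golden-Thompson is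
  derived from the inequality \<open>tr (C D)\<^sup>N \<le> tr (C\<^sup>N D\<^sup>N)\<close> for symmetric matrices and \<open>N\<close> a power of two,
  in the limit of \<open>C = I + A/N\<close>, \<open>D = I + B/N\<close>.
\<close>

section \<open>Orthonormal bases and the spectral theorem\<close>

text \<open>An orthonormal basis is indexed by the coordinate type itself, so that it has the right cardinality by
  construction and is the family of rows of an orthogonal matrix.\<close>

definition onb :: "('n \<Rightarrow> real^'n) \<Rightarrow> bool" where
  "onb b \<longleftrightarrow> (\<forall>i j. b i \<bullet> b j = (if i = j then 1 else 0))"

lemma onb_inner: "onb b \<Longrightarrow> b i \<bullet> b j = (if i = j then 1 else 0)"
  by (simp add: onb_def)

lemma onb_norm: "onb b \<Longrightarrow> norm (b i) = 1"
  by (simp add: onb_def norm_eq_sqrt_inner)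

lemma onb_matrix:
  fixes b :: "'n \<Rightarrow> real^'n"
  assumes "onb b"
  shows "(\<chi> i. b i) ** transpose (\<chi> i. b i) = mat 1" "transpose (\<chi> i. b i) ** (\<chi> i. b i) = mat 1"
proof -
  show 1: "(\<chi> i. b i) ** transpose (\<chi> i. b i) = mat 1"
    using assms by (simp add: vec_eq_iff matrix_matrix_mult_def transpose_def mat_def onb_def inner_vec_def)
  then show "transpose (\<chi> i. b i) ** (\<chi> i. b i) = mat 1"
    by (simp add: matrix_left_right_inverse)
qed

lemma onb_expand:
  fixes x :: "real^'n"
  assumes "onb b"
  shows "x = (\<Sum>i\<in>UNIV. (b i \<bullet> x) *\<^sub>R b i)"
proof -
  have "x = transpose (\<chi> i. b i) *v ((\<chi> i. b i) *v x)"
    by (simp only: matrix_vector_mul_assoc onb_matrix[OF assms] matrix_vector_mul_lid)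
  also have "\<dots> = (\<Sum>i\<in>UNIV. (b i \<bullet> x) *\<^sub>R b i)"
    by (simp add: vec_eq_iff matrix_vector_mult_def transpose_def inner_vec_def mult.commute)
  finally show ?thesis .
qed

lemma onb_parseval:
  fixes x y :: "real^'n"
  assumes "onb b"
  shows "x \<bullet> y = (\<Sum>i\<in>UNIV. (b i \<bullet> x) * (b i \<bullet> y))"
proof -
  have "x \<bullet> y = (\<Sum>i\<in>UNIV. (b i \<bullet> x) *\<^sub>R b i) \<bullet> y" using onb_expand[OF assms, of x] by simp
  then show ?thesis by (simp add: inner_sum_left)
qed

lemma matrix_eq_on_onb:
  fixes A B :: "real^'n^'n"
  assumes "onb b" and "\<And>i. A *v b i = B *v b i"
  shows "A = B"
proof -
  have "A *v x = B *v x" for x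
    by (subst (1 2) onb_expand[OF assms(1), of x]) (simp add: linear_sum[OF matrix_vector_mul_linear] matrix_vector_mult_scaleR assms(2))
  then show ?thesis by (simp add: matrix_eq)
qed

lemma trace_onb:
  fixes A :: "real^'n^'n"
  assumes "onb b"
  shows "trace A = (\<Sum>i\<in>UNIV. b i \<bullet> (A *v b i))"
proof -
  let ?Q = "(\<chi> i. b i)"
  have "trace A = trace (transpose ?Q ** (?Q ** A))"
    by (simp only: matrix_mul_assoc onb_matrix[OF assms] matrix_mul_lid)
  also have "\<dots> = trace ((?Q ** A) ** transpose ?Q)" by (rule trace_mul_sym)
  also have "\<dots> = (\<Sum>i\<in>UNIV. b i \<bullet> (A *v b i))"
  proof -
    have "((?Q ** A) ** transpose ?Q) $ i $ i = b i \<bullet> (A *v b i)" for i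
    proof -
      have "((?Q ** A) ** transpose ?Q) $ i $ i = ((b i) v* A) \<bullet> b i"
        by (simp add: matrix_matrix_mult_def transpose_def inner_vec_def vector_matrix_mult_def mult.commute)
      then show ?thesis by (simp add: dot_lmul_matrix)
    qed
    then show ?thesis by (simp add: trace_def)
  qed
  finally show ?thesis .
qed

lemma symmetric_inner:
  fixes A :: "real^'n^'n"
  assumes "transpose A = A"
  shows "x \<bullet> (A *v y) = (A *v x) \<bullet> y"
  using assms by (metis dot_lmul_matrix transpose_matrix_vector)

text \<open>At a maximizer \<open>u\<close> of the Rayleigh quotient the nonnegative form \<open>\<mu> \<bar>x\<bar>\<^sup>2 - x \<bullet> A x\<close> vanishes, so it has
  no linear term at \<open>u\<close>: moving from \<open>u\<close> in the direction \<open>w = A u - \<mu> u\<close> would otherwise make it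
  negative.  Hence \<open>w = 0\<close>.\<close>

lemma maximizer_is_eigenvector:
  fixes A :: "real^'n^'n"
  assumes sym: "transpose A = A" and V: "subspace V" and inv: "\<And>x. x \<in> V \<Longrightarrow> A *v x \<in> V"
    and u: "u \<in> V" "norm u = 1" and max: "\<And>x. x \<in> V \<Longrightarrow> norm x = 1 \<Longrightarrow> x \<bullet> (A *v x) \<le> u \<bullet> (A *v u)"
  shows "A *v u = (u \<bullet> (A *v u)) *\<^sub>R u"
proof -
  let ?m = "u \<bullet> (A *v u)"
  define B where "B x = ?m * (x \<bullet> x) - x \<bullet> (A *v x)" for x
  have Bnn: "B x \<ge> 0" if "x \<in> V" for x
  proof (cases "x = 0")
    case False
    have "(x /\<^sub>R norm x) \<in> V" "norm (x /\<^sub>R norm x) = 1"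
      using that False V by (auto simp: subspace_mul)
    from max[OF this] have "(x \<bullet> (A *v x)) / (norm x)\<^sup>2 \<le> ?m"
      by (simp add: matrix_vector_mult_scaleR power2_eq_square field_simps)
    then show ?thesis using False by (simp add: B_def field_simps dot_square_norm)
  qed (simp add: B_def)
  define w where "w = A *v u - ?m *\<^sub>R u"
  have wV: "w \<in> V" unfolding w_def using V inv u by (simp add: subspace_diff subspace_mul)
  have uu: "u \<bullet> u = 1" using u by (simp add: dot_square_norm)
  have exp: "B (u + t *\<^sub>R w) = t\<^sup>2 * B w - 2 * t * (w \<bullet> w)" for t
  proof -
    have s: "u \<bullet> (A *v w) = w \<bullet> (A *v u)" using symmetric_inner[OF sym, of u w] by (simp add: inner_commute)
    have ww: "w \<bullet> w = w \<bullet> (A *v u) - ?m * (w \<bullet> u)" 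
    proof -
      have "w \<bullet> w = w \<bullet> (A *v u - ?m *\<^sub>R u)" using w_def by simp
      then show ?thesis by (simp only: inner_diff_right inner_scaleR_right)
    qed
    show ?thesis
      unfolding B_def matrix_vector_right_distrib matrix_vector_mult_scaleR inner_add_left inner_add_right inner_scaleR_left inner_scaleR_right s ww uu
      by (simp add: algebra_simps power2_eq_square inner_commute[of u w])
  qed
  have "w \<bullet> w = 0"
  proof (rule ccontr)
    assume "w \<bullet> w \<noteq> 0"
    then have p: "w \<bullet> w > 0" by simp
    have Bw: "B w \<ge> 0" using Bnn wV by blast
    define t where "t = (w \<bullet> w) / (B w + 1)"
    have t: "t > 0" "t * B w < 2 * (w \<bullet> w)" 
      using p Bw by (auto simp: t_def field_simps intro: add_nonneg_pos)
    have "B (u + t *\<^sub>R w) = t * (t * B w - 2 * (w \<bullet> w))" by (simp add: exp algebra_simps power2_eq_square)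
    also have "\<dots> < 0" using t by (simp add: mult_pos_neg)
    finally show False using Bnn[of "u + t *\<^sub>R w"] u wV V by (simp add: subspace_add subspace_mul)
  qed
  then show ?thesis by (simp add: w_def)
qed

text \<open>Induction on the dimension: split off a maximizer \<open>u\<close> of the Rayleigh quotient; its orthogonal
  complement in the subspace is again invariant because \<open>A\<close> is symmetric.\<close>

lemma invariant_subspace_eigenbasis:
  fixes A :: "real^'n^'n"
  assumes sym: "transpose A = A" and "subspace V" and "\<And>x. x \<in> V \<Longrightarrow> A *v x \<in> V" and "dim V = k"
  shows "\<exists>B. B \<subseteq> V \<and> pairwise orthogonal B \<and> (\<forall>x\<in>B. norm x = 1) \<and> card B = k \<and> finite B \<and> (\<forall>x\<in>B. \<exists>l. A *v x = l *\<^sub>R x)"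
  using assms(2-)
proof (induction k arbitrary: V)
  case 0
  then show ?case by (intro exI[of _ "{}"]) auto
next
  case (Suc k)
  let ?K = "V \<inter> sphere 0 1"
  have "compact ?K" using Suc.prems(1) by (simp add: closed_subspace compact_Int_closed closed_Int_compact)
  moreover have "?K \<noteq> {}"
  proof -
    obtain x where "x \<in> V" "x \<noteq> 0" using Suc.prems(3) dim_eq_0[of V] by auto
    then have "x /\<^sub>R norm x \<in> ?K" using Suc.prems(1) by (auto simp: subspace_mul)
    then show ?thesis by blast
  qed
  moreover have "continuous_on ?K (\<lambda>x. x \<bullet> (A *v x))"
    by (intro continuous_intros matrix_vector_mult_linear_continuous_on)
  ultimately obtain u where u: "u \<in> ?K" "\<forall>x\<in>?K. x \<bullet> (A *v x) \<le> u \<bullet> (A *v u)"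
    using continuous_attains_sup by (metis (no_types, lifting))
  have eig: "A *v u = (u \<bullet> (A *v u)) *\<^sub>R u"
    using u by (intro maximizer_is_eigenvector[OF sym Suc.prems(1,2)]) auto
  define V' where "V' = {x \<in> V. x \<bullet> u = 0}"
  have sub: "subspace V'"
    using Suc.prems(1) by (auto simp: V'_def subspace_def inner_add_left)
  have inv: "A *v x \<in> V'" if "x \<in> V'" for x
  proof -
    have "(A *v x) \<bullet> u = x \<bullet> (A *v u)" by (simp add: symmetric_inner[OF sym])
    also have "\<dots> = 0" using that by (subst eig) (simp add: V'_def)
    finally show ?thesis using that Suc.prems(2) by (simp add: V'_def)
  qed
  have "dim V' = k"
  proof -
    have nz: "u \<noteq> 0" using u by auto
    have "span {u} \<subseteq> V" using u Suc.prems(1) by (simp add: span_minimal)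
    have *: "{y \<in> span V. \<forall>x\<in>span {u}. orthogonal x y} = V'"
    proof -
      have "(\<forall>x\<in>span {u}. orthogonal x y) \<longleftrightarrow> y \<bullet> u = 0" for y
        by (auto simp: span_singleton orthogonal_def inner_commute)
      then show ?thesis using Suc.prems(1) by (auto simp: V'_def span_eq_iff[THEN iffD2])
    qed
    have "dim {y \<in> span V. \<forall>x\<in>span {u}. orthogonal x y} + dim (span {u}) = dim (span V)"
      using \<open>span {u} \<subseteq> V\<close> Suc.prems(1) by (intro dim_subspace_orthogonal_to_vectors) (auto simp: span_eq_iff[THEN iffD2])
    then show ?thesis unfolding * using nz Suc.prems(3) by (simp add: dim_span dim_singleton)
  qed
  from Suc.IH[OF sub inv this] obtain B where B: "B \<subseteq> V'" "pairwise orthogonal B" "\<forall>x\<in>B. norm x = 1" "card B = k" "finite B" "\<forall>x\<in>B. \<exists>l. A *v x = l *\<^sub>R x"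
    by blast
  have "u \<notin> B" using B(1) u by (auto simp: V'_def dot_square_norm)
  moreover have "pairwise orthogonal (insert u B)"
    using B(1,2) by (auto simp: pairwise_insert V'_def orthogonal_def inner_commute)
  ultimately show ?case
    using B u eig by (intro exI[of _ "insert u B"]) (auto simp: V'_def)
qed

theorem spectral_theorem:
  fixes A :: "real^'n^'n"
  assumes "transpose A = A"
  obtains b l where "onb b" "\<And>i. A *v b i = l i *\<^sub>R b i"
proof -
  have "dim (UNIV :: (real^'n) set) = CARD('n)" by simp
  from invariant_subspace_eigenbasis[OF assms subspace_UNIV _ this]
  obtain B :: "(real^'n) set" where B: "pairwise orthogonal B" "\<forall>x\<in>B. norm x = 1" "card B = CARD('n)" "finite B" "\<forall>x\<in>B. \<exists>l. A *v x = l *\<^sub>R x"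
    by auto
  obtain b :: "'n \<Rightarrow> real^'n" where b: "bij_betw b UNIV B"
    using B(3,4) finite_same_card_bij[of "UNIV :: 'n set" B] by auto
  have "onb b"
    unfolding onb_def
  proof (intro allI)
    fix i j
    have m: "b i \<in> B" "b j \<in> B" using b by (auto simp: bij_betw_def)
    show "b i \<bullet> b j = (if i = j then 1 else 0)"
    proof (cases "i = j")
      case True
      then show ?thesis using B(2) m by (simp add: dot_square_norm)
    next
      case False
      then have "b i \<noteq> b j" using b by (auto simp: bij_betw_def inj_on_def)
      then show ?thesis using B(1) m False by (simp add: pairwise_def orthogonal_def)
    qed
  qed
  moreover have "\<exists>l. A *v b i = l *\<^sub>R b i" for i using B(5) b by (auto simp: bij_betw_def)
  then obtain l where "\<And>i. A *v b i = l i *\<^sub>R b i" by metis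
  ultimately show ?thesis by (rule that)
qed

section \<open>Positive definite matrices, square roots and Cholesky factors\<close>

lemma inner_transpose:
  fixes K :: "real^'n^'m" shows "x \<bullet> (transpose K *v y) = (K *v x) \<bullet> y"
  by (metis dot_lmul_matrix inner_commute transpose_matrix_vector)

lemma outer_mult_vector: "outer x *v y = (x \<bullet> y) *\<^sub>R x"
  by (simp add: vec_eq_iff outer_def matrix_vector_mult_def inner_vec_def sum_distrib_left sum_distrib_right mult_ac)

lemma transpose_outer: "transpose (outer x) = outer x"
  by (simp add: vec_eq_iff outer_def transpose_def mult.commute)

lemma transpose_sum: "transpose (\<Sum>i\<in>I. f i) = (\<Sum>i\<in>I. transpose (f i :: real^'n^'m))"
  by (induction I rule: infinite_finite_induct) (auto simp: vec_eq_iff transpose_def)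

lemma sum_matrix_vector: "(\<Sum>i\<in>I. f i) *v x = (\<Sum>i\<in>I. (f i :: real^'n^'m) *v x)"
  by (induction I rule: infinite_finite_induct) (auto simp: matrix_vector_mult_add_rdistrib)

lemma inner_outer: "u \<bullet> (outer x *v u) = (x \<bullet> u)\<^sup>2"
  by (simp add: outer_mult_vector power2_eq_square inner_commute)

definition spectral_sum :: "('n \<Rightarrow> real^'n) \<Rightarrow> ('n \<Rightarrow> real) \<Rightarrow> real^'n^'n" where
  "spectral_sum b l = (\<Sum>i\<in>UNIV. l i *\<^sub>R outer (b i))"

lemma spectral_sum_eigenvector:
  assumes "onb b" shows "spectral_sum b l *v b j = l j *\<^sub>R b j"
proof -
  have "spectral_sum b l *v b j = (\<Sum>i\<in>UNIV. if j = i then l i *\<^sub>R b i else 0)"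
    unfolding spectral_sum_def sum_matrix_vector
    by (intro sum.cong refl) (simp add: scaleR_matrix_vector_assoc[symmetric] outer_mult_vector onb_inner[OF assms] eq_commute)
  then show ?thesis by simp
qed

lemma transpose_spectral_sum: "transpose (spectral_sum b l) = spectral_sum b l"
  by (simp add: spectral_sum_def transpose_sum transpose_scalar transpose_outer)

lemma quadratic_form_eigen:
  fixes A :: "real^'n^'n"
  assumes "onb b" "\<And>i. A *v b i = l i *\<^sub>R b i" "transpose A = A"
  shows "x \<bullet> (A *v x) = (\<Sum>i\<in>UNIV. l i * (b i \<bullet> x)\<^sup>2)"
  unfolding onb_parseval[OF assms(1), of x]
  by (intro sum.cong refl) (simp add: symmetric_inner[OF assms(3)] assms(2) power2_eq_square)

lemma eigenvalue_eq: "norm b = 1 \<Longrightarrow> A *v b = l *\<^sub>R b \<Longrightarrow> l = b \<bullet> (A *v b)"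
  by (simp add: dot_square_norm)

definition pd :: "real^'n^'n \<Rightarrow> bool" where
  "pd A \<longleftrightarrow> transpose A = A \<and> (\<forall>x. x \<noteq> 0 \<longrightarrow> 0 < x \<bullet> (A *v x))"

lemma pd_imp_psd: "pd A \<Longrightarrow> psd A"
  unfolding pd_def psd_def by (metis inner_zero_left less_eq_real_def)

lemma psd_spectral_sum:
  assumes "onb b" "\<And>i. l i \<ge> 0" shows "psd (spectral_sum b l)"
  unfolding psd_def
  by (auto simp: transpose_spectral_sum assms
      quadratic_form_eigen[OF assms(1) spectral_sum_eigenvector[OF assms(1)] transpose_spectral_sum] intro!: sum_nonneg)

text \<open>For uniqueness, \<open>C\<^sup>2 = B\<^sup>2\<close> forces \<open>(C + l) (C - l) b = 0\<close> on an eigenvector \<open>b\<close> of \<open>B\<close> with eigenvalue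
  \<open>l\<close>, and \<open>C + l\<close> is injective when \<open>l > 0\<close>, while \<open>C\<^sup>2 b = 0\<close> forces \<open>C b = 0\<close>; so \<open>C\<close> agrees with \<open>B\<close>
  on an eigenbasis.\<close>

lemma psd_sqrt_exists_unique:
  assumes "psd A" shows "\<exists>!B. psd B \<and> B ** B = A"
proof (rule ex_ex1I)
  have sym: "transpose A = A" using assms by (simp add: psd_def)
  obtain b l where b: "onb b" "\<And>i. A *v b i = l i *\<^sub>R b i" using spectral_theorem[OF sym] by blast
  have l: "l i \<ge> 0" for i
    using assms eigenvalue_eq[OF onb_norm[OF b(1)] b(2), of i] by (simp add: psd_def)
  let ?B = "spectral_sum b (\<lambda>i. sqrt (l i))"
  have "?B ** ?B = A"
    by (rule matrix_eq_on_onb[OF b(1)])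
      (simp add: matrix_vector_mul_assoc[symmetric] spectral_sum_eigenvector[OF b(1)] matrix_vector_mult_scaleR b(2) l)
  then show "\<exists>B. psd B \<and> B ** B = A" using psd_spectral_sum[OF b(1), of "\<lambda>i. sqrt (l i)"] l by auto
next
  fix B C assume B: "psd B \<and> B ** B = A" and C: "psd C \<and> C ** C = A"
  have symB: "transpose B = B" and symC: "transpose C = C" using B C by (auto simp: psd_def)
  obtain b l where b: "onb b" "\<And>i. B *v b i = l i *\<^sub>R b i" using spectral_theorem[OF symB] by blast
  have l: "l i \<ge> 0" for i
    using B eigenvalue_eq[OF onb_norm[OF b(1)] b(2), of i] by (simp add: psd_def)
  show "B = C"
  proof (rule matrix_eq_on_onb[OF b(1)])
    fix i
    have CC: "C *v (C *v b i) = (l i)\<^sup>2 *\<^sub>R b i"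
    proof -
      have "C *v (C *v b i) = B *v (B *v b i)" using B C by (simp add: matrix_vector_mul_assoc)
      then show ?thesis by (simp add: b(2) matrix_vector_mult_scaleR power2_eq_square)
    qed
    define v where "v = C *v b i - l i *\<^sub>R b i"
    have Cv: "C *v v = - l i *\<^sub>R v"
      by (simp add: v_def matrix_vector_mult_diff_distrib matrix_vector_mult_scaleR CC scaleR_diff_right power2_eq_square)
    have "v = 0"
    proof (cases "l i = 0")
      case True
      have "v \<bullet> v = b i \<bullet> (C *v (C *v b i))" 
        by (simp add: v_def True symmetric_inner[OF symC])
      also have "\<dots> = 0" using CC True by simp
      finally show ?thesis by simp
    next
      case False
      have "0 \<le> v \<bullet> (C *v v)" using C by (simp add: psd_def)
      also have "\<dots> = - l i * (v \<bullet> v)" by (simp add: Cv)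
      finally have "l i * (v \<bullet> v) \<le> 0" by simp
      moreover have "l i > 0" using False l[of i] by simp
      ultimately have "v \<bullet> v \<le> 0" by (simp add: mult_le_0_iff)
      then show ?thesis by (metis inner_ge_zero inner_eq_zero_iff order_antisym)
    qed
    then show "B *v b i = C *v b i" by (simp add: v_def b(2))
  qed
qed

lemma psd_sqrt_works:
  assumes "psd A" shows "psd (psd_sqrt A)" "psd_sqrt A ** psd_sqrt A = A"
  using theI'[OF psd_sqrt_exists_unique[OF assms]] by (auto simp: psd_sqrt_def)

lemma matrix_inv_works:
  fixes A :: "real^'n^'n"
  assumes "A ** B = mat 1 \<or> B ** A = mat 1"
  shows "A ** matrix_inv A = mat 1" "matrix_inv A ** A = mat 1"
proof -
  have "\<exists>A'. A ** A' = mat 1 \<and> A' ** A = mat 1" using assms matrix_left_right_inverse by blast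
  from someI_ex[OF this] show "A ** matrix_inv A = mat 1" "matrix_inv A ** A = mat 1"
    by (auto simp: matrix_inv_def)
qed

lemma pd_invertible:
  fixes A :: "real^'n^'n"
  assumes "pd A" shows "A ** matrix_inv A = mat 1" "matrix_inv A ** A = mat 1"
proof -
  have "A *v x = 0 \<longrightarrow> x = 0" for x
    using assms by (metis inner_zero_right less_irrefl pd_def)
  then have "\<exists>B. B ** A = mat 1" by (simp add: matrix_left_invertible_ker)
  then show "A ** matrix_inv A = mat 1" "matrix_inv A ** A = mat 1" using matrix_inv_works[of A] by blast+
qed

lemma inv_sqrt_whitens:
  fixes A :: "real^'n^'n"
  assumes "pd A"
  shows "transpose (inv_sqrt A) = inv_sqrt A" "inv_sqrt A ** A ** inv_sqrt A = mat 1"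
proof -
  let ?B = "psd_sqrt A" let ?K = "matrix_inv ?B"
  note B = psd_sqrt_works[OF pd_imp_psd[OF assms]]
  have "?B ** (?B ** matrix_inv A) = mat 1" by (simp add: matrix_mul_assoc B(2) pd_invertible[OF assms])
  then have K: "?B ** ?K = mat 1" "?K ** ?B = mat 1" using matrix_inv_works[of ?B] by blast+
  have "transpose ?K ** ?B = transpose (?B ** ?K)" using B(1) by (simp add: matrix_transpose_mul psd_def)
  then have "transpose ?K ** ?B = mat 1" by (simp add: K)
  then have "transpose ?K ** ?B ** ?K = ?K" by simp
  then show "transpose (inv_sqrt A) = inv_sqrt A" by (simp add: matrix_mul_assoc[symmetric] K inv_sqrt_def)
  have "?K ** A ** ?K = (?K ** ?B) ** (?B ** ?K)" using B(2) by (metis matrix_mul_assoc)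
  then show "inv_sqrt A ** A ** inv_sqrt A = mat 1" by (simp add: K inv_sqrt_def)
qed

text \<open>Gram-Schmidt on the rows of \<open>B\<close>, in the order of the index type, written without recursion: the
  \<open>i\<close>-th new vector is the normalized component of row \<open>i\<close> orthogonal to the span of the rows before it.
  Row \<open>i\<close> is orthogonal to all later new vectors, which is triangularity.  A column of the inverse of
  \<open>B\<close> shows that row \<open>i\<close> is not in the span of the rows before it.\<close>

lemma gram_schmidt_factor:
  fixes B :: "real^'d::{finite,linorder}^'d::{finite,linorder}"
  assumes "invertible B"
  shows "\<exists>R. (\<forall>i j. i < j \<longrightarrow> R $ i $ j = 0) \<and> (\<forall>i. 0 < R $ i $ i) \<and> R ** transpose R = B ** transpose B"
proof -
  define V where "V i = span ((\<lambda>j. B $ j) ` {..<i})" for i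
  have "\<exists>y z. B $ i = z + y \<and> z \<in> V i \<and> (\<forall>w\<in>V i. y \<bullet> w = 0)" for i
  proof -
    obtain z y where "z \<in> span ((\<lambda>j. B $ j) ` {..<i})" "\<And>w. w \<in> span ((\<lambda>j. B $ j) ` {..<i}) \<Longrightarrow> orthogonal y w" "B $ i = z + y"
      using orthogonal_subspace_decomp_exists[of "(\<lambda>j. B $ j) ` {..<i}" "B $ i"] by metis
    then show ?thesis unfolding V_def orthogonal_def by blast
  qed
  then obtain y z where yz: "\<And>i. B $ i = z i + y i" "\<And>i. z i \<in> V i" "\<And>i w. w \<in> V i \<Longrightarrow> y i \<bullet> w = 0"
    by metis
  obtain C where C: "B ** C = mat 1" using assms by (auto simp: invertible_def)
  have dual: "B $ j \<bullet> column i C = (if i = j then 1 else 0)" for i j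
  proof -
    have "B $ j \<bullet> column i C = (B ** C) $ j $ i" by (simp add: inner_vec_def matrix_matrix_mult_def column_def)
    then show ?thesis by (simp add: C mat_def)
  qed
  have nz: "y i \<noteq> 0" for i
  proof
    assume "y i = 0"
    then have "B $ i \<in> V i" using yz(1,2)[of i] by simp
    moreover have "V i \<subseteq> {x. column i C \<bullet> x = 0}"
      unfolding V_def
      by (rule span_minimal[OF _ subspace_hyperplane]) (use dual in \<open>auto simp: inner_commute\<close>)
    ultimately show False using dual[of i i] by (auto simp: inner_commute)
  qed
  have mem: "B $ i \<in> V j" if "i < j" for i j
    unfolding V_def using that by (intro span_base) auto
  have Vmono: "V i \<subseteq> V j" if "i < j" for i j
    unfolding V_def using that by (intro span_mono) auto
  have ymem: "y i \<in> V j" if "i < j" for i j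
  proof -
    have "y i = B $ i - z i" using yz(1) by simp
    then show ?thesis using mem[OF that] yz(2)[of i] Vmono[OF that] unfolding V_def
      by (metis span_diff subsetD)
  qed
  define p where "p i = y i /\<^sub>R norm (y i)" for i
  have "onb p"
    unfolding onb_def
  proof (intro allI)
    fix i j
    show "p i \<bullet> p j = (if i = j then 1 else 0)"
      using yz(3)[OF ymem[of i j]] yz(3)[OF ymem[of j i]] nz[of i]
      by (cases i j rule: linorder_cases) (auto simp: p_def inner_commute dot_square_norm power2_eq_square)
  qed
  let ?P = "\<chi> i. p i"
  let ?R = "B ** transpose ?P"
  have R: "?R $ i $ j = B $ i \<bullet> p j" for i j
    by (simp add: matrix_matrix_mult_def transpose_def inner_vec_def)
  have "?R ** transpose ?R = B ** (transpose ?P ** ?P) ** transpose B"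
    by (simp add: matrix_transpose_mul matrix_mul_assoc)
  also have "\<dots> = B ** transpose B" by (simp add: onb_matrix[OF \<open>onb p\<close>])
  finally have "?R ** transpose ?R = B ** transpose B" .
  moreover have "?R $ i $ j = 0" if "i < j" for i j
    unfolding R using yz(3)[OF mem[OF that]] by (simp add: p_def inner_commute)
  moreover have "?R $ i $ i > 0" for i
  proof -
    have "y i \<bullet> z i = 0" using yz(2,3) by blast
    then have "B $ i \<bullet> p i = norm (y i)"
      using nz[of i] by (simp add: yz(1) p_def inner_add_left inner_commute[of "z i"] dot_square_norm power2_eq_square)
    then show ?thesis unfolding R using nz by simp
  qed
  ultimately show ?thesis by blast
qed

text \<open>The product \<open>R R\<^sup>T\<close> determines the columns of \<open>R\<close> one after the other; the induction is on the number of
  columns before the current one.\<close>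

lemma cholesky_factor_unique:
  fixes R Q :: "real^'d::{finite,linorder}^'d::{finite,linorder}"
  assumes R: "\<And>i j. i < j \<Longrightarrow> R $ i $ j = 0" "\<And>i. 0 < R $ i $ i"
    and Q: "\<And>i j. i < j \<Longrightarrow> Q $ i $ j = 0" "\<And>i. 0 < Q $ i $ i"
    and eq: "R ** transpose R = Q ** transpose Q"
  shows "R = Q"
proof -
  have entry: "(P ** transpose P) $ i $ j = P $ i $ j * P $ j $ j + (\<Sum>k\<in>{..<j}. P $ i $ k * P $ j $ k)"
    if "\<And>i j. i < j \<Longrightarrow> P $ i $ j = (0::real)" for P :: "real^'d::{finite,linorder}^'d::{finite,linorder}" and i j
  proof -
    have "(P ** transpose P) $ i $ j = (\<Sum>k\<in>UNIV. P $ i $ k * P $ j $ k)"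
      by (simp add: matrix_matrix_mult_def transpose_def)
    also have "\<dots> = (\<Sum>k\<in>insert j {..<j}. P $ i $ k * P $ j $ k)"
      by (rule sum.mono_neutral_right) (auto simp: not_less that)
    finally show ?thesis by simp
  qed
  have "\<forall>i. R $ i $ j = Q $ i $ j" for j
  proof (induction "card {..<j}" arbitrary: j rule: less_induct)
    case less
    have IH: "R $ i $ k = Q $ i $ k" if "k < j" for i k
      using less[of k] that by (metis finite_lessThan finite lessThan_strict_subset_iff psubset_card_mono)
    have "R $ i $ j * R $ j $ j = Q $ i $ j * Q $ j $ j" for i
      using eq entry[OF R(1), of i j] entry[OF Q(1), of i j] IH by simp
    from this[of j] this show ?case
      using R(2)[of j] Q(2)[of j]
      by (metis less_eq_real_def less_irrefl mult_right_cancel power2_eq_iff_nonneg power2_eq_square)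
  qed
  then show ?thesis by (simp add: vec_eq_iff)
qed

lemma cholesky_factorization:
  fixes A :: "real^'d::{finite,linorder}^'d::{finite,linorder}"
  assumes "pd A"
  shows "cholesky A ** transpose (cholesky A) = A"
proof -
  note B = psd_sqrt_works[OF pd_imp_psd[OF assms]]
  have "psd_sqrt A ** (psd_sqrt A ** matrix_inv A) = mat 1" by (simp add: matrix_mul_assoc B(2) pd_invertible[OF assms])
  then have inv: "invertible (psd_sqrt A)" using invertible_right_inverse by blast
  have BB: "psd_sqrt A ** transpose (psd_sqrt A) = A" using B by (simp add: psd_def)
  let ?P = "\<lambda>R. (\<forall>i j. i < j \<longrightarrow> R $ i $ j = 0) \<and> (\<forall>i. 0 < R $ i $ i) \<and> R ** transpose R = A"
  have "\<exists>!R. ?P R"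
  proof (rule ex_ex1I)
    show "\<exists>R. ?P R" using gram_schmidt_factor[OF inv] BB by simp
    fix R Q assume "?P R" "?P Q"
    then show "R = Q" by (metis cholesky_factor_unique)
  qed
  from theI'[OF this] show ?thesis by (simp add: cholesky_def)
qed

lemma cholesky_whitens:
  fixes A :: "real^'d::{finite,linorder}^'d::{finite,linorder}"
  assumes "pd A"
  shows "matrix_inv (cholesky A) ** A ** transpose (matrix_inv (cholesky A)) = mat 1"
proof -
  let ?R = "cholesky A" let ?K = "matrix_inv ?R"
  note R = cholesky_factorization[OF assms]
  have "?R ** (transpose ?R ** matrix_inv A) = mat 1" by (simp add: matrix_mul_assoc R pd_invertible[OF assms])
  then have K: "?K ** ?R = mat 1" using matrix_inv_works[of ?R] by blast
  have "?K ** (?R ** transpose ?R) ** transpose ?K = (?K ** ?R) ** transpose (?K ** ?R)"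
    by (simp only: matrix_transpose_mul matrix_mul_assoc)
  then have "?K ** A ** transpose ?K = (?K ** ?R) ** transpose (?K ** ?R)" by (simp only: R)
  then show ?thesis by (simp add: K)
qed

text \<open>Both the inverse Cholesky factor and the inverse square root whiten \<open>A\<close>; all that matters of a whitening
  matrix \<open>K\<close> is that \<open>K\<^sup>T K\<close> is the inverse of \<open>A\<close>.\<close>

lemma whitener_gram:
  fixes K A :: "real^'n^'n"
  assumes "K ** A ** transpose K = mat 1"
  shows "A ** (transpose K ** K) = mat 1"
  using assms by (metis matrix_left_right_inverse matrix_mul_assoc)

section \<open>Spectral norm and effective dimension\<close>

lemma norm_le_of_quadratic_form:
  fixes B :: "real^'n^'n"
  assumes sym: "transpose B = B" and le: "\<And>y. \<bar>y \<bullet> (B *v y)\<bar> \<le> e * (y \<bullet> y)"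
  shows "norm (B *v x) \<le> e * norm x"
proof -
  obtain b l where b: "onb b" "\<And>i. B *v b i = l i *\<^sub>R b i" using spectral_theorem[OF sym] by blast
  have l: "\<bar>l i\<bar> \<le> e" for i
    using le[of "b i"] onb_norm[OF b(1), of i] eigenvalue_eq[OF onb_norm[OF b(1)] b(2), of i] by (simp add: dot_square_norm)
  have e: "e \<ge> 0" using l[of undefined] by linarith
  have "(norm (B *v x))\<^sup>2 = (\<Sum>i\<in>UNIV. (l i)\<^sup>2 * (b i \<bullet> x)\<^sup>2)"
    unfolding power2_norm_eq_inner onb_parseval[OF b(1), of "B *v x"]
    by (intro sum.cong refl) (simp add: symmetric_inner[OF sym] b(2) power2_eq_square)
  also have "\<dots> \<le> (\<Sum>i\<in>UNIV. e\<^sup>2 * (b i \<bullet> x)\<^sup>2)"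
    by (intro sum_mono mult_right_mono) (use l e abs_le_square_iff in force)+
  also have "\<dots> = (e * norm x)\<^sup>2"
    by (simp only: power_mult_distrib power2_norm_eq_inner onb_parseval[OF b(1), of x x] sum_distrib_left power2_eq_square[of "b _ \<bullet> x"])
  finally show ?thesis by (rule power2_le_imp_le) (use e in simp)
qed

lemma spectral_norm_le:
  fixes B :: "real^'n^'n"
  assumes "transpose B = B" "\<And>y. \<bar>y \<bullet> (B *v y)\<bar> \<le> e * (y \<bullet> y)"
  shows "spectral_norm B \<le> e"
  unfolding spectral_norm_def by (rule onorm_le) (rule norm_le_of_quadratic_form[OF assms])

lemma norm_mult_le_spectral_norm:
  fixes A :: "real^'n^'n" shows "norm (A *v x) \<le> spectral_norm A * norm x"
  unfolding spectral_norm_def by (rule onorm) simp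

lemma quadratic_form_le_spectral_norm:
  fixes A :: "real^'n^'n" shows "x \<bullet> (A *v x) \<le> spectral_norm A * (x \<bullet> x)"
proof -
  have "x \<bullet> (A *v x) \<le> norm x * norm (A *v x)" by (rule norm_cauchy_schwarz)
  also have "\<dots> \<le> norm x * (spectral_norm A * norm x)" by (intro mult_left_mono norm_mult_le_spectral_norm) auto
  finally show ?thesis by (simp add: dot_square_norm power2_eq_square algebra_simps)
qed

lemma reg_mult_vector: "reg \<mu> A *v x = A *v x + \<mu> *\<^sub>R x"
  by (simp add: reg_def matrix_vector_mult_add_rdistrib scaleR_matrix_vector_assoc[symmetric])

lemma transpose_reg: "transpose (reg \<mu> A) = reg \<mu> (transpose A)"
  by (simp add: reg_def vec_eq_iff transpose_def mat_def)

lemma quadratic_form_reg: "x \<bullet> (reg \<mu> A *v x) = x \<bullet> (A *v x) + \<mu> * (x \<bullet> x)"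
  by (simp add: reg_mult_vector inner_add_right)

lemma pd_reg:
  assumes "psd A" "\<mu> > 0" shows "pd (reg \<mu> A)"
  using assms by (auto simp: pd_def psd_def transpose_reg quadratic_form_reg intro!: add_nonneg_pos)

lemma psd_eigenvalue_nonneg:
  assumes "psd A" "onb b" "\<And>i. A *v b i = l i *\<^sub>R b i" shows "l i \<ge> 0"
  using assms(1) eigenvalue_eq[OF onb_norm[OF assms(2)] assms(3), of i] by (simp add: psd_def)

lemma df_eq_sum:
  fixes S :: "real^'n^'n"
  assumes S: "psd S" and lam: "lam > 0" and b: "onb b" "\<And>i. S *v b i = s i *\<^sub>R b i"
  shows "df lam S = (\<Sum>i\<in>UNIV. s i / (s i + lam))"
proof -
  let ?A = "reg lam S"
  have s: "s i \<ge> 0" for i by (rule psd_eigenvalue_nonneg[OF S b])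
  have "S ** matrix_inv ?A *v b i = (s i / (s i + lam)) *\<^sub>R b i" for i
  proof -
    have ne: "s i + lam \<noteq> 0" using s[of i] lam by linarith
    have "?A *v b i = (s i + lam) *\<^sub>R b i" by (simp add: reg_mult_vector b(2) scaleR_add_left)
    then have "matrix_inv ?A *v ((s i + lam) *\<^sub>R b i) = b i"
      by (metis matrix_vector_mul_assoc pd_invertible(2)[OF pd_reg[OF S lam]] matrix_vector_mul_lid)
    then have "(s i + lam) *\<^sub>R (matrix_inv ?A *v b i) = b i" by (simp only: matrix_vector_mult_scaleR)
    then have "matrix_inv ?A *v b i = (1 / (s i + lam)) *\<^sub>R b i" using ne
      by (metis scaleR_scaleR scaleR_one divide_inverse_commute mult_1_right left_inverse)
    then show ?thesis by (simp add: matrix_vector_mul_assoc[symmetric] matrix_vector_mult_scaleR b(2))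
  qed
  then show ?thesis unfolding df_def trace_onb[OF b(1)] 
    by (simp add: dot_square_norm onb_norm[OF b(1)])
qed

lemma spectral_norm_le_some_eigenvalue:
  fixes S :: "real^'n^'n"
  assumes S: "psd S" and b: "onb b" "\<And>i. S *v b i = s i *\<^sub>R b i"
  shows "\<exists>i. spectral_norm S \<le> s i"
proof -
  have s: "s i \<ge> 0" for i by (rule psd_eigenvalue_nonneg[OF S b])
  have sym: "transpose S = S" using S by (simp add: psd_def)
  have "Max (range s) \<in> range s" by (rule Max_in) auto
  then obtain i where i: "s i = Max (range s)" by (metis rangeE)
  have "spectral_norm S \<le> s i"
  proof (rule spectral_norm_le[OF sym])
    fix y
    have "y \<bullet> (S *v y) \<le> (\<Sum>j\<in>UNIV. s i * (b j \<bullet> y)\<^sup>2)"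
      unfolding quadratic_form_eigen[OF b sym] by (intro sum_mono mult_right_mono) (auto simp: i)
    also have "\<dots> = s i * (y \<bullet> y)" by (simp add: onb_parseval[OF b(1), of y y] sum_distrib_left power2_eq_square)
    finally show "\<bar>y \<bullet> (S *v y)\<bar> \<le> s i * (y \<bullet> y)" using S by (simp add: psd_def)
  qed
  then show ?thesis by blast
qed

text \<open>The largest eigenvalue alone contributes at least \<open>1/2\<close>.  This is what makes the sample size bound imply
  that the batches are nonempty.\<close>

lemma df_ge_half:
  fixes S :: "real^'n^'n"
  assumes S: "psd S" and lam: "lam > 0" "lam \<le> spectral_norm S"
  shows "df lam S \<ge> 1/2"
proof -
  have sym: "transpose S = S" using S by (simp add: psd_def)
  obtain b s where b: "onb b" "\<And>i. S *v b i = s i *\<^sub>R b i" using spectral_theorem[OF sym] by blast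
  have s: "s i \<ge> 0" for i by (rule psd_eigenvalue_nonneg[OF S b])
  obtain i where "lam \<le> s i" using spectral_norm_le_some_eigenvalue[OF S b] lam(2) order_trans by blast
  then have "1/2 \<le> s i / (s i + lam)" using lam by (simp add: field_simps)
  also have "\<dots> \<le> (\<Sum>i\<in>UNIV. s i / (s i + lam))" using s lam by (intro member_le_sum) auto
  finally show ?thesis by (simp add: df_eq_sum[OF S lam(1) b])
qed

text \<open>In an eigenbasis \<open>b\<close> of \<open>S\<close> the trace is the sum of \<open>s i \<bar>K b i\<bar>\<^sup>2\<close>.  With \<open>y = K\<^sup>T K b i\<close> one has
  \<open>y \<bullet> A y = \<bar>K b i\<bar>\<^sup>2 = b i \<bullet> y\<close>, while \<open>y \<bullet> (S + mu) y \<ge> (s i + mu) (b i \<bullet> y)\<^sup>2\<close>; so the domination hypothesis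
  gives \<open>\<bar>K b i\<bar>\<^sup>2 \<le> 2 / (s i + mu)\<close>.  The factor \<open>c\<close> allows \<open>mu\<close> to be smaller than \<open>lam\<close>, as it is for
  the last batch.\<close>

lemma trace_whitened_le_df:
  fixes S A K :: "real^'n^'n"
  assumes S: "psd S" and lam: "lam > 0" and mu: "mu > 0" "lam \<le> c * mu" "1 \<le> c"
    and KAK: "K ** A ** transpose K = mat 1"
    and le: "\<And>x. x \<bullet> (reg mu S *v x) \<le> 2 * (x \<bullet> (A *v x))"
  shows "trace (K ** S ** transpose K) \<le> 2 * c * df lam S"
proof -
  have sym: "transpose S = S" using S by (simp add: psd_def)
  obtain b s where b: "onb b" "\<And>i. S *v b i = s i *\<^sub>R b i" using spectral_theorem[OF sym] by blast
  have s: "s i \<ge> 0" for i by (rule psd_eigenvalue_nonneg[OF S b])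
  have "trace (K ** S ** transpose K) = trace (transpose K ** K ** S)"
    by (metis trace_mul_sym matrix_mul_assoc)
  also have "\<dots> = (\<Sum>i\<in>UNIV. s i * (norm (K *v b i))\<^sup>2)"
    unfolding trace_onb[OF b(1)]
    by (intro sum.cong refl)
      (simp add: matrix_vector_mul_assoc[symmetric] b(2) matrix_vector_mult_scaleR power2_norm_eq_inner inner_transpose del: transpose_matrix_vector)
  also have "\<dots> \<le> (\<Sum>i\<in>UNIV. 2 * c * (s i / (s i + lam)))"
  proof (intro sum_mono)
    fix i
    define a where "a = (norm (K *v b i))\<^sup>2"
    define y where "y = transpose K *v (K *v b i)"
    have biy: "b i \<bullet> y = a"
      by (simp add: y_def a_def power2_norm_eq_inner inner_transpose del: transpose_matrix_vector)
    have "A *v y = b i" 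
      using whitener_gram[OF KAK] by (metis matrix_vector_mul_assoc matrix_vector_mul_lid y_def)
    then have yAy: "y \<bullet> (A *v y) = a" using biy by (simp add: inner_commute)
    have pos: "s i + mu > 0" using s[of i] mu by linarith
    have sq: "(\<Sum>j\<in>UNIV. (s j + mu) * (b j \<bullet> y)\<^sup>2) = y \<bullet> (reg mu S *v y)"
      by (simp add: quadratic_form_reg quadratic_form_eigen[OF b sym] onb_parseval[OF b(1), of y y] sum_distrib_left sum.distrib[symmetric] power2_eq_square algebra_simps)
    have "(s i + mu) * (b i \<bullet> y)\<^sup>2 \<le> (\<Sum>j\<in>UNIV. (s j + mu) * (b j \<bullet> y)\<^sup>2)"
      using s mu by (intro member_le_sum) (auto intro!: mult_nonneg_nonneg add_nonneg_nonneg less_imp_le)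
    then have "(s i + mu) * a\<^sup>2 \<le> 2 * a" using le[of y] by (simp add: sq biy yAy)
    then have "a * (s i + mu) \<le> 2"
    proof (cases "a = 0")
      case False
      then have "a > 0" by (simp add: a_def)
      then show ?thesis using \<open>(s i + mu) * a\<^sup>2 \<le> 2 * a\<close> by (simp add: power2_eq_square mult.commute mult.left_commute)
    qed simp
    then have "a \<le> 2 / (s i + mu)" using pos by (simp add: field_simps)
    also have "\<dots> \<le> 2 * (c / (s i + lam))"
    proof -
      have "s i + lam \<le> c * (s i + mu)" using mult_right_mono[OF mu(3) s[of i]] mu by (simp add: algebra_simps)
      then show ?thesis using pos s[of i] lam by (simp add: field_simps)
    qed
    finally have "s i * a \<le> s i * (2 * (c / (s i + lam)))" using s by (intro mult_left_mono)
    then show "s i * (norm (K *v b i))\<^sup>2 \<le> 2 * c * (s i / (s i + lam))" by (simp add: a_def algebra_simps)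
  qed
  also have "\<dots> = 2 * c * df lam S" by (simp add: df_eq_sum[OF S lam b] sum_distrib_left)
  finally show ?thesis .
qed

section \<open>Golden-Thompson inequality\<close>

primrec mpow :: "real^'n^'n \<Rightarrow> nat \<Rightarrow> real^'n^'n" where
  "mpow A 0 = mat 1"
| "mpow A (Suc n) = A ** mpow A n"

lemma mpow_add: "mpow A (m + n) = mpow A m ** mpow A n"
  by (induction m) (simp_all add: matrix_mul_assoc)

lemma mpow_mult: "mpow A (m * n) = mpow (mpow A m) n"
  by (induction n) (simp_all add: mpow_add)

lemma mpow_pow2_Suc: "mpow A (2 ^ Suc k) = mpow (A ** A) (2 ^ k)"
proof -
  have "mpow A (2 ^ Suc k) = mpow (mpow A 2) (2 ^ k)" by (simp only: power_Suc mpow_mult)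
  then show ?thesis by (simp add: numeral_2_eq_2)
qed

lemma mpow_Suc_right: "mpow A (Suc n) = mpow A n ** A"
  using mpow_add[of A n 1] by simp

lemma transpose_mpow: "transpose (mpow A n) = mpow (transpose A) n"
proof (induction n)
  case (Suc n)
  then show ?case by (simp only: mpow.simps(2)[of A] matrix_transpose_mul mpow_Suc_right[of "transpose A"])
qed simp

lemma mpow_eigenvector: "A *v x = c *\<^sub>R x \<Longrightarrow> mpow A n *v x = c ^ n *\<^sub>R x"
  by (induction n) (simp_all add: matrix_vector_mul_assoc[symmetric] matrix_vector_mult_scaleR)

lemma trace_mpow_mult_commute:
  fixes A B :: "real^'n^'n"
  shows "trace (mpow (A ** B) n) = trace (mpow (B ** A) n)"
proof (cases n)
  case (Suc k)
  have *: "mpow (A ** B) (Suc m) = A ** mpow (B ** A) m ** B" for m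
    by (induction m) (simp_all add: matrix_mul_assoc)
  have "trace (mpow (A ** B) n) = trace (A ** (mpow (B ** A) k ** B))"
    unfolding Suc * by (simp add: matrix_mul_assoc)
  also have "\<dots> = trace (mpow (B ** A) k ** (B ** A))"
    by (subst trace_mul_sym) (simp add: matrix_mul_assoc)
  also have "\<dots> = trace (mpow (B ** A) n)" by (simp only: Suc mpow_Suc_right)
  finally show ?thesis .
qed simp

lemma trace_mult_transpose: "trace (A ** transpose B) = A \<bullet> (B :: real^'n^'n)"
  by (simp add: trace_def matrix_matrix_mult_def transpose_def inner_vec_def)

lemma norm_transpose: "norm (transpose A) = norm (A :: real^'n^'n)"
proof -
  have "transpose A \<bullet> transpose A = A \<bullet> A"
    by (simp only: trace_mult_transpose[symmetric] transpose_transpose) (rule trace_mul_sym)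
  then show ?thesis by (simp add: norm_eq_sqrt_inner)
qed

lemma trace_mult_le_norm: "trace (A ** B) \<le> norm A * norm (B :: real^'n^'n)"
  using norm_cauchy_schwarz[of A "transpose B"] trace_mult_transpose[of A "transpose B"]
  by (simp add: norm_transpose)

text \<open>Two inequalities proved by simultaneous induction on the exponent.  The first one, for
  \<open>Z\<^sup>N\<close> with \<open>N\<close> a power of two, squares \<open>Z\<close>, applies the induction hypothesis to \<open>Z\<^sup>2\<close>, and rearranges the word
  \<open>Z Z Z\<^sup>T Z\<^sup>T\<close> cyclically into the product of \<open>Z Z\<^sup>T\<close> and \<open>Z\<^sup>T Z\<close>; the second inequality separates these
  two factors, and Cauchy-Schwarz for the Frobenius inner product finishes, because their powers
  have the same norm.  The second inequality follows from the first one with \<open>Z = C D\<close>, from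
  cyclicity, and from itself for \<open>C\<^sup>2\<close> and \<open>D\<^sup>2\<close>.\<close>

lemma trace_power_bounds:
  fixes Z C D :: "real^'n^'n"
  shows "trace (mpow Z (2 ^ Suc k)) \<le> trace (mpow (Z ** transpose Z) (2 ^ k))
      \<and> (transpose C = C \<longrightarrow> transpose D = D \<longrightarrow>
            trace (mpow (C ** D) (2 ^ k)) \<le> trace (mpow C (2 ^ k) ** mpow D (2 ^ k)))"
proof (induction k arbitrary: Z C D rule: less_induct)
  case (less k)
  show ?case
  proof (cases k)
    case 0
    then show ?thesis
      using trace_mult_le_norm[of Z Z] trace_mult_transpose[of Z Z]
      by (simp add: numeral_2_eq_2 dot_square_norm power2_eq_square)
  next
    case (Suc j)
    have IHQ: "trace (mpow Y (2 ^ k)) \<le> trace (mpow (Y ** transpose Y) (2 ^ j))" for Y :: "real^'n^'n"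
      using less[of j Y] Suc by simp
    have IHG: "trace (mpow (E ** F) (2 ^ j)) \<le> trace (mpow E (2 ^ j) ** mpow F (2 ^ j))"
      if "transpose E = E" "transpose F = F" for E F :: "real^'n^'n"
      using less[of j _ E F] Suc that by simp
    let ?D = "Z ** transpose Z" and ?C = "transpose Z ** Z"
    have "trace (mpow Z (2 ^ Suc k)) = trace (mpow (Z ** Z) (2 ^ k))"
      by (simp only: mpow_pow2_Suc)
    also have "\<dots> \<le> trace (mpow (Z ** (Z ** transpose Z ** transpose Z)) (2 ^ j))"
      using IHQ[of "Z ** Z"] by (simp add: matrix_transpose_mul matrix_mul_assoc)
    also have "\<dots> = trace (mpow (?D ** ?C) (2 ^ j))"
      by (subst trace_mpow_mult_commute) (simp add: matrix_mul_assoc)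
    also have "\<dots> \<le> trace (mpow ?D (2 ^ j) ** mpow ?C (2 ^ j))"
      by (rule IHG) (simp_all add: matrix_transpose_mul)
    also have "\<dots> \<le> norm (mpow ?D (2 ^ j)) * norm (mpow ?C (2 ^ j))" by (rule trace_mult_le_norm)
    also have "\<dots> = trace (mpow ?D (2 ^ k))"
    proof -
      have sq: "(norm (mpow E (2 ^ j)))\<^sup>2 = trace (mpow E (2 ^ k))" if "transpose E = E" for E :: "real^'n^'n"
      proof -
        have "(norm (mpow E (2 ^ j)))\<^sup>2 = trace (mpow E (2 ^ j) ** transpose (mpow E (2 ^ j)))"
          by (simp only: trace_mult_transpose dot_square_norm)
        also have "\<dots> = trace (mpow E (2 ^ j + 2 ^ j))" by (simp add: transpose_mpow that mpow_add)
        finally show ?thesis using Suc by (simp add: mult_2)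
      qed
      have "(norm (mpow ?D (2 ^ j)))\<^sup>2 = (norm (mpow ?C (2 ^ j)))\<^sup>2"
        by (simp add: sq matrix_transpose_mul trace_mpow_mult_commute)
      then have "norm (mpow ?C (2 ^ j)) = norm (mpow ?D (2 ^ j))" by simp
      then show ?thesis using sq[of ?D] by (simp add: matrix_transpose_mul power2_eq_square)
    qed
    finally have Q: "trace (mpow Z (2 ^ Suc k)) \<le> trace (mpow ?D (2 ^ k))" .
    have "trace (mpow (C ** D) (2 ^ k)) \<le> trace (mpow C (2 ^ k) ** mpow D (2 ^ k))"
      if "transpose C = C" "transpose D = D"
    proof -
      have "trace (mpow (C ** D) (2 ^ k)) \<le> trace (mpow (C ** (D ** D ** C)) (2 ^ j))"
        using IHQ[of "C ** D"] that by (simp add: matrix_transpose_mul matrix_mul_assoc)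
      also have "\<dots> = trace (mpow ((D ** D) ** (C ** C)) (2 ^ j))"
        by (subst trace_mpow_mult_commute) (simp add: matrix_mul_assoc)
      also have "\<dots> \<le> trace (mpow (D ** D) (2 ^ j) ** mpow (C ** C) (2 ^ j))"
        using that by (intro IHG) (simp_all add: matrix_transpose_mul)
      also have "\<dots> = trace (mpow D (2 ^ k) ** mpow C (2 ^ k))"
        by (simp only: Suc mpow_pow2_Suc)
      finally show ?thesis using trace_mul_sym[of "mpow D (2 ^ k)" "mpow C (2 ^ k)"] by linarith
    qed
    with Q show ?thesis by blast
  qed
qed

lemma bounded_bilinear_matrix_mult: "bounded_bilinear ((**) :: real^'n^'n \<Rightarrow> real^'n^'n \<Rightarrow> real^'n^'n)"
  unfolding bilinear_conv_bounded_bilinear[symmetric] bilinear_def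
  by (intro conjI allI linearI) (simp_all add: matrix_eq matrix_vector_mult_add_rdistrib matrix_vector_right_distrib
      matrix_vector_mul_assoc[symmetric] scaleR_matrix_vector_assoc[symmetric] matrix_vector_mult_scaleR)

lemma continuous_on_mpow: "continuous_on X f \<Longrightarrow> continuous_on X (\<lambda>x. mpow (f x) n)"
  by (induction n) (auto intro: bounded_bilinear.continuous_on[OF bounded_bilinear_matrix_mult])

lemma bounded_linear_trace: "bounded_linear (trace :: real^'n^'n \<Rightarrow> real)"
  unfolding linear_conv_bounded_linear[symmetric]
  by (auto intro!: linearI simp: trace_def sum.distrib sum_distrib_left)

text \<open>The matrix exponential as a limit of powers: in this form Golden-Thompson is a limit of
  \<open>trace_power_bounds\<close>, and Borel measurability is immediate.\<close>

definition mexp :: "real^'n^'n \<Rightarrow> real^'n^'n" where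
  "mexp A = lim (\<lambda>k. mpow (mat 1 + (1 / 2 ^ k) *\<^sub>R A) (2 ^ k))"

lemma LIMSEQ_compound_interest_pow2: "(\<lambda>k. (1 + l / 2 ^ k) ^ (2 ^ k)) \<longlonglongrightarrow> exp (l::real)"
proof -
  have "filterlim (\<lambda>k. 2 ^ k :: nat) sequentially sequentially"
    by (rule filterlim_subseq) (simp add: strict_mono_def)
  from filterlim_compose[OF tendsto_exp_limit_sequentially this, of l] show ?thesis by simp
qed

lemma
  fixes A :: "real^'n^'n"
  assumes b: "onb b" "\<And>i. A *v b i = l i *\<^sub>R b i"
  shows mexp_tendsto_spectral: "(\<lambda>k. mpow (mat 1 + (1 / 2 ^ k) *\<^sub>R A) (2 ^ k)) \<longlonglongrightarrow> spectral_sum b (\<lambda>i. exp (l i))"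
    and mexp_spectral: "mexp A = spectral_sum b (\<lambda>i. exp (l i))"
proof -
  have "mpow (mat 1 + (1 / 2 ^ k) *\<^sub>R A) (2 ^ k) = spectral_sum b (\<lambda>i. (1 + l i / 2 ^ k) ^ (2 ^ k))" for k
  proof (rule matrix_eq_on_onb[OF b(1)])
    fix i
    have "(mat 1 + (1 / 2 ^ k) *\<^sub>R A) *v b i = (1 + l i / 2 ^ k) *\<^sub>R b i"
      by (simp add: matrix_vector_mult_add_rdistrib scaleR_matrix_vector_assoc[symmetric] b(2) scaleR_add_left)
    from mpow_eigenvector[OF this]
    show "mpow (mat 1 + (1 / 2 ^ k) *\<^sub>R A) (2 ^ k) *v b i = spectral_sum b (\<lambda>i. (1 + l i / 2 ^ k) ^ (2 ^ k)) *v b i"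
      by (simp add: spectral_sum_eigenvector[OF b(1)])
  qed
  moreover have "(\<lambda>k. spectral_sum b (\<lambda>i. (1 + l i / 2 ^ k) ^ (2 ^ k))) \<longlonglongrightarrow> spectral_sum b (\<lambda>i. exp (l i))"
    unfolding spectral_sum_def by (intro tendsto_intros LIMSEQ_compound_interest_pow2)
  ultimately show *: "(\<lambda>k. mpow (mat 1 + (1 / 2 ^ k) *\<^sub>R A) (2 ^ k)) \<longlonglongrightarrow> spectral_sum b (\<lambda>i. exp (l i))"
    by simp
  then show "mexp A = spectral_sum b (\<lambda>i. exp (l i))" unfolding mexp_def by (rule limI)
qed

lemma mexp_tendsto:
  assumes "transpose A = A"
  shows "(\<lambda>k. mpow (mat 1 + (1 / 2 ^ k) *\<^sub>R A) (2 ^ k)) \<longlonglongrightarrow> mexp A"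
proof -
  obtain b l where b: "onb b" "\<And>i. A *v b i = l i *\<^sub>R b i" using spectral_theorem[OF assms] by blast
  show ?thesis using mexp_tendsto_spectral[OF b] mexp_spectral[OF b] by simp
qed

lemma spectral_norm_nonneg: "0 \<le> spectral_norm A"
  unfolding spectral_norm_def by (rule onorm_pos_le) simp

lemma spectral_norm_mult: "spectral_norm (A ** B) \<le> spectral_norm A * spectral_norm B"
  unfolding spectral_norm_def using onorm_compose[of "(*v) A" "(*v) B"]
  by (simp add: comp_def matrix_vector_mul_assoc)

lemma spectral_norm_add: "spectral_norm (A + B) \<le> spectral_norm A + spectral_norm B"
proof -
  have "(*v) (A + B) = (\<lambda>x. A *v x + B *v x)" by (rule ext) (rule matrix_vector_mult_add_rdistrib)
  then show ?thesis
    unfolding spectral_norm_def using onorm_triangle[of "(*v) A" "(*v) B"] by simp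
qed

lemma spectral_norm_scaleR: "spectral_norm (c *\<^sub>R A) = \<bar>c\<bar> * spectral_norm A"
proof -
  have "(*v) (c *\<^sub>R A) = (\<lambda>x. c *\<^sub>R (A *v x))" by (rule ext) (simp add: scaleR_matrix_vector_assoc)
  then show ?thesis
    unfolding spectral_norm_def using onorm_scaleR[of "(*v) A" c] by simp
qed

lemma spectral_norm_mat_1: "spectral_norm (mat 1 :: real^'n^'n) \<le> 1"
  unfolding spectral_norm_def by (rule onorm_le) simp

lemma spectral_norm_mpow_le:
  assumes "spectral_norm A \<le> c" shows "spectral_norm (mpow A n) \<le> c ^ n"
proof (induction n)
  case (Suc n)
  have "spectral_norm (mpow A (Suc n)) \<le> spectral_norm A * spectral_norm (mpow A n)" by (simp add: spectral_norm_mult)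
  also have "\<dots> \<le> c * c ^ n" using Suc assms order_trans[OF spectral_norm_nonneg assms] by (intro mult_mono) (auto simp: spectral_norm_nonneg)
  finally show ?case by simp
qed (simp add: spectral_norm_mat_1)

text \<open>Telescoping: the two powers differ in one factor at a time.\<close>

lemma spectral_norm_mpow_diff:
  assumes A: "spectral_norm A \<le> c" and B: "spectral_norm B \<le> c" and c: "1 \<le> c"
  shows "spectral_norm (mpow A n - mpow B n) \<le> real n * c ^ n * spectral_norm (A - B)"
proof (induction n)
  case 0
  show ?case by (simp add: spectral_norm_def onorm_zero)
next
  case (Suc n)
  let ?d = "spectral_norm (A - B)"
  have eq: "mpow A (Suc n) - mpow B (Suc n) = A ** (mpow A n - mpow B n) + (A - B) ** mpow B n"
    by (simp add: matrix_eq matrix_vector_mult_add_rdistrib matrix_vector_mult_diff_rdistrib matrix_vector_mul_assoc[symmetric] matrix_vector_mult_diff_distrib)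
  have "spectral_norm (mpow A (Suc n) - mpow B (Suc n)) \<le> spectral_norm A * spectral_norm (mpow A n - mpow B n) + ?d * spectral_norm (mpow B n)"
    unfolding eq by (rule order_trans[OF spectral_norm_add]) (intro add_mono spectral_norm_mult)
  also have "\<dots> \<le> c * (real n * c ^ n * ?d) + ?d * c ^ n"
    using Suc A c by (intro add_mono mult_mono spectral_norm_mpow_le[OF B]) (auto simp: spectral_norm_nonneg)
  also have "\<dots> \<le> c * (real n * c ^ n * ?d) + ?d * (c * c ^ n)"
    using mult_right_mono[OF c, of "c ^ n"] c by (intro add_mono mult_left_mono) (auto simp: spectral_norm_nonneg)
  also have "\<dots> = real (Suc n) * c ^ Suc n * ?d" by (simp add: algebra_simps)
  finally show ?case .
qed

lemma abs_trace_le: "\<bar>trace (A :: real^'n^'n)\<bar> \<le> real CARD('n) * spectral_norm A"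
proof -
  have "\<bar>trace A\<bar> \<le> (\<Sum>i\<in>UNIV. \<bar>A $ i $ i\<bar>)" unfolding trace_def by (rule sum_abs)
  also have "\<dots> \<le> (\<Sum>i\<in>(UNIV::'n set). spectral_norm A)"
    by (intro sum_mono) (simp add: spectral_norm_def matrix_component_le_onorm)
  finally show ?thesis by simp
qed

text \<open>With \<open>N = 2\<^sup>k\<close>, the product \<open>(I + A/N) (I + B/N)\<close> differs from \<open>I + (A + B)/N\<close> by \<open>A B / N\<^sup>2\<close>, so their
  \<open>N\<close>-th powers differ by \<open>O(1/N)\<close>.\<close>

theorem golden_thompson:
  fixes A B :: "real^'n^'n"
  assumes A: "transpose A = A" and B: "transpose B = B"
  shows "trace (mexp (A + B)) \<le> trace (mexp A ** mexp B)"
proof -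
  define P where "P k = mat 1 + (1 / 2 ^ k) *\<^sub>R A" for k :: nat
  define Q where "Q k = mat 1 + (1 / 2 ^ k) *\<^sub>R B" for k :: nat
  define R where "R k = mat 1 + (1 / 2 ^ k) *\<^sub>R (A + B)" for k :: nat
  let ?N = "\<lambda>k::nat. 2 ^ k :: nat"
  let ?a = "spectral_norm A" and ?b = "spectral_norm B"
  let ?c = "?a + ?b + ?a * ?b"
  have ab: "0 \<le> ?a" "0 \<le> ?b" "0 \<le> ?a * ?b" by (auto simp: spectral_norm_nonneg)
  have AB: "transpose (A + B) = A + B" using A B by (simp add: vec_eq_iff transpose_def)
  have symP: "transpose (P k) = P k" and symQ: "transpose (Q k) = Q k" for k
    using A B by (simp_all add: P_def Q_def vec_eq_iff transpose_def mat_def)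
  have limR: "(\<lambda>k. trace (mpow (R k) (?N k))) \<longlonglongrightarrow> trace (mexp (A + B))"
    unfolding R_def by (intro bounded_linear.tendsto[OF bounded_linear_trace] mexp_tendsto AB)
  have limPQ: "(\<lambda>k. trace (mpow (P k) (?N k) ** mpow (Q k) (?N k))) \<longlonglongrightarrow> trace (mexp A ** mexp B)"
    unfolding P_def Q_def
    by (intro bounded_linear.tendsto[OF bounded_linear_trace] bounded_bilinear.tendsto[OF bounded_bilinear_matrix_mult] mexp_tendsto A B)
  have step: "trace (mpow (R k) (?N k)) \<le> trace (mpow (P k) (?N k) ** mpow (Q k) (?N k)) + real CARD('n) * (?a * ?b * exp ?c) * (1 / 2 ^ k)" for k
  proof -
    define e :: real where "e = 1 / 2 ^ k"
    have e: "0 < e" "e \<le> 1" "e * real (?N k) = 1" by (simp_all add: e_def)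
    have diff: "P k ** Q k - R k = e\<^sup>2 *\<^sub>R (A ** B)"
      by (simp add: R_def P_def Q_def e_def[symmetric] matrix_eq matrix_vector_mult_add_rdistrib matrix_vector_mult_diff_rdistrib matrix_vector_mul_assoc[symmetric] scaleR_matrix_vector_assoc[symmetric] matrix_vector_right_distrib matrix_vector_mult_scaleR power2_eq_square algebra_simps)
    have nR: "spectral_norm (R k) \<le> 1 + e * ?c"
    proof -
      have "spectral_norm (R k) \<le> spectral_norm (mat 1 :: real^'n^'n) + e * spectral_norm (A + B)"
        unfolding R_def e_def[symmetric] using spectral_norm_add[of "mat 1" "e *\<^sub>R (A + B)"] e by (simp add: spectral_norm_scaleR)
      also have "\<dots> \<le> 1 + e * ?c"
        using e spectral_norm_add[of A B] ab by (intro add_mono mult_left_mono spectral_norm_mat_1) linarith+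
      finally show ?thesis .
    qed
    have nP: "spectral_norm (P k) \<le> 1 + e * ?a" "spectral_norm (Q k) \<le> 1 + e * ?b"
      unfolding P_def Q_def e_def[symmetric]
      using spectral_norm_add[of "mat 1" "e *\<^sub>R A"] spectral_norm_add[of "mat 1" "e *\<^sub>R B"] e spectral_norm_mat_1[where 'n='n]
      by (simp_all add: spectral_norm_scaleR)
    have nPQ: "spectral_norm (P k ** Q k) \<le> 1 + e * ?c"
    proof -
      have "spectral_norm (P k ** Q k) \<le> (1 + e * ?a) * (1 + e * ?b)"
        using nP e ab by (intro order_trans[OF spectral_norm_mult] mult_mono) (auto simp: spectral_norm_nonneg)
      also have "\<dots> = 1 + e * (?a + ?b) + e * (e * (?a * ?b))" by (simp add: algebra_simps)
      also have "\<dots> \<le> 1 + e * (?a + ?b) + e * (?a * ?b)"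
        using e ab by (intro add_left_mono mult_left_mono mult_left_le_one_le) auto
      finally show ?thesis by (simp add: algebra_simps)
    qed
    have "trace (mpow (R k) (?N k)) - trace (mpow (P k ** Q k) (?N k)) \<le> real CARD('n) * spectral_norm (mpow (P k ** Q k) (?N k) - mpow (R k) (?N k))"
      using abs_trace_le[of "mpow (P k ** Q k) (?N k) - mpow (R k) (?N k)"] by (simp add: trace_sub)
    also have "\<dots> \<le> real CARD('n) * (real (?N k) * (1 + e * ?c) ^ ?N k * (e\<^sup>2 * (?a * ?b)))"
    proof -
      have "spectral_norm (P k ** Q k - R k) \<le> e\<^sup>2 * (?a * ?b)"
        unfolding diff spectral_norm_scaleR using spectral_norm_mult[of A B] by (simp add: mult_left_mono)
      moreover have "1 \<le> 1 + e * ?c" using e ab by simp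
      ultimately show ?thesis
        by (intro mult_left_mono order_trans[OF spectral_norm_mpow_diff[OF nPQ nR]]) auto
    qed
    also have "\<dots> = real CARD('n) * ((?a * ?b) * (1 + e * ?c) ^ ?N k) * (e * real (?N k) * e)"
      by (simp add: power2_eq_square algebra_simps)
    also have "\<dots> \<le> real CARD('n) * ((?a * ?b) * exp ?c) * e"
    proof -
      have "(1 + e * ?c) ^ ?N k \<le> exp (e * ?c) ^ ?N k"
        using e ab by (intro power_mono exp_ge_add_one_self) auto
      also have "\<dots> = exp ?c" using e by (simp add: exp_of_nat_mult[symmetric] mult.assoc[symmetric] mult.commute)
      finally show ?thesis unfolding e(3) mult_1 using e ab by (intro mult_right_mono mult_left_mono) auto
    qed
    finally have "trace (mpow (R k) (?N k)) \<le> trace (mpow (P k ** Q k) (?N k)) + real CARD('n) * ((?a * ?b) * exp ?c) * e" by simp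
    also have "trace (mpow (P k ** Q k) (?N k)) \<le> trace (mpow (P k) (?N k) ** mpow (Q k) (?N k))"
      using trace_power_bounds[where k=k and C="P k" and D="Q k"] symP symQ by blast
    finally show ?thesis by (simp add: e_def)
  qed
  have "(\<lambda>k. (1 / 2 ^ k :: real)) \<longlonglongrightarrow> 0"
    using LIMSEQ_realpow_zero[of "1/2::real"] by (simp add: power_divide)
  then have "(\<lambda>k. trace (mpow (P k) (?N k) ** mpow (Q k) (?N k)) + real CARD('n) * (?a * ?b * exp ?c) * (1 / 2 ^ k)) \<longlonglongrightarrow> trace (mexp A ** mexp B) + real CARD('n) * (?a * ?b * exp ?c) * 0"
    by (intro tendsto_add limPQ tendsto_mult tendsto_const)
  from LIMSEQ_le[OF limR this] step show ?thesis by auto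
qed

section \<open>Spectral bounds for the matrix exponential\<close>

lemma psd_mexp:
  assumes "transpose A = A" shows "psd (mexp A)"
proof -
  obtain b l where b: "onb b" "\<And>i. A *v b i = l i *\<^sub>R b i" using spectral_theorem[OF assms] by blast
  show ?thesis using mexp_spectral[OF b] psd_spectral_sum[OF b(1), of "\<lambda>i. exp (l i)"] by simp
qed

lemma mexp_0: "mexp (0 :: real^'n^'n) = mat 1"
proof -
  have "mpow (mat 1 :: real^'n^'n) n = mat 1" for n by (induction n) auto
  then show ?thesis by (simp add: mexp_def)
qed

text \<open>The scalar inequality \<open>exp t \<le> 1 + t + t\<^sup>2\<close> for \<open>t \<le> 1\<close>, applied to the eigenvalues.\<close>

lemma quadratic_form_mexp_le:
  fixes A :: "real^'n^'n"
  assumes sym: "transpose A = A" and le: "\<And>x. x \<bullet> (A *v x) \<le> x \<bullet> x"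
  shows "x \<bullet> (mexp A *v x) \<le> x \<bullet> ((mat 1 + A + A ** A) *v x)"
proof -
  have scalar: "exp t \<le> 1 + t + t\<^sup>2" if "t \<le> 1" for t :: real
  proof (cases "t \<ge> 0")
    case True
    then show ?thesis using exp_bound[of t] that by simp
  next
    case False
    have "exp t = 1 / exp (- t)" by (simp add: exp_minus field_simps)
    also have "\<dots> \<le> 1 / (1 - t)" using False exp_ge_add_one_self[of "-t"] by (intro divide_left_mono) auto
    also have "\<dots> \<le> 1 + t + t\<^sup>2"
    proof -
      have "(1 + t + t\<^sup>2) * (1 - t) = 1 - t ^ 3" by (simp add: algebra_simps power2_eq_square power3_eq_cube)
      moreover have "t ^ 3 \<le> 0" using False by (simp add: power3_eq_cube mult_le_0_iff zero_le_mult_iff)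
      ultimately show ?thesis using False by (simp add: pos_divide_le_eq)
    qed
    finally show ?thesis .
  qed
  obtain b l where b: "onb b" "\<And>i. A *v b i = l i *\<^sub>R b i" using spectral_theorem[OF sym] by blast
  have l: "l i \<le> 1" for i
    using le[of "b i"] eigenvalue_eq[OF onb_norm[OF b(1)] b(2), of i] onb_norm[OF b(1), of i] by (simp add: dot_square_norm)
  have "x \<bullet> (mexp A *v x) = (\<Sum>i\<in>UNIV. exp (l i) * (b i \<bullet> x)\<^sup>2)"
    unfolding mexp_spectral[OF b]
    by (rule quadratic_form_eigen[OF b(1) spectral_sum_eigenvector[OF b(1)] transpose_spectral_sum])
  also have "\<dots> \<le> (\<Sum>i\<in>UNIV. (1 + l i + (l i)\<^sup>2) * (b i \<bullet> x)\<^sup>2)"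
    by (intro sum_mono mult_right_mono scalar l) simp
  also have "\<dots> = x \<bullet> ((mat 1 + A + A ** A) *v x)"
  proof (rule quadratic_form_eigen[OF b(1), symmetric])
    show "(mat 1 + A + A ** A) *v b i = (1 + l i + (l i)\<^sup>2) *\<^sub>R b i" for i
      by (simp add: matrix_vector_mult_add_rdistrib matrix_vector_mul_assoc[symmetric] b(2) matrix_vector_mult_scaleR scaleR_add_left power2_eq_square)
    have "transpose (mat 1 + A + A ** A) = mat 1 + transpose A + transpose (A ** A)"
      by (simp add: vec_eq_iff transpose_def mat_def)
    then show "transpose (mat 1 + A + A ** A) = mat 1 + A + A ** A" by (simp add: matrix_transpose_mul sym)
  qed
  finally show ?thesis .
qed

text \<open>Evaluate both traces in an eigenbasis of \<open>E\<close>: only the quadratic forms of \<open>M\<close> and \<open>N\<close> enter, with nonnegative weights.\<close>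

lemma trace_psd_mult_mono:
  fixes E M N :: "real^'n^'n"
  assumes E: "psd E" and le: "\<And>x. x \<bullet> (M *v x) \<le> x \<bullet> (N *v x)"
  shows "trace (E ** M) \<le> trace (E ** N)"
proof -
  have sym: "transpose E = E" using E by (simp add: psd_def)
  obtain b l where b: "onb b" "\<And>i. E *v b i = l i *\<^sub>R b i" using spectral_theorem[OF sym] by blast
  have "trace (E ** F) = (\<Sum>i\<in>UNIV. l i * (b i \<bullet> (F *v b i)))" for F
    unfolding trace_onb[OF b(1)]
    by (simp add: matrix_vector_mul_assoc[symmetric] symmetric_inner[OF sym] b(2))
  then show ?thesis using le psd_eigenvalue_nonneg[OF E b] by (auto intro!: sum_mono mult_left_mono)
qed

lemma exp_le_trace_mexp:
  fixes A :: "real^'n^'n"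
  assumes sym: "transpose A = A" and u: "t * (u \<bullet> u) < u \<bullet> (A *v u)"
  shows "exp t \<le> trace (mexp A)"
proof -
  obtain b l where b: "onb b" "\<And>i. A *v b i = l i *\<^sub>R b i" using spectral_theorem[OF sym] by blast
  have "\<exists>i. t \<le> l i"
  proof (rule ccontr)
    assume "\<nexists>i. t \<le> l i"
    then have "(\<Sum>i\<in>UNIV. l i * (b i \<bullet> u)\<^sup>2) \<le> (\<Sum>i\<in>UNIV. t * (b i \<bullet> u)\<^sup>2)"
      by (intro sum_mono mult_right_mono) (auto simp: not_le less_imp_le)
    then show False using u unfolding quadratic_form_eigen[OF b sym]
      by (simp add: onb_parseval[OF b(1), of u u] sum_distrib_left power2_eq_square)
  qed
  then obtain i where "exp t \<le> exp (l i)" by auto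
  also have "\<dots> \<le> (\<Sum>i\<in>UNIV. exp (l i))" by (intro member_le_sum) auto
  also have "\<dots> = trace (mexp A)"
    unfolding trace_onb[OF b(1)] mexp_spectral[OF b]
    by (simp add: spectral_sum_eigenvector[OF b(1)] dot_square_norm onb_norm[OF b(1)])
  finally show ?thesis .
qed

lemma norm_outer: "norm (outer x) = (norm x)\<^sup>2"
proof -
  have "outer x \<bullet> outer x = (x \<bullet> x) * (x \<bullet> x)"
  proof -
    have row: "outer x $ i = x $ i *\<^sub>R x" for i by (simp add: outer_def vec_eq_iff)
    have "outer x \<bullet> outer x = (\<Sum>i\<in>UNIV. (x $ i * x $ i) * (x \<bullet> x))"
      by (simp add: inner_vec_def[of "outer x"] row mult.assoc)
    then show ?thesis by (simp only: sum_distrib_right[symmetric] inner_vec_def[of x x] inner_real_def)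
  qed
  then have "(norm (outer x))\<^sup>2 = ((norm x)\<^sup>2)\<^sup>2"
    by (simp only: power2_norm_eq_inner power2_eq_square[of "x \<bullet> x"])
  then show ?thesis by (rule power2_eq_imp_eq) auto
qed

lemma norm_mexp_le:
  fixes A :: "real^'n^'n"
  assumes sym: "transpose A = A" and le: "\<And>x. x \<bullet> (A *v x) \<le> c * (x \<bullet> x)"
  shows "norm (mexp A) \<le> real CARD('n) * exp c"
proof -
  obtain b l where b: "onb b" "\<And>i. A *v b i = l i *\<^sub>R b i" using spectral_theorem[OF sym] by blast
  have l: "l i \<le> c" for i
    using le[of "b i"] eigenvalue_eq[OF onb_norm[OF b(1)] b(2), of i] onb_norm[OF b(1), of i] by (simp add: dot_square_norm)
  have "norm (mexp A) \<le> (\<Sum>i\<in>(UNIV::'n set). exp c)"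
    unfolding mexp_spectral[OF b] spectral_sum_def
    by (rule sum_norm_le) (simp add: norm_outer onb_norm[OF b(1)] l)
  then show ?thesis by simp
qed

lemma borel_measurable_mexp: "mexp \<in> borel_measurable borel"
  unfolding mexp_def[abs_def]
  by (intro borel_measurable_lim_metric borel_measurable_continuous_onI continuous_on_mpow continuous_intros)

section \<open>A matrix Bernstein inequality\<close>

lemma bounded_linear_matrix_vector_left: "bounded_linear (\<lambda>A :: real^'n^'n. A *v x)"
  unfolding linear_conv_bounded_linear[symmetric]
  by (intro linearI) (simp_all add: matrix_vector_mult_add_rdistrib scaleR_matrix_vector_assoc)

lemma bounded_linear_quadratic_form: "bounded_linear (\<lambda>A :: real^'n^'n. x \<bullet> (A *v x))"
  by (rule bounded_linear_compose[OF bounded_linear_inner_right bounded_linear_matrix_vector_left])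

lemma bounded_linear_transpose: "bounded_linear (transpose :: real^'n^'n \<Rightarrow> real^'n^'n)"
  unfolding linear_conv_bounded_linear[symmetric]
  by (intro linearI) (simp_all add: vec_eq_iff transpose_def)

lemma norm_matrix_vector_le: "norm ((A :: real^'n^'m) *v x) \<le> norm A * norm x"
proof -
  have "norm (A *v x) = L2_set (\<lambda>i. \<bar>A $ i \<bullet> x\<bar>) UNIV"
    by (simp add: norm_vec_def[of "A *v x"] matrix_vector_mul_component)
  also have "\<dots> \<le> L2_set (\<lambda>i. norm (A $ i) * norm x) UNIV"
    by (intro L2_set_mono) (auto simp: Cauchy_Schwarz_ineq2)
  also have "\<dots> = norm A * norm x"
    by (simp add: L2_set_left_distrib[symmetric] norm_vec_def[of A])
  finally show ?thesis .
qed

lemma norm_matrix_mult_le: "norm (A ** B) \<le> norm A * norm (B :: real^'n^'n)"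
proof -
  have row: "norm ((A ** B) $ i) \<le> norm (A $ i) * norm B" for i
  proof -
    have "(A ** B) $ i = transpose B *v (A $ i)"
      by (simp add: vec_eq_iff matrix_matrix_mult_def vector_matrix_mult_def mult.commute)
    then show ?thesis using norm_matrix_vector_le[of "transpose B" "A $ i"]
      by (simp only: norm_transpose mult.commute)
  qed
  have "norm (A ** B) \<le> L2_set (\<lambda>i. norm (A $ i) * norm B) UNIV"
    unfolding norm_vec_def[of "A ** B"] by (intro L2_set_mono row) auto
  also have "\<dots> = norm A * norm B"
    by (simp add: L2_set_left_distrib[symmetric] norm_vec_def[of A])
  finally show ?thesis .
qed

lemma quadratic_form_le_norm: "x \<bullet> (A *v x) \<le> norm (A :: real^'n^'n) * (x \<bullet> x)"
proof -
  have "x \<bullet> (A *v x) \<le> norm x * norm (A *v x)" by (rule norm_cauchy_schwarz)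
  also have "\<dots> \<le> norm x * (norm A * norm x)" by (intro mult_left_mono norm_matrix_vector_le) auto
  finally show ?thesis by (simp add: dot_square_norm power2_eq_square algebra_simps)
qed

lemma trace_psd_nonneg: "psd (E :: real^'n^'n) \<Longrightarrow> 0 \<le> trace E"
  using trace_psd_mult_mono[of E 0 "mat 1"] by (simp add: trace_0[simplified])

text \<open>All events below are of the form ``a quadratic form is dominated''; they are closed conditions on the
  matrix, hence Borel.\<close>

lemma closed_quadratic_form_bounded:
  "closed {D :: real^'n^'n. \<forall>u. u \<bullet> (D *v u) \<le> t * (u \<bullet> u)}"
  by (intro closed_Collect_all closed_Collect_le continuous_intros
      linear_continuous_on bounded_linear_quadratic_form)

lemma quadratic_form_bounded_measurable [measurable]:
  "Measurable.pred borel (\<lambda>D :: real^'n^'n. \<forall>u. u \<bullet> (D *v u) \<le> t * (u \<bullet> u))"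
  using borel_closed[OF closed_quadratic_form_bounded[of t]] by (simp add: pred_def)

lemma borel_measurable_matrix_mult [measurable (raw)]:
  fixes f g :: "'a \<Rightarrow> real^'n^'n"
  assumes "f \<in> borel_measurable N" "g \<in> borel_measurable N"
  shows "(\<lambda>x. f x ** g x) \<in> borel_measurable N"
  by (rule borel_measurable_continuous_Pair[OF assms])
    (intro bounded_bilinear.continuous_on[OF bounded_bilinear_matrix_mult] continuous_intros)

lemma borel_measurable_matrix_vector [measurable (raw)]:
  fixes f :: "'a \<Rightarrow> real^'n^'n"
  assumes "f \<in> borel_measurable N"
  shows "(\<lambda>x. f x *v y) \<in> borel_measurable N"
  using measurable_compose[OF assms borel_measurable_continuous_onI[OF linear_continuous_on[OF bounded_linear_matrix_vector_left]]] .

context prob_space begin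

lemma indep_vars_measurable: "indep_vars N Y I \<Longrightarrow> i \<in> I \<Longrightarrow> Y i \<in> measurable M (N i)"
  by (simp add: indep_vars_def)

lemma integral_quadratic_form:
  fixes Y :: "'a \<Rightarrow> real^'n^'n"
  assumes "integrable M Y"
  shows "integrable M (\<lambda>\<omega>. u \<bullet> (Y \<omega> *v u))" "u \<bullet> ((\<integral>\<omega>. Y \<omega> \<partial>M) *v u) = (\<integral>\<omega>. u \<bullet> (Y \<omega> *v u) \<partial>M)"
  using integrable_bounded_linear[OF bounded_linear_quadratic_form assms]
    integral_bounded_linear[OF bounded_linear_quadratic_form assms] by auto

lemma integral_transpose_eq:
  fixes Y :: "'a \<Rightarrow> real^'n^'n"
  assumes "integrable M Y" "\<And>\<omega>. \<omega> \<in> space M \<Longrightarrow> transpose (Y \<omega>) = Y \<omega>"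
  shows "transpose (\<integral>\<omega>. Y \<omega> \<partial>M) = (\<integral>\<omega>. Y \<omega> \<partial>M)"
proof -
  have "transpose (\<integral>\<omega>. Y \<omega> \<partial>M) = (\<integral>\<omega>. transpose (Y \<omega>) \<partial>M)"
    using integral_bounded_linear[OF bounded_linear_transpose assms(1)] by simp
  also have "\<dots> = (\<integral>\<omega>. Y \<omega> \<partial>M)" by (rule Bochner_Integration.integral_cong) (auto simp: assms(2))
  finally show ?thesis .
qed

lemma expectation_trace_mult_indep:
  fixes F G :: "'a \<Rightarrow> real^'n^'n"
  assumes ind: "indep_var borel F borel G" and F: "integrable M F" and G: "integrable M G"
  shows "integrable M (\<lambda>\<omega>. trace (F \<omega> ** G \<omega>))"
    and "(\<integral>\<omega>. trace (F \<omega> ** G \<omega>) \<partial>M) = trace ((\<integral>\<omega>. F \<omega> \<partial>M) ** (\<integral>\<omega>. G \<omega> \<partial>M))"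
proof -
  have bl: "bounded_linear (\<lambda>A :: real^'n^'n. A $ i $ j)" for i j
    by (rule bounded_linear_compose[OF bounded_linear_vec_nth bounded_linear_vec_nth])
  have m: "(\<lambda>A :: real^'n^'n. A $ i $ j) \<in> borel_measurable borel" for i j
    by (intro borel_measurable_continuous_onI linear_continuous_on bl)
  note Fe = integrable_bounded_linear[OF bl F] integral_bounded_linear[OF bl F]
  note Ge = integrable_bounded_linear[OF bl G] integral_bounded_linear[OF bl G]
  have "indep_var borel (\<lambda>\<omega>. F \<omega> $ i $ j) borel (\<lambda>\<omega>. G \<omega> $ j $ i)" for i j
    using indep_var_compose[OF ind m[of i j] m[of j i]] by (simp add: comp_def)
  from indep_var_integrable[OF this Fe(1) Ge(1)] indep_var_lebesgue_integral[OF this Fe(1) Ge(1)]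
  have e: "integrable M (\<lambda>\<omega>. F \<omega> $ i $ j * G \<omega> $ j $ i)"
    "(\<integral>\<omega>. F \<omega> $ i $ j * G \<omega> $ j $ i \<partial>M) = (\<integral>\<omega>. F \<omega> \<partial>M) $ i $ j * (\<integral>\<omega>. G \<omega> \<partial>M) $ j $ i" for i j
    by (auto simp: Fe(2) Ge(2))
  show "integrable M (\<lambda>\<omega>. trace (F \<omega> ** G \<omega>))"
    unfolding trace_def matrix_matrix_mult_def by (simp add: e(1))
  show "(\<integral>\<omega>. trace (F \<omega> ** G \<omega>) \<partial>M) = trace ((\<integral>\<omega>. F \<omega> \<partial>M) ** (\<integral>\<omega>. G \<omega> \<partial>M))"
    unfolding trace_def matrix_matrix_mult_def by (simp add: e)
qed

lemma integrable_mexp: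
  fixes B :: "'a \<Rightarrow> real^'n^'n"
  assumes [measurable]: "B \<in> borel_measurable M"
    and "\<And>\<omega>. \<omega> \<in> space M \<Longrightarrow> transpose (B \<omega>) = B \<omega>" and "\<And>\<omega>. \<omega> \<in> space M \<Longrightarrow> norm (B \<omega>) \<le> c"
  shows "integrable M (\<lambda>\<omega>. mexp (B \<omega>))"
proof (rule integrable_const_bound)
  have "norm (mexp (B \<omega>)) \<le> real CARD('n) * exp c" if "\<omega> \<in> space M" for \<omega>
  proof (rule norm_mexp_le[OF assms(2)[OF that]])
    show "x \<bullet> (B \<omega> *v x) \<le> c * (x \<bullet> x)" for x
      using quadratic_form_le_norm[of x "B \<omega>"] mult_right_mono[OF assms(3)[OF that] inner_ge_zero[of x]] by linarith
  qed
  then show "AE \<omega> in M. norm (mexp (B \<omega>)) \<le> real CARD('n) * exp c" by simp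
  show "(\<lambda>\<omega>. mexp (B \<omega>)) \<in> borel_measurable M"
    using measurable_compose[OF assms(1) borel_measurable_mexp] .
qed

text \<open>The Ahlswede-Winter recursion.  Golden-Thompson separates the new summand \<open>Y j\<close> from the sum over \<open>J\<close>;
  \<open>exp (Y j)\<close> is replaced by \<open>I + Y j + (Y j)\<^sup>2\<close> under the trace; by independence the expectation of the trace is
  the trace of the product of the expectations, and the second one is at most \<open>(1 + v) I\<close>.\<close>

lemma expectation_trace_mexp_sum_le:
  fixes Y :: "'i \<Rightarrow> 'a \<Rightarrow> real^'n^'n"
  assumes ind: "indep_vars (\<lambda>_. borel) Y I"
    and sym: "\<And>i \<omega>. i \<in> I \<Longrightarrow> \<omega> \<in> space M \<Longrightarrow> transpose (Y i \<omega>) = Y i \<omega>"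
    and bnd: "\<And>i \<omega>. i \<in> I \<Longrightarrow> \<omega> \<in> space M \<Longrightarrow> norm (Y i \<omega>) \<le> c"
    and le1: "\<And>i \<omega> x. i \<in> I \<Longrightarrow> \<omega> \<in> space M \<Longrightarrow> x \<bullet> (Y i \<omega> *v x) \<le> x \<bullet> x"
    and mean: "\<And>i. i \<in> I \<Longrightarrow> (\<integral>\<omega>. Y i \<omega> \<partial>M) = 0"
    and var: "\<And>i x. i \<in> I \<Longrightarrow> (\<integral>\<omega>. (norm (Y i \<omega> *v x))\<^sup>2 \<partial>M) \<le> v * (x \<bullet> x)"
    and v: "0 \<le> v" and "finite J" "J \<subseteq> I"
  shows "(\<integral>\<omega>. trace (mexp (\<Sum>i\<in>J. Y i \<omega>)) \<partial>M) \<le> real CARD('n) * (1 + v) ^ card J"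
  using \<open>finite J\<close> \<open>J \<subseteq> I\<close>
proof (induction J rule: finite_induct)
  case empty
  then show ?case by (simp add: mexp_0 trace_I prob_space)
next
  case (insert j J)
  have meas: "Y i \<in> borel_measurable M" if "i \<in> I" for i
    using indep_vars_measurable[OF ind that] .
  have jI: "j \<in> I" and JI: "J \<subseteq> I" using insert.prems by auto
  note [measurable] = meas[OF jI]
  define B where "B \<omega> = (\<Sum>i\<in>J. Y i \<omega>)" for \<omega>
  define F where "F \<omega> = mexp (B \<omega>)" for \<omega>
  define P where "P A = mat 1 + A + A ** A" for A :: "real^'n^'n"
  define G where "G \<omega> = P (Y j \<omega>)" for \<omega>
  have [measurable]: "B \<in> borel_measurable M" unfolding B_def[abs_def] using JI meas by (auto intro!: borel_measurable_sum)
  have symB: "transpose (B \<omega>) = B \<omega>" if "\<omega> \<in> space M" for \<omega>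
    unfolding B_def transpose_sum using sym JI that by (auto intro!: sum.cong)
  have normB: "norm (B \<omega>) \<le> real (card J) * c" if "\<omega> \<in> space M" for \<omega>
    unfolding B_def using bnd JI that by (auto intro!: sum_norm_bound)
  have intF: "integrable M F" unfolding F_def[abs_def] by (rule integrable_mexp) (use symB normB in auto)
  have intY: "integrable M (Y j)" by (rule integrable_const_bound[of _ c]) (use bnd jI in auto)
  have normYY: "norm (Y j \<omega> ** Y j \<omega>) \<le> c * c" if "\<omega> \<in> space M" for \<omega>
    using norm_matrix_mult_le[of "Y j \<omega>" "Y j \<omega>"] bnd[OF jI that]
    by (meson mult_mono norm_ge_zero order_trans)
  have intYY: "integrable M (\<lambda>\<omega>. Y j \<omega> ** Y j \<omega>)"
    by (rule integrable_const_bound[of _ "c * c"]) (use normYY in auto)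
  have intG: "integrable M G" unfolding G_def[abs_def] P_def using intY intYY by simp
  \<comment> \<open>\<open>F\<close> depends on the summands in \<open>J\<close> only, \<open>G\<close> on \<open>Y j\<close> only.\<close>
  have indFG: "indep_var borel F borel G"
  proof -
    have r: "indep_var (PiM J (\<lambda>_. borel)) (\<lambda>\<omega>. restrict (\<lambda>i. Y i \<omega>) J) (PiM {j} (\<lambda>_. borel)) (\<lambda>\<omega>. restrict (\<lambda>i. Y i \<omega>) {j})"
      using insert.hyps jI JI by (intro indep_var_restrict[OF ind]) auto
    have mF: "(\<lambda>y. mexp (\<Sum>i\<in>J. y i)) \<in> borel_measurable (PiM J (\<lambda>_. borel))"
      by (rule measurable_compose[OF _ borel_measurable_mexp]) (auto intro!: borel_measurable_sum measurable_component_singleton)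
    have mG: "(\<lambda>y. P (y j)) \<in> borel_measurable (PiM {j} (\<lambda>_. borel))"
      unfolding P_def by measurable
    show ?thesis
      using indep_var_compose[OF r mF mG] by (simp add: comp_def F_def[abs_def] B_def G_def[abs_def] cong: sum.cong)
  qed
  have psdF: "psd (\<integral>\<omega>. F \<omega> \<partial>M)"
  proof -
    have "transpose (\<integral>\<omega>. F \<omega> \<partial>M) = (\<integral>\<omega>. F \<omega> \<partial>M)"
      by (rule integral_transpose_eq[OF intF]) (use psd_mexp[OF symB] in \<open>simp add: psd_def F_def\<close>)
    moreover have "0 \<le> x \<bullet> ((\<integral>\<omega>. F \<omega> \<partial>M) *v x)" for x
      unfolding integral_quadratic_form[OF intF]
      by (rule Bochner_Integration.integral_nonneg_AE) (use psd_mexp[OF symB] in \<open>simp add: psd_def F_def\<close>)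
    ultimately show ?thesis by (simp add: psd_def)
  qed
  have quadG: "x \<bullet> ((\<integral>\<omega>. G \<omega> \<partial>M) *v x) \<le> x \<bullet> (((1 + v) *\<^sub>R mat 1) *v x)" for x
  proof -
    have "(\<integral>\<omega>. G \<omega> \<partial>M) = mat 1 + (\<integral>\<omega>. Y j \<omega> ** Y j \<omega> \<partial>M)"
      unfolding G_def P_def using intY intYY mean[OF jI] by (simp add: prob_space)
    then have "x \<bullet> ((\<integral>\<omega>. G \<omega> \<partial>M) *v x) = x \<bullet> x + (\<integral>\<omega>. x \<bullet> ((Y j \<omega> ** Y j \<omega>) *v x) \<partial>M)"
      by (simp add: matrix_vector_mult_add_rdistrib inner_add_right integral_quadratic_form[OF intYY])
    also have "(\<integral>\<omega>. x \<bullet> ((Y j \<omega> ** Y j \<omega>) *v x) \<partial>M) = (\<integral>\<omega>. (norm (Y j \<omega> *v x))\<^sup>2 \<partial>M)"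
      by (intro Bochner_Integration.integral_cong refl)
        (simp add: matrix_vector_mul_assoc[symmetric] symmetric_inner[OF sym[OF jI]] dot_square_norm)
    also have "\<dots> \<le> v * (x \<bullet> x)" by (rule var[OF jI])
    finally show ?thesis by (simp add: scaleR_matrix_vector_assoc[symmetric] algebra_simps)
  qed
  have "(\<integral>\<omega>. trace (mexp (\<Sum>i\<in>insert j J. Y i \<omega>)) \<partial>M) \<le> (\<integral>\<omega>. trace (F \<omega> ** G \<omega>) \<partial>M)"
  proof (rule integral_mono)
    have "integrable M (\<lambda>\<omega>. mexp (\<Sum>i\<in>insert j J. Y i \<omega>))"
    proof (rule integrable_mexp)
      show "(\<lambda>\<omega>. \<Sum>i\<in>insert j J. Y i \<omega>) \<in> borel_measurable M" using insert.prems meas by (auto intro!: borel_measurable_sum)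
      show "transpose (\<Sum>i\<in>insert j J. Y i \<omega>) = (\<Sum>i\<in>insert j J. Y i \<omega>)" if "\<omega> \<in> space M" for \<omega>
        unfolding transpose_sum using sym insert.prems that by (auto intro!: sum.cong)
      show "norm (\<Sum>i\<in>insert j J. Y i \<omega>) \<le> real (card (insert j J)) * c" if "\<omega> \<in> space M" for \<omega>
        using bnd insert.prems that by (intro sum_norm_bound) auto
    qed
    then show "integrable M (\<lambda>\<omega>. trace (mexp (\<Sum>i\<in>insert j J. Y i \<omega>)))"
      by (rule integrable_bounded_linear[OF bounded_linear_trace])
    show "integrable M (\<lambda>\<omega>. trace (F \<omega> ** G \<omega>))" by (rule expectation_trace_mult_indep[OF indFG intF intG])
    fix \<omega> assume w: "\<omega> \<in> space M"
    have "trace (mexp (\<Sum>i\<in>insert j J. Y i \<omega>)) = trace (mexp (B \<omega> + Y j \<omega>))"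
      using insert.hyps by (simp add: B_def add.commute)
    also have "\<dots> \<le> trace (F \<omega> ** mexp (Y j \<omega>))"
      unfolding F_def by (rule golden_thompson[OF symB[OF w] sym[OF jI w]])
    also have "\<dots> \<le> trace (F \<omega> ** G \<omega>)"
      unfolding F_def G_def P_def
      by (intro trace_psd_mult_mono psd_mexp symB[OF w] quadratic_form_mexp_le sym[OF jI w] le1[OF jI w])
    finally show "trace (mexp (\<Sum>i\<in>insert j J. Y i \<omega>)) \<le> trace (F \<omega> ** G \<omega>)" .
  qed
  also have "\<dots> = trace ((\<integral>\<omega>. F \<omega> \<partial>M) ** (\<integral>\<omega>. G \<omega> \<partial>M))" by (rule expectation_trace_mult_indep[OF indFG intF intG])
  also have "\<dots> \<le> trace ((\<integral>\<omega>. F \<omega> \<partial>M) ** ((1 + v) *\<^sub>R mat 1))" by (rule trace_psd_mult_mono[OF psdF quadG])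
  also have "\<dots> = (1 + v) * trace (\<integral>\<omega>. F \<omega> \<partial>M)"
  proof -
    have "A ** ((1 + v) *\<^sub>R mat 1) = (1 + v) *\<^sub>R A" for A :: "real^'n^'n"
      by (simp add: matrix_eq matrix_vector_mul_assoc[symmetric] scaleR_matrix_vector_assoc[symmetric] matrix_vector_mult_scaleR)
    then show ?thesis by (simp add: trace_def sum_distrib_left)
  qed
  also have "trace (\<integral>\<omega>. F \<omega> \<partial>M) = (\<integral>\<omega>. trace (F \<omega>) \<partial>M)"
    by (rule integral_bounded_linear[OF bounded_linear_trace intF, symmetric])
  also have "(1 + v) * \<dots> \<le> (1 + v) * (real CARD('n) * (1 + v) ^ card J)"
    using insert.IH[OF JI] v by (intro mult_left_mono) (auto simp: F_def B_def)
  finally show ?case using insert.hyps by (simp add: algebra_simps)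
qed

text \<open>Markov's inequality for the trace of the exponential, which dominates \<open>exp t\<close> as soon as some eigenvalue
  exceeds \<open>t\<close>.\<close>

lemma matrix_chernoff_bound:
  fixes Y :: "'i \<Rightarrow> 'a \<Rightarrow> real^'n^'n"
  assumes ind: "indep_vars (\<lambda>_. borel) Y I" and fin: "finite I"
    and sym: "\<And>i \<omega>. i \<in> I \<Longrightarrow> \<omega> \<in> space M \<Longrightarrow> transpose (Y i \<omega>) = Y i \<omega>"
    and bnd: "\<And>i \<omega>. i \<in> I \<Longrightarrow> \<omega> \<in> space M \<Longrightarrow> norm (Y i \<omega>) \<le> c"
    and le1: "\<And>i \<omega> x. i \<in> I \<Longrightarrow> \<omega> \<in> space M \<Longrightarrow> x \<bullet> (Y i \<omega> *v x) \<le> x \<bullet> x"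
    and mean: "\<And>i. i \<in> I \<Longrightarrow> (\<integral>\<omega>. Y i \<omega> \<partial>M) = 0"
    and var: "\<And>i x. i \<in> I \<Longrightarrow> (\<integral>\<omega>. (norm (Y i \<omega> *v x))\<^sup>2 \<partial>M) \<le> v * (x \<bullet> x)"
    and v: "0 \<le> v"
  shows "prob {\<omega> \<in> space M. \<not> (\<forall>u. u \<bullet> ((\<Sum>i\<in>I. Y i \<omega>) *v u) \<le> t * (u \<bullet> u))} \<le> real CARD('n) * exp (real (card I) * v - t)"
proof -
  define B where "B \<omega> = (\<Sum>i\<in>I. Y i \<omega>)" for \<omega>
  let ?E = "{\<omega> \<in> space M. \<not> (\<forall>u. u \<bullet> (B \<omega> *v u) \<le> t * (u \<bullet> u))}"
  have [measurable]: "B \<in> borel_measurable M" unfolding B_def[abs_def]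
    using indep_vars_measurable[OF ind] by (auto intro!: borel_measurable_sum)
  have symB: "transpose (B \<omega>) = B \<omega>" if "\<omega> \<in> space M" for \<omega>
    unfolding B_def transpose_sum using sym that by (auto intro!: sum.cong)
  have normB: "norm (B \<omega>) \<le> real (card I) * c" if "\<omega> \<in> space M" for \<omega>
    unfolding B_def using bnd that by (auto intro!: sum_norm_bound)
  have intB: "integrable M (\<lambda>\<omega>. trace (mexp (B \<omega>)))"
    by (intro integrable_bounded_linear[OF bounded_linear_trace] integrable_mexp) (use symB normB in auto)
  have E: "?E \<in> events" by measurable
  have "exp t * prob ?E = (\<integral>\<omega>. exp t * indicator ?E \<omega> \<partial>M)" using E by simp
  also have "\<dots> \<le> (\<integral>\<omega>. trace (mexp (B \<omega>)) \<partial>M)"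
  proof (rule integral_mono[OF _ intB])
    show "integrable M (\<lambda>\<omega>. exp t * indicator ?E \<omega>)" using E by (simp add: integrable_real_indicator emeasure_eq_measure)
    show "exp t * indicator ?E \<omega> \<le> trace (mexp (B \<omega>))" if "\<omega> \<in> space M" for \<omega>
      using exp_le_trace_mexp[OF symB[OF that]] trace_psd_nonneg[OF psd_mexp[OF symB[OF that]]]
      by (auto simp: indicator_def not_le)
  qed
  also have "\<dots> \<le> real CARD('n) * (1 + v) ^ card I"
    unfolding B_def by (rule expectation_trace_mexp_sum_le[OF ind sym bnd le1 mean var v fin]) auto
  also have "\<dots> \<le> real CARD('n) * exp (real (card I) * v)"
    using v by (intro mult_left_mono) (auto simp: exp_of_nat_mult intro!: power_mono)
  finally have "prob ?E \<le> real CARD('n) * exp (real (card I) * v) / exp t" by (simp add: pos_le_divide_eq mult.commute)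
  then show ?thesis by (simp add: B_def exp_diff)
qed

text \<open>Since \<open>0 \<le> Y \<le> \<theta>\<close>, both \<open>(Y - E Y) / \<theta>\<close> and its negative are at most \<open>I\<close>, so the Chernoff bound applies
  on both sides with the inverse temperature \<open>1 / \<theta>\<close>.  The second moments need no centring: the variance of
  \<open>Y x\<close> is at most \<open>E \<bar>Y x\<bar>\<^sup>2\<close>.\<close>

lemma matrix_bernstein_psd:
  fixes Y :: "'i \<Rightarrow> 'a \<Rightarrow> real^'n^'n"
  assumes ind: "indep_vars (\<lambda>_. borel) Y I" and fin: "finite I"
    and psd: "\<And>i \<omega>. i \<in> I \<Longrightarrow> \<omega> \<in> space M \<Longrightarrow> psd (Y i \<omega>)"
    and bnd: "\<And>i \<omega>. i \<in> I \<Longrightarrow> \<omega> \<in> space M \<Longrightarrow> norm (Y i \<omega>) \<le> \<theta>" and \<theta>: "0 < \<theta>"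
    and var: "\<And>i x. i \<in> I \<Longrightarrow> (\<integral>\<omega>. (norm (Y i \<omega> *v x))\<^sup>2 \<partial>M) \<le> v * (x \<bullet> x)"
    and v: "0 \<le> v"
  shows "prob {\<omega> \<in> space M. \<not> (\<forall>u. \<bar>u \<bullet> ((\<Sum>i\<in>I. Y i \<omega> - (\<integral>\<omega>. Y i \<omega> \<partial>M)) *v u)\<bar> \<le> (\<theta> * l + real (card I) * v / \<theta>) * (u \<bullet> u))}
    \<le> 2 * real CARD('n) * exp (- l)"
proof -
  define E where "E i = (\<integral>\<omega>. Y i \<omega> \<partial>M)" for i
  define t where "t = l + real (card I) * (v / \<theta>\<^sup>2)"
  note meas = indep_vars_measurable[OF ind]
  have int: "integrable M (Y i)" if "i \<in> I" for i
    by (rule integrable_const_bound[of _ \<theta>]) (use bnd that meas in auto)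
  have sym: "transpose (Y i \<omega>) = Y i \<omega>" if "i \<in> I" "\<omega> \<in> space M" for i \<omega> using psd[OF that] by (simp add: psd_def)
  have symE: "transpose (E i) = E i" if "i \<in> I" for i
    unfolding E_def by (rule integral_transpose_eq[OF int[OF that] sym[OF that]])
  have nn: "0 \<le> x \<bullet> (Y i \<omega> *v x)" if "i \<in> I" "\<omega> \<in> space M" for i \<omega> x using psd[OF that] by (simp add: psd_def)
  have up: "x \<bullet> (Y i \<omega> *v x) \<le> \<theta> * (x \<bullet> x)" if "i \<in> I" "\<omega> \<in> space M" for i \<omega> x
    using quadratic_form_le_norm[of x "Y i \<omega>"] bnd[OF that] by (meson inner_ge_zero mult_right_mono order_trans)
  have Enn: "0 \<le> x \<bullet> (E i *v x)" if "i \<in> I" for i x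
    unfolding E_def integral_quadratic_form(2)[OF int[OF that]]
    by (rule Bochner_Integration.integral_nonneg_AE) (use nn[OF that] in auto)
  have Eup: "x \<bullet> (E i *v x) \<le> \<theta> * (x \<bullet> x)" if "i \<in> I" for i x
    unfolding E_def integral_quadratic_form(2)[OF int[OF that]]
    by (rule integral_le_const[OF integral_quadratic_form(1)[OF int[OF that]]]) (use up[OF that] in auto)
  have normE: "norm (E i) \<le> \<theta>" if "i \<in> I" for i
  proof -
    have "norm (E i) \<le> (\<integral>\<omega>. norm (Y i \<omega>) \<partial>M)" unfolding E_def by (rule integral_norm_bound)
    also have "\<dots> \<le> \<theta>" using int[OF that] by (intro integral_le_const) (use bnd[OF that] in auto)
    finally show ?thesis .
  qed
  have varE: "(\<integral>\<omega>. (norm ((Y i \<omega> - E i) *v x))\<^sup>2 \<partial>M) \<le> v * (x \<bullet> x)" if i: "i \<in> I" for i x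
  proof -
    have [measurable]: "Y i \<in> borel_measurable M" by (rule meas[OF i])
    have Yx: "integrable M (\<lambda>\<omega>. Y i \<omega> *v x)" "(\<integral>\<omega>. Y i \<omega> *v x \<partial>M) = E i *v x"
      using integrable_bounded_linear[OF bounded_linear_matrix_vector_left int[OF i], of x]
        integral_bounded_linear[OF bounded_linear_matrix_vector_left int[OF i], of x] by (auto simp: E_def)
    have sq: "integrable M (\<lambda>\<omega>. (norm (Y i \<omega> *v x))\<^sup>2)"
    proof (rule integrable_const_bound[of _ "(\<theta> * norm x)\<^sup>2"])
      have "norm (Y i \<omega> *v x) \<le> \<theta> * norm x" if "\<omega> \<in> space M" for \<omega>
        using norm_matrix_vector_le[of "Y i \<omega>" x] bnd[OF i that] by (meson mult_right_mono norm_ge_zero order_trans)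
      then show "AE \<omega> in M. norm ((norm (Y i \<omega> *v x))\<^sup>2) \<le> (\<theta> * norm x)\<^sup>2" by (auto intro!: power_mono)
    qed measurable
    have "(\<integral>\<omega>. (norm ((Y i \<omega> - E i) *v x))\<^sup>2 \<partial>M) = (\<integral>\<omega>. (norm (Y i \<omega> *v x))\<^sup>2 - 2 * ((Y i \<omega> *v x) \<bullet> (E i *v x)) + (norm (E i *v x))\<^sup>2 \<partial>M)"
      by (simp add: matrix_vector_mult_diff_rdistrib power2_norm_eq_inner inner_diff_left inner_diff_right inner_commute algebra_simps)
    also have "\<dots> = (\<integral>\<omega>. (norm (Y i \<omega> *v x))\<^sup>2 \<partial>M) - 2 * ((E i *v x) \<bullet> (E i *v x)) + (norm (E i *v x))\<^sup>2"
      using sq Yx by (simp add: prob_space)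
    also have "\<dots> \<le> (\<integral>\<omega>. (norm (Y i \<omega> *v x))\<^sup>2 \<partial>M)" by (simp add: dot_square_norm)
    also have "\<dots> \<le> v * (x \<bullet> x)" by (rule var[OF i])
    finally show ?thesis .
  qed
  have tail: "prob {\<omega> \<in> space M. \<not> (\<forall>u. u \<bullet> ((\<Sum>i\<in>I. s *\<^sub>R (Y i \<omega> - E i)) *v u) \<le> t * (u \<bullet> u))} \<le> real CARD('n) * exp (- l)"
    if s: "s = 1 / \<theta> \<or> s = - (1 / \<theta>)" for s
  proof -
    have s2: "s\<^sup>2 = 1 / \<theta>\<^sup>2" using s by (auto simp: power_divide)
    have q: "x \<bullet> ((s *\<^sub>R (Y i \<omega> - E i)) *v x) = s * (x \<bullet> (Y i \<omega> *v x) - x \<bullet> (E i *v x))" for i \<omega> x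
      by (simp add: scaleR_matrix_vector_assoc[symmetric] matrix_vector_mult_diff_rdistrib inner_diff_right)
    have "prob {\<omega> \<in> space M. \<not> (\<forall>u. u \<bullet> ((\<Sum>i\<in>I. s *\<^sub>R (Y i \<omega> - E i)) *v u) \<le> t * (u \<bullet> u))}
      \<le> real CARD('n) * exp (real (card I) * (v / \<theta>\<^sup>2) - t)"
    proof (rule matrix_chernoff_bound[OF _ fin])
      show "indep_vars (\<lambda>_. borel) (\<lambda>i \<omega>. s *\<^sub>R (Y i \<omega> - E i)) I"
        by (rule indep_vars_compose2[OF ind]) measurable
      show "transpose (s *\<^sub>R (Y i \<omega> - E i)) = s *\<^sub>R (Y i \<omega> - E i)" if "i \<in> I" "\<omega> \<in> space M" for i \<omega>
        using linear_diff[OF bounded_linear.linear[OF bounded_linear_transpose], of "Y i \<omega>" "E i"]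
        by (simp add: transpose_scalar sym[OF that] symE[OF that(1)])
      show "norm (s *\<^sub>R (Y i \<omega> - E i)) \<le> \<bar>s\<bar> * (\<theta> + \<theta>)" if "i \<in> I" "\<omega> \<in> space M" for i \<omega>
        using norm_triangle_le_diff[of "Y i \<omega>" "E i" "\<theta> + \<theta>"] bnd[OF that] normE[OF that(1)] by (simp add: mult_left_mono)
      show "x \<bullet> ((s *\<^sub>R (Y i \<omega> - E i)) *v x) \<le> x \<bullet> x" if "i \<in> I" "\<omega> \<in> space M" for i \<omega> x
        using s
      proof
        assume "s = 1 / \<theta>"
        have "(x \<bullet> (Y i \<omega> *v x) - x \<bullet> (E i *v x)) / \<theta> \<le> x \<bullet> x"
          using up[OF that, of x] Enn[OF that(1), of x] \<theta> by (simp add: pos_divide_le_eq mult.commute)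
        then show ?thesis unfolding q by (simp add: \<open>s = 1 / \<theta>\<close>)
      next
        assume "s = - (1 / \<theta>)"
        have "(x \<bullet> (E i *v x) - x \<bullet> (Y i \<omega> *v x)) / \<theta> \<le> x \<bullet> x"
          using nn[OF that, of x] Eup[OF that(1), of x] \<theta> by (simp add: pos_divide_le_eq mult.commute)
        then show ?thesis unfolding q by (simp add: \<open>s = - (1 / \<theta>)\<close> diff_divide_distrib)
      qed
      show "(\<integral>\<omega>. s *\<^sub>R (Y i \<omega> - E i) \<partial>M) = 0" if "i \<in> I" for i
        using int[OF that] by (simp add: prob_space E_def)
      show "(\<integral>\<omega>. (norm ((s *\<^sub>R (Y i \<omega> - E i)) *v x))\<^sup>2 \<partial>M) \<le> v / \<theta>\<^sup>2 * (x \<bullet> x)" if "i \<in> I" for i x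
      proof -
        have "(\<integral>\<omega>. (norm ((s *\<^sub>R (Y i \<omega> - E i)) *v x))\<^sup>2 \<partial>M) = (1 / \<theta>\<^sup>2) * (\<integral>\<omega>. (norm ((Y i \<omega> - E i) *v x))\<^sup>2 \<partial>M)"
          by (simp add: scaleR_matrix_vector_assoc[symmetric] power_mult_distrib s2)
        also have "\<dots> \<le> (1 / \<theta>\<^sup>2) * (v * (x \<bullet> x))" by (intro mult_left_mono varE[OF that]) auto
        finally show ?thesis by simp
      qed
      show "0 \<le> v / \<theta>\<^sup>2" using v by simp
    qed
    then show ?thesis by (simp add: t_def)
  qed
  let ?U = "\<lambda>s. {\<omega> \<in> space M. \<not> (\<forall>u. u \<bullet> ((\<Sum>i\<in>I. s *\<^sub>R (Y i \<omega> - E i)) *v u) \<le> t * (u \<bullet> u))}"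
  have U: "?U s \<in> events" for s
  proof -
    have [measurable]: "(\<lambda>\<omega>. \<Sum>i\<in>I. s *\<^sub>R (Y i \<omega> - E i)) \<in> borel_measurable M" using meas by (auto intro!: borel_measurable_sum)
    show ?thesis by measurable
  qed
  have "prob {\<omega> \<in> space M. \<not> (\<forall>u. \<bar>u \<bullet> ((\<Sum>i\<in>I. Y i \<omega> - E i) *v u)\<bar> \<le> (\<theta> * l + real (card I) * v / \<theta>) * (u \<bullet> u))}
    \<le> prob (?U (1 / \<theta>) \<union> ?U (- (1 / \<theta>)))"
  proof (rule finite_measure_mono)
    show "{\<omega> \<in> space M. \<not> (\<forall>u. \<bar>u \<bullet> ((\<Sum>i\<in>I. Y i \<omega> - E i) *v u)\<bar> \<le> (\<theta> * l + real (card I) * v / \<theta>) * (u \<bullet> u))}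
      \<subseteq> ?U (1 / \<theta>) \<union> ?U (- (1 / \<theta>))"
    proof (rule subsetI, rule ccontr)
      fix \<omega>
      define a where "a u = u \<bullet> ((\<Sum>i\<in>I. Y i \<omega> - E i) *v u)" for u
      assume w: "\<omega> \<in> {\<omega> \<in> space M. \<not> (\<forall>u. \<bar>u \<bullet> ((\<Sum>i\<in>I. Y i \<omega> - E i) *v u)\<bar> \<le> (\<theta> * l + real (card I) * v / \<theta>) * (u \<bullet> u))}"
        and n: "\<omega> \<notin> ?U (1 / \<theta>) \<union> ?U (- (1 / \<theta>))"
      have s: "u \<bullet> ((\<Sum>i\<in>I. s *\<^sub>R (Y i \<omega> - E i)) *v u) = s * a u" for s u
        unfolding a_def scaleR_sum_right[symmetric] scaleR_matrix_vector_assoc[symmetric] by simp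
      have "(1 / \<theta>) * a u \<le> t * (u \<bullet> u) \<and> - (1 / \<theta>) * a u \<le> t * (u \<bullet> u)" for u
      proof -
        have "u \<bullet> ((\<Sum>i\<in>I. (1 / \<theta>) *\<^sub>R (Y i \<omega> - E i)) *v u) \<le> t * (u \<bullet> u)"
          "u \<bullet> ((\<Sum>i\<in>I. - (1 / \<theta>) *\<^sub>R (Y i \<omega> - E i)) *v u) \<le> t * (u \<bullet> u)"
          using w n by blast+
        then show ?thesis unfolding s by blast
      qed
      then have "\<bar>a u\<bar> / \<theta> \<le> t * (u \<bullet> u)" for u by (cases "a u \<ge> 0") auto
      then have "\<bar>a u\<bar> \<le> \<theta> * (t * (u \<bullet> u))" for u using \<theta> by (simp add: pos_divide_le_eq mult.commute)
      moreover have "\<theta> * t = \<theta> * l + real (card I) * v / \<theta>"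
        using \<theta> by (simp add: t_def field_simps power2_eq_square)
      ultimately have "\<bar>a u\<bar> \<le> (\<theta> * l + real (card I) * v / \<theta>) * (u \<bullet> u)" for u
        by (metis mult.assoc)
      then show False using w by (simp add: a_def)
    qed
  qed (intro sets.Un U)
  also have "\<dots> \<le> prob (?U (1 / \<theta>)) + prob (?U (- (1 / \<theta>)))" by (rule measure_Un_le) (rule U)+
  also have "\<dots> \<le> real CARD('n) * exp (- l) + real CARD('n) * exp (- l)" by (intro add_mono tail) auto
  finally show ?thesis by (simp add: E_def)
qed

end

section \<open>Truncated empirical covariance of a whitened sample\<close>

lemma continuous_on_outer: "continuous_on UNIV (outer :: real^'n \<Rightarrow> real^'n^'n)"
  unfolding outer_def[abs_def]
  by (intro continuous_on_vec_lambda continuous_intros)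

lemma borel_measurable_outer [measurable]: "outer \<in> borel_measurable borel"
  by (rule borel_measurable_continuous_onI[OF continuous_on_outer])

lemma borel_measurable_trunc_weight [measurable]: "trunc_weight \<theta> \<in> borel_measurable borel"
  unfolding trunc_weight_def[abs_def] by measurable

lemma trunc_weight_bounds:
  assumes "0 < \<theta>"
  shows "0 \<le> trunc_weight \<theta> r" "trunc_weight \<theta> r \<le> 1" "trunc_weight \<theta> r * r\<^sup>2 \<le> \<theta>"
    and "(1 - trunc_weight \<theta> r) * \<theta> \<le> r\<^sup>2"
proof -
  show "0 \<le> trunc_weight \<theta> r" using assms by (simp add: trunc_weight_def)
  show "trunc_weight \<theta> r \<le> 1" by (simp add: trunc_weight_def min_le_iff_disj)
  show "trunc_weight \<theta> r * r\<^sup>2 \<le> \<theta>" using assms by (simp add: trunc_weight_def)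
  show "(1 - trunc_weight \<theta> r) * \<theta> \<le> r\<^sup>2"
  proof (cases "r\<^sup>2 \<le> \<theta>")
    case True
    then show ?thesis by (simp add: trunc_weight_def)
  next
    case False
    have "(1 - trunc_weight \<theta> r) * \<theta> \<le> 1 * \<theta>"
      using assms by (intro mult_right_mono) (auto simp: trunc_weight_def)
    then show ?thesis using False by simp
  qed
qed

lemma psd_weighted_outer: "0 \<le> w \<Longrightarrow> psd (w *\<^sub>R outer z)"
  by (simp add: psd_def transpose_scalar transpose_outer scaleR_matrix_vector_assoc[symmetric] inner_outer)

context prob_space begin

text \<open>Cauchy-Schwarz in the form needed, from \<open>f\<^sup>2 g\<^sup>2 \<le> (c f\<^sup>4 + g\<^sup>4 / c) / 2\<close> with the optimal ratio \<open>c\<close>; \<open>F\<close> and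
  \<open>G\<close> are shifted by \<open>e > 0\<close> to keep \<open>c\<close> well defined when one of them vanishes.\<close>

lemma fourth_moment_product:
  fixes f g :: "'a \<Rightarrow> real"
  assumes [measurable]: "f \<in> borel_measurable M" "g \<in> borel_measurable M"
    and f: "integrable M (\<lambda>\<omega>. (f \<omega>) ^ 4)" "(\<integral>\<omega>. (f \<omega>) ^ 4 \<partial>M) \<le> k * F\<^sup>2"
    and g: "integrable M (\<lambda>\<omega>. (g \<omega>) ^ 4)" "(\<integral>\<omega>. (g \<omega>) ^ 4 \<partial>M) \<le> k * G\<^sup>2"
    and nn: "0 \<le> F" "0 \<le> G" "0 \<le> k"
  shows "integrable M (\<lambda>\<omega>. (f \<omega>)\<^sup>2 * (g \<omega>)\<^sup>2)" "(\<integral>\<omega>. (f \<omega>)\<^sup>2 * (g \<omega>)\<^sup>2 \<partial>M) \<le> k * F * G"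
proof -
  have amgm: "x\<^sup>2 * y\<^sup>2 \<le> (c * x ^ 4 + y ^ 4 / c) / 2" if "c > 0" for x y c :: real
  proof -
    have "0 \<le> (c * x\<^sup>2 - y\<^sup>2)\<^sup>2 / c" using that by simp
    also have "\<dots> = c * x ^ 4 + y ^ 4 / c - 2 * (x\<^sup>2 * y\<^sup>2)"
      using that by (simp add: power2_eq_square power4_eq_xxxx field_simps)
    finally show ?thesis by simp
  qed
  show int: "integrable M (\<lambda>\<omega>. (f \<omega>)\<^sup>2 * (g \<omega>)\<^sup>2)"
  proof (rule Bochner_Integration.integrable_bound)
    show "integrable M (\<lambda>\<omega>. (f \<omega>) ^ 4 + (g \<omega>) ^ 4)" using f g by simp
    have "norm ((f \<omega>)\<^sup>2 * (g \<omega>)\<^sup>2) \<le> norm ((f \<omega>) ^ 4 + (g \<omega>) ^ 4)" for \<omega>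
    proof -
      have "0 \<le> (f \<omega>)\<^sup>2 * (g \<omega>)\<^sup>2" "0 \<le> (f \<omega>) ^ 4" "0 \<le> (g \<omega>) ^ 4" by simp_all
      moreover have "(f \<omega>)\<^sup>2 * (g \<omega>)\<^sup>2 \<le> ((f \<omega>) ^ 4 + (g \<omega>) ^ 4) / 2"
        using amgm[OF zero_less_one, of "f \<omega>" "g \<omega>"] by simp
      ultimately have "(f \<omega>)\<^sup>2 * (g \<omega>)\<^sup>2 \<le> (f \<omega>) ^ 4 + (g \<omega>) ^ 4" by argo
      then show ?thesis by simp
    qed
    then show "AE \<omega> in M. norm ((f \<omega>)\<^sup>2 * (g \<omega>)\<^sup>2) \<le> norm ((f \<omega>) ^ 4 + (g \<omega>) ^ 4)" by simp
  qed measurable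
  have "(\<integral>\<omega>. (f \<omega>)\<^sup>2 * (g \<omega>)\<^sup>2 \<partial>M) \<le> k * (F + e) * (G + e)" if e: "e > 0" for e
  proof -
    define c where "c = (G + e) / (F + e)"
    have p: "F + e > 0" "G + e > 0" using nn e by auto
    have c: "c > 0" using p by (simp add: c_def)
    have "(\<integral>\<omega>. (f \<omega>)\<^sup>2 * (g \<omega>)\<^sup>2 \<partial>M) \<le> (\<integral>\<omega>. (c * (f \<omega>) ^ 4 + (g \<omega>) ^ 4 / c) / 2 \<partial>M)"
      using f(1) g(1) by (intro integral_mono int amgm[OF c]) auto
    also have "\<dots> = (c * (\<integral>\<omega>. (f \<omega>) ^ 4 \<partial>M) + (\<integral>\<omega>. (g \<omega>) ^ 4 \<partial>M) / c) / 2"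
      using f(1) g(1) by simp
    also have "\<dots> \<le> (c * (k * (F + e)\<^sup>2) + (k * (G + e)\<^sup>2) / c) / 2"
    proof -
      have "k * F\<^sup>2 \<le> k * (F + e)\<^sup>2" "k * G\<^sup>2 \<le> k * (G + e)\<^sup>2" using nn e by (auto intro!: mult_left_mono power_mono)
      then show ?thesis using f(2) g(2) c by (intro divide_right_mono add_mono mult_left_mono) auto
    qed
    also have "\<dots> = k * (F + e) * (G + e)"
    proof -
      have "c * (F + e)\<^sup>2 = (F + e) * (G + e)" "(G + e)\<^sup>2 / c = (F + e) * (G + e)"
        using p by (simp_all add: c_def power2_eq_square)
      then have eqs: "c * (k * (F + e)\<^sup>2) = k * ((F + e) * (G + e))" "(k * (G + e)\<^sup>2) / c = k * ((F + e) * (G + e))"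
        by (metis mult.left_commute, metis times_divide_eq_right)
      show ?thesis unfolding eqs by simp
    qed
    finally show ?thesis .
  qed
  then have "(\<integral>\<omega>. (f \<omega>)\<^sup>2 * (g \<omega>)\<^sup>2 \<partial>M) \<le> k * (F + inverse (real (Suc n))) * (G + inverse (real (Suc n)))" for n by simp
  moreover have "(\<lambda>n. k * (F + inverse (real (Suc n))) * (G + inverse (real (Suc n)))) \<longlonglongrightarrow> k * (F + 0) * (G + 0)"
    by (intro tendsto_intros LIMSEQ_inverse_real_of_nat)
  ultimately show "(\<integral>\<omega>. (f \<omega>)\<^sup>2 * (g \<omega>)\<^sup>2 \<partial>M) \<le> k * F * G"
    using LIMSEQ_le_const by fastforce
qed

text \<open>The quantity \<open>v\<close> bounds \<open>E \<bar>Z\<bar>\<^sup>2 (Z \<bullet> x)\<^sup>2 / \<bar>x\<bar>\<^sup>2\<close>: expand \<open>\<bar>Z\<bar>\<^sup>2\<close> in coordinates and apply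
  \<open>fourth_moment_product\<close> to each.  It plays two roles.  It is the variance proxy in the Bernstein
  inequality, because \<open>\<bar>Y x\<bar>\<^sup>2 \<le> \<bar>Z\<bar>\<^sup>2 (Z \<bullet> x)\<^sup>2\<close>; and it controls the bias, because the truncation weight
  \<open>w\<close> satisfies \<open>1 - w \<le> \<bar>Z\<bar>\<^sup>2 / \<theta>\<close>.\<close>

lemma truncated_covariance_deviation:
  fixes Z :: "'i \<Rightarrow> 'a \<Rightarrow> real^'n" and H :: "real^'n^'n"
  assumes ind: "indep_vars (\<lambda>_. borel) Z I" and fin: "finite I" and ne: "I \<noteq> {}"
    and m2: "\<And>i u. i \<in> I \<Longrightarrow> integrable M (\<lambda>\<omega>. (Z i \<omega> \<bullet> u)\<^sup>2)"
      "\<And>i u. i \<in> I \<Longrightarrow> (\<integral>\<omega>. (Z i \<omega> \<bullet> u)\<^sup>2 \<partial>M) = u \<bullet> (H *v u)"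
    and m4: "\<And>i u. i \<in> I \<Longrightarrow> integrable M (\<lambda>\<omega>. (Z i \<omega> \<bullet> u) ^ 4)"
      "\<And>i u. i \<in> I \<Longrightarrow> (\<integral>\<omega>. (Z i \<omega> \<bullet> u) ^ 4 \<partial>M) \<le> k * (u \<bullet> (H *v u))\<^sup>2"
    and k: "0 \<le> k" and h: "\<And>u. u \<bullet> (H *v u) \<le> h * (u \<bullet> u)" and tr: "trace H \<le> \<tau>"
    and \<theta>: "0 < \<theta>" and v: "v = k * \<tau> * h"
  shows "prob {\<omega> \<in> space M. \<not> (\<forall>u. \<bar>u \<bullet> (((1 / real (card I)) *\<^sub>R
        (\<Sum>i\<in>I. trunc_weight \<theta> (norm (Z i \<omega>)) *\<^sub>R outer (Z i \<omega>)) - H) *v u)\<bar>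
          \<le> (\<theta> * l / real (card I) + 2 * v / \<theta>) * (u \<bullet> u))}
    \<le> 2 * real CARD('n) * exp (- l)"
proof -
  define w where "w i \<omega> = trunc_weight \<theta> (norm (Z i \<omega>))" for i \<omega>
  define Y where "Y i \<omega> = w i \<omega> *\<^sub>R outer (Z i \<omega>)" for i \<omega>
  let ?m = "real (card I)"
  have m: "?m > 0" using fin ne by (simp add: card_gt_0_iff)
  have meas: "Z i \<in> borel_measurable M" if "i \<in> I" for i by (rule indep_vars_measurable[OF ind that])
  have w: "0 \<le> w i \<omega>" "w i \<omega> \<le> 1" "w i \<omega> * (norm (Z i \<omega>))\<^sup>2 \<le> \<theta>" "(1 - w i \<omega>) * \<theta> \<le> (norm (Z i \<omega>))\<^sup>2" for i \<omega>
    unfolding w_def by (rule trunc_weight_bounds[OF \<theta>])+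
  obtain i0 where i0: "i0 \<in> I" using ne by auto
  have Hnn: "0 \<le> u \<bullet> (H *v u)" for u
    unfolding m2(2)[OF i0, symmetric] by simp
  have h0: "0 \<le> h"
  proof -
    have "0 \<le> h * (axis undefined 1 \<bullet> (axis undefined 1 :: real^'n))" by (rule order_trans[OF Hnn h])
    then show ?thesis by (simp add: inner_axis_axis)
  qed
  have traceH: "(\<Sum>j\<in>UNIV. axis j 1 \<bullet> (H *v axis j 1)) = trace H"
    by (rule trace_onb[symmetric]) (simp add: onb_def inner_axis_axis)
  have heavy: "integrable M (\<lambda>\<omega>. (norm (Z i \<omega>))\<^sup>2 * (Z i \<omega> \<bullet> x)\<^sup>2)"
    "(\<integral>\<omega>. (norm (Z i \<omega>))\<^sup>2 * (Z i \<omega> \<bullet> x)\<^sup>2 \<partial>M) \<le> v * (x \<bullet> x)" if i: "i \<in> I" for i x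
  proof -
    have [measurable]: "Z i \<in> borel_measurable M" by (rule meas[OF i])
    have expand: "(norm z)\<^sup>2 * (z \<bullet> x)\<^sup>2 = (\<Sum>j\<in>UNIV. (z \<bullet> axis j 1)\<^sup>2 * (z \<bullet> x)\<^sup>2)" for z :: "real^'n"
      unfolding power2_norm_eq_inner inner_vec_def[of z z]
      by (simp add: inner_axis sum_distrib_right power2_eq_square)
    note p = fourth_moment_product[OF _ _ m4(1)[OF i] m4(2)[OF i] m4(1)[OF i] m4(2)[OF i] Hnn Hnn k]
    have int: "integrable M (\<lambda>\<omega>. (Z i \<omega> \<bullet> axis j 1)\<^sup>2 * (Z i \<omega> \<bullet> x)\<^sup>2)" for j by (rule p(1)) measurable
    show "integrable M (\<lambda>\<omega>. (norm (Z i \<omega>))\<^sup>2 * (Z i \<omega> \<bullet> x)\<^sup>2)" unfolding expand by (intro Bochner_Integration.integrable_sum int)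
    have "(\<integral>\<omega>. (norm (Z i \<omega>))\<^sup>2 * (Z i \<omega> \<bullet> x)\<^sup>2 \<partial>M) = (\<Sum>j\<in>UNIV. \<integral>\<omega>. (Z i \<omega> \<bullet> axis j 1)\<^sup>2 * (Z i \<omega> \<bullet> x)\<^sup>2 \<partial>M)"
      unfolding expand by (rule Bochner_Integration.integral_sum) (rule int)
    also have "\<dots> \<le> (\<Sum>j\<in>UNIV. k * (axis j 1 \<bullet> (H *v axis j 1)) * (x \<bullet> (H *v x)))"
      by (intro sum_mono p(2)) measurable
    also have "\<dots> = k * trace H * (x \<bullet> (H *v x))"
      by (simp add: traceH[symmetric] sum_distrib_left sum_distrib_right)
    also have "\<dots> \<le> k * \<tau> * (h * (x \<bullet> x))"
    proof -
      have "0 \<le> trace H" unfolding traceH[symmetric] by (intro sum_nonneg Hnn)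
      then show ?thesis using tr k by (intro mult_mono h Hnn) (auto intro!: mult_left_mono)
    qed
    finally show "(\<integral>\<omega>. (norm (Z i \<omega>))\<^sup>2 * (Z i \<omega> \<bullet> x)\<^sup>2 \<partial>M) \<le> v * (x \<bullet> x)" by (simp add: v)
  qed
  have v0: "0 \<le> v"
  proof -
    have "0 \<le> (\<integral>\<omega>. (norm (Z i0 \<omega>))\<^sup>2 * (Z i0 \<omega> \<bullet> axis undefined 1)\<^sup>2 \<partial>M)" by simp
    also have "\<dots> \<le> v" using heavy(2)[OF i0, of "axis undefined 1"] by (simp add: inner_axis_axis)
    finally show ?thesis .
  qed
  have indY: "indep_vars (\<lambda>_. borel) Y I"
    unfolding Y_def[abs_def] w_def by (rule indep_vars_compose2[OF ind]) measurable
  note measY = indep_vars_measurable[OF indY]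
  have normY: "norm (Y i \<omega>) \<le> \<theta>" for i \<omega> using w by (simp add: Y_def norm_outer abs_of_nonneg)
  have intY: "integrable M (Y i)" if "i \<in> I" for i
    by (rule integrable_const_bound[of _ \<theta>]) (use normY measY[OF that] in auto)
  have psdY: "psd (Y i \<omega>)" for i \<omega> unfolding Y_def by (rule psd_weighted_outer[OF w(1)])
  have varY: "(\<integral>\<omega>. (norm (Y i \<omega> *v x))\<^sup>2 \<partial>M) \<le> v * (x \<bullet> x)" if i: "i \<in> I" for i x
  proof -
    have [measurable]: "Y i \<in> borel_measurable M" by (rule measY[OF i])
    have le: "(norm (Y i \<omega> *v x))\<^sup>2 \<le> (norm (Z i \<omega>))\<^sup>2 * (Z i \<omega> \<bullet> x)\<^sup>2" for \<omega>
    proof -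
      have "(norm (Y i \<omega> *v x))\<^sup>2 = (w i \<omega>)\<^sup>2 * ((norm (Z i \<omega>))\<^sup>2 * (Z i \<omega> \<bullet> x)\<^sup>2)"
        by (simp add: Y_def scaleR_matrix_vector_assoc[symmetric] outer_mult_vector power_mult_distrib)
      also have "\<dots> \<le> 1 * ((norm (Z i \<omega>))\<^sup>2 * (Z i \<omega> \<bullet> x)\<^sup>2)"
        using w(1,2)[of i \<omega>] by (intro mult_right_mono) (auto simp: power_le_one)
      finally show ?thesis by simp
    qed
    have "integrable M (\<lambda>\<omega>. (norm (Y i \<omega> *v x))\<^sup>2)"
      by (rule Bochner_Integration.integrable_bound[OF heavy(1)[OF i, of x]]) (use le in auto)
    then have "(\<integral>\<omega>. (norm (Y i \<omega> *v x))\<^sup>2 \<partial>M) \<le> (\<integral>\<omega>. (norm (Z i \<omega>))\<^sup>2 * (Z i \<omega> \<bullet> x)\<^sup>2 \<partial>M)"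
      by (intro integral_mono heavy(1)[OF i] le)
    with heavy(2)[OF i] show ?thesis by (rule order_trans[rotated])
  qed
  define E where "E i = (\<integral>\<omega>. Y i \<omega> \<partial>M)" for i
  have bias: "0 \<le> x \<bullet> (H *v x) - x \<bullet> (E i *v x)" "x \<bullet> (H *v x) - x \<bullet> (E i *v x) \<le> v / \<theta> * (x \<bullet> x)" if i: "i \<in> I" for i x
  proof -
    have Yx: "x \<bullet> (Y i \<omega> *v x) = w i \<omega> * (Z i \<omega> \<bullet> x)\<^sup>2" for \<omega>
      by (simp add: Y_def scaleR_matrix_vector_assoc[symmetric] inner_outer)
    have intYx: "integrable M (\<lambda>\<omega>. w i \<omega> * (Z i \<omega> \<bullet> x)\<^sup>2)"
      using integral_quadratic_form(1)[OF intY[OF i], of x] by (simp add: Yx)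
    have eq: "x \<bullet> (H *v x) - x \<bullet> (E i *v x) = (\<integral>\<omega>. (1 - w i \<omega>) * (Z i \<omega> \<bullet> x)\<^sup>2 \<partial>M)"
      unfolding E_def integral_quadratic_form(2)[OF intY[OF i]] Yx m2(2)[OF i, symmetric]
      using m2(1)[OF i] intYx by (simp add: left_diff_distrib)
    have int1: "integrable M (\<lambda>\<omega>. (1 - w i \<omega>) * (Z i \<omega> \<bullet> x)\<^sup>2)"
      using m2(1)[OF i] intYx by (simp add: left_diff_distrib)
    show "0 \<le> x \<bullet> (H *v x) - x \<bullet> (E i *v x)" unfolding eq using w(2) by (intro Bochner_Integration.integral_nonneg) simp
    have "(\<integral>\<omega>. (1 - w i \<omega>) * (Z i \<omega> \<bullet> x)\<^sup>2 \<partial>M) \<le> (\<integral>\<omega>. (norm (Z i \<omega>))\<^sup>2 * (Z i \<omega> \<bullet> x)\<^sup>2 / \<theta> \<partial>M)"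
    proof (rule integral_mono[OF int1])
      show "integrable M (\<lambda>\<omega>. (norm (Z i \<omega>))\<^sup>2 * (Z i \<omega> \<bullet> x)\<^sup>2 / \<theta>)" using heavy(1)[OF i] by simp
      show "(1 - w i \<omega>) * (Z i \<omega> \<bullet> x)\<^sup>2 \<le> (norm (Z i \<omega>))\<^sup>2 * (Z i \<omega> \<bullet> x)\<^sup>2 / \<theta>" for \<omega>
        using mult_right_mono[OF w(4)[of i \<omega>], of "(Z i \<omega> \<bullet> x)\<^sup>2"] \<theta> by (simp add: pos_le_divide_eq mult_ac)
    qed
    also have "\<dots> \<le> v / \<theta> * (x \<bullet> x)" using heavy(2)[OF i, of x] \<theta> by (simp add: divide_right_mono)
    finally show "x \<bullet> (H *v x) - x \<bullet> (E i *v x) \<le> v / \<theta> * (x \<bullet> x)" by (simp add: eq)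
  qed
  let ?bad = "{\<omega> \<in> space M. \<not> (\<forall>u. \<bar>u \<bullet> ((\<Sum>i\<in>I. Y i \<omega> - E i) *v u)\<bar> \<le> (\<theta> * l + ?m * v / \<theta>) * (u \<bullet> u))}"
  have "prob {\<omega> \<in> space M. \<not> (\<forall>u. \<bar>u \<bullet> (((1 / ?m) *\<^sub>R (\<Sum>i\<in>I. Y i \<omega>) - H) *v u)\<bar>
          \<le> (\<theta> * l / ?m + 2 * v / \<theta>) * (u \<bullet> u))} \<le> prob ?bad"
  proof (rule finite_measure_mono)
    show "?bad \<in> events"
    proof -
      have [measurable]: "(\<lambda>\<omega>. \<Sum>i\<in>I. Y i \<omega> - E i) \<in> borel_measurable M" using measY by (auto intro!: borel_measurable_sum)
      have *: "(\<forall>u. \<bar>u \<bullet> (B *v u)\<bar> \<le> c * (u \<bullet> u)) \<longleftrightarrow> (\<forall>u. u \<bullet> (B *v u) \<le> c * (u \<bullet> u)) \<and> (\<forall>u. u \<bullet> ((-1 *\<^sub>R B) *v u) \<le> c * (u \<bullet> u))" for B :: "real^'n^'n" and c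
        by (simp only: scaleR_matrix_vector_assoc[symmetric] abs_le_iff) auto
      show ?thesis unfolding * by measurable
    qed
    show "{\<omega> \<in> space M. \<not> (\<forall>u. \<bar>u \<bullet> (((1 / ?m) *\<^sub>R (\<Sum>i\<in>I. Y i \<omega>) - H) *v u)\<bar> \<le> (\<theta> * l / ?m + 2 * v / \<theta>) * (u \<bullet> u))} \<subseteq> ?bad"
    proof (rule subsetI, rule ccontr)
      fix \<omega>
      assume L: "\<omega> \<in> {\<omega> \<in> space M. \<not> (\<forall>u. \<bar>u \<bullet> (((1 / ?m) *\<^sub>R (\<Sum>i\<in>I. Y i \<omega>) - H) *v u)\<bar> \<le> (\<theta> * l / ?m + 2 * v / \<theta>) * (u \<bullet> u))}"
        and R: "\<omega> \<notin> ?bad"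
      obtain u where u: "\<not> \<bar>u \<bullet> (((1 / ?m) *\<^sub>R (\<Sum>i\<in>I. Y i \<omega>) - H) *v u)\<bar> \<le> (\<theta> * l / ?m + 2 * v / \<theta>) * (u \<bullet> u)"
        using L by blast
      have good: "\<forall>u. \<bar>u \<bullet> ((\<Sum>i\<in>I. Y i \<omega> - E i) *v u)\<bar> \<le> (\<theta> * l + ?m * v / \<theta>) * (u \<bullet> u)"
        using L R by blast
      let ?a = "u \<bullet> ((\<Sum>i\<in>I. Y i \<omega> - E i) *v u)" and ?b = "\<Sum>i\<in>I. u \<bullet> (H *v u) - u \<bullet> (E i *v u)"
      have eq: "u \<bullet> (((1 / ?m) *\<^sub>R (\<Sum>i\<in>I. Y i \<omega>) - H) *v u) = (?a - ?b) / ?m"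
        using m by (simp add: matrix_vector_mult_diff_rdistrib scaleR_matrix_vector_assoc[symmetric] sum_matrix_vector inner_diff_right inner_sum_right sum_subtractf diff_divide_distrib)
      have b: "0 \<le> ?b" "?b \<le> ?m * (v / \<theta> * (u \<bullet> u))"
        using bias(1)[of _ u] sum_bounded_above[of I "\<lambda>i. u \<bullet> (H *v u) - u \<bullet> (E i *v u)" "v / \<theta> * (u \<bullet> u)"] bias(2)[of _ u]
        by (auto intro!: sum_nonneg)
      have "\<bar>?a - ?b\<bar> \<le> (\<theta> * l + ?m * v / \<theta>) * (u \<bullet> u) + ?m * (v / \<theta> * (u \<bullet> u))"
        using good[rule_format, of u] b by linarith
      then have "\<bar>(?a - ?b) / ?m\<bar> \<le> ((\<theta> * l + ?m * v / \<theta>) * (u \<bullet> u) + ?m * (v / \<theta> * (u \<bullet> u))) / ?m"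
        unfolding abs_divide using m by (simp add: divide_right_mono)
      also have "\<dots> = (\<theta> * l / ?m + 2 * v / \<theta>) * (u \<bullet> u)" using m \<theta> by (simp add: field_simps)
      finally show False using u unfolding eq by blast
    qed
  qed
  also have "\<dots> \<le> 2 * real CARD('n) * exp (- l)"
    unfolding E_def by (rule matrix_bernstein_psd[OF indY fin psdY normY \<theta> varY v0])
  finally show ?thesis by (simp only: Y_def w_def)
qed

text \<open>The previous lemma for \<open>Z = K X\<close>, transported back by \<open>u = K\<^sup>T y\<close>, which turns \<open>y \<bullet> y\<close> into \<open>u \<bullet> A u\<close>.  The
  domination hypothesis provides \<open>h = 2\<close> and, with the effective dimension, the trace bound; so \<open>v\<close> becomes
  \<open>4 c k df\<close>.\<close>

lemma whitened_truncated_covariance_deviation: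
  fixes X :: "'i \<Rightarrow> 'a \<Rightarrow> real^'n" and S A K :: "real^'n^'n"
  assumes ind: "indep_vars (\<lambda>_. borel) X I" and fin: "finite I" and ne: "I \<noteq> {}"
    and m2: "\<And>i u. i \<in> I \<Longrightarrow> integrable M (\<lambda>\<omega>. (X i \<omega> \<bullet> u)\<^sup>2)"
      "\<And>i u. i \<in> I \<Longrightarrow> (\<integral>\<omega>. (X i \<omega> \<bullet> u)\<^sup>2 \<partial>M) = u \<bullet> (S *v u)"
    and m4: "\<And>i u. i \<in> I \<Longrightarrow> integrable M (\<lambda>\<omega>. (X i \<omega> \<bullet> u) ^ 4)"
      "\<And>i u. i \<in> I \<Longrightarrow> (\<integral>\<omega>. (X i \<omega> \<bullet> u) ^ 4 \<partial>M) \<le> k * (u \<bullet> (S *v u))\<^sup>2"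
    and k: "0 \<le> k" and S: "psd S" and lam: "0 < lam" and mu: "0 < mu" "lam \<le> c * mu" "1 \<le> c"
    and KAK: "K ** A ** transpose K = mat 1"
    and le: "\<And>x. x \<bullet> (reg mu S *v x) \<le> 2 * (x \<bullet> (A *v x))"
    and \<theta>: "0 < \<theta>"
  shows "prob {\<omega> \<in> space M. \<not> (\<forall>u. \<bar>u \<bullet> (((1 / real (card I)) *\<^sub>R
        (\<Sum>i\<in>I. trunc_weight \<theta> (norm (K *v X i \<omega>)) *\<^sub>R outer (X i \<omega>)) - S) *v u)\<bar>
          \<le> (\<theta> * l / real (card I) + 8 * c * k * df lam S / \<theta>) * (u \<bullet> (A *v u)))}
    \<le> 2 * real CARD('n) * exp (- l)"
proof -
  let ?m = "real (card I)"
  define H where "H = K ** S ** transpose K"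
  have quad: "u \<bullet> ((K ** B ** transpose K) *v u) = (transpose K *v u) \<bullet> (B *v (transpose K *v u))" for u and B :: "real^'n^'n"
    using inner_transpose[of u "transpose K" "B *v (transpose K *v u)"]
    by (simp only: matrix_vector_mul_assoc[symmetric] transpose_transpose)
  have inner: "(K *v x) \<bullet> u = x \<bullet> (transpose K *v u)" for x u by (rule inner_transpose[symmetric])
  define v where "v = k * (2 * c * df lam S) * 2"
  have tail: "prob {\<omega> \<in> space M. \<not> (\<forall>u. \<bar>u \<bullet> (((1 / ?m) *\<^sub>R
        (\<Sum>i\<in>I. trunc_weight \<theta> (norm (K *v X i \<omega>)) *\<^sub>R outer (K *v X i \<omega>)) - H) *v u)\<bar>
          \<le> (\<theta> * l / ?m + 2 * v / \<theta>) * (u \<bullet> u))}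
    \<le> 2 * real CARD('n) * exp (- l)"
  proof (rule truncated_covariance_deviation[OF _ fin ne])
    show "indep_vars (\<lambda>_. borel) (\<lambda>i \<omega>. K *v X i \<omega>) I"
      by (rule indep_vars_compose2[OF ind])
        (intro borel_measurable_continuous_onI matrix_vector_mult_linear_continuous_on)
    show "integrable M (\<lambda>\<omega>. ((K *v X i \<omega>) \<bullet> u)\<^sup>2)" "(\<integral>\<omega>. ((K *v X i \<omega>) \<bullet> u)\<^sup>2 \<partial>M) = u \<bullet> (H *v u)"
      "integrable M (\<lambda>\<omega>. ((K *v X i \<omega>) \<bullet> u) ^ 4)" "(\<integral>\<omega>. ((K *v X i \<omega>) \<bullet> u) ^ 4 \<partial>M) \<le> k * (u \<bullet> (H *v u))\<^sup>2"
      if "i \<in> I" for i u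
      unfolding inner H_def quad by (rule m2[OF that] m4[OF that])+
    show "u \<bullet> (H *v u) \<le> 2 * (u \<bullet> u)" for u
    proof -
      have "u \<bullet> (H *v u) \<le> (transpose K *v u) \<bullet> (reg mu S *v (transpose K *v u))"
        unfolding H_def quad using mu by (simp add: quadratic_form_reg)
      also have "\<dots> \<le> 2 * (u \<bullet> ((K ** A ** transpose K) *v u))" unfolding quad by (rule le)
      finally show ?thesis by (simp add: KAK)
    qed
    show "trace H \<le> 2 * c * df lam S" unfolding H_def by (rule trace_whitened_le_df[OF S lam mu KAK le])
  qed (use k \<theta> v_def in auto)
  have incl: "\<omega> \<in> {\<omega> \<in> space M. \<not> (\<forall>u. \<bar>u \<bullet> (((1 / ?m) *\<^sub>R
        (\<Sum>i\<in>I. trunc_weight \<theta> (norm (K *v X i \<omega>)) *\<^sub>R outer (K *v X i \<omega>)) - H) *v u)\<bar>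
          \<le> (\<theta> * l / ?m + 2 * v / \<theta>) * (u \<bullet> u))} \<longleftrightarrow> \<omega> \<in> {\<omega> \<in> space M. \<not> (\<forall>u. \<bar>u \<bullet> (((1 / ?m) *\<^sub>R
        (\<Sum>i\<in>I. trunc_weight \<theta> (norm (K *v X i \<omega>)) *\<^sub>R outer (X i \<omega>)) - S) *v u)\<bar>
          \<le> (\<theta> * l / ?m + 2 * v / \<theta>) * (u \<bullet> (A *v u)))}" for \<omega>
  proof -
    let ?B = "(1 / ?m) *\<^sub>R (\<Sum>i\<in>I. trunc_weight \<theta> (norm (K *v X i \<omega>)) *\<^sub>R outer (X i \<omega>)) - S"
    let ?BK = "(1 / ?m) *\<^sub>R (\<Sum>i\<in>I. trunc_weight \<theta> (norm (K *v X i \<omega>)) *\<^sub>R outer (K *v X i \<omega>)) - H"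
    have BK: "u \<bullet> (?BK *v u) = (transpose K *v u) \<bullet> (?B *v (transpose K *v u))" for u
      unfolding H_def
      by (simp only: matrix_vector_mult_diff_rdistrib scaleR_matrix_vector_assoc[symmetric] sum_matrix_vector inner_diff_right inner_scaleR_right inner_sum_right inner_outer inner quad)
    have AK: "u \<bullet> u = (transpose K *v u) \<bullet> (A *v (transpose K *v u))" for u
      using quad[of u A] by (simp only: KAK matrix_vector_mul_lid)
    have "(transpose K ** K) ** A = mat 1" using whitener_gram[OF KAK] by (simp only: matrix_left_right_inverse)
    then have surj: "transpose K *v (K *v (A *v y)) = y" for y by (simp only: matrix_vector_mul_assoc matrix_mul_assoc matrix_vector_mul_lid)
    show ?thesis
      unfolding mem_Collect_eq BK AK[symmetric] using surj AK by (metis (no_types, lifting))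
  qed
  have v2: "2 * v / \<theta> = 8 * c * k * df lam S / \<theta>" by (simp add: v_def)
  show ?thesis using tail set_eqI[OF incl] unfolding v2 by simp
qed

end

section \<open>Measurability of the algorithm\<close>

text \<open>The squared Mahalanobis norm \<open>x \<bullet> A\<^sup>-\<^sup>1 x\<close>, with \<open>A\<^sup>-\<^sup>1 x\<close> given by Cramer's rule.  It is the squared length of
  \<open>x\<close> whitened by any factor of \<open>A\<close>, and it is a rational function of the entries; this makes the
  Cholesky factor harmless for measurability.\<close>

definition mahalanobis_sq :: "real^'n^'n \<Rightarrow> real^'n \<Rightarrow> real" where
  "mahalanobis_sq A x = x \<bullet> (\<chi> k. det (\<chi> i j. if j = k then x $ i else A $ i $ j) / det A)"

lemma pd_det_nonzero: "pd A \<Longrightarrow> det A \<noteq> 0"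
  using pd_invertible[of A] invertible_det_nz[of A] by (auto simp: invertible_def)

lemma norm_whitened_eq_mahalanobis:
  fixes A K :: "real^'n^'n"
  assumes "pd A" and KAK: "K ** A ** transpose K = mat 1"
  shows "norm (K *v x) = sqrt (mahalanobis_sq A x)"
proof -
  let ?y = "transpose K *v (K *v x)"
  have "A *v ?y = x"
    using whitener_gram[OF KAK] by (metis matrix_vector_mul_assoc matrix_vector_mul_lid)
  then have "mahalanobis_sq A x = x \<bullet> ?y"
    unfolding mahalanobis_sq_def by (simp only: cramer[OF pd_det_nonzero[OF assms(1)]] )
  then show ?thesis by (simp only: inner_transpose norm_eq_sqrt_inner)
qed

lemma borel_measurable_vec_nth [measurable (raw)]:
  fixes f :: "'a \<Rightarrow> 'b::euclidean_space^'n"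
  assumes "f \<in> borel_measurable N" shows "(\<lambda>x. f x $ i) \<in> borel_measurable N"
  by (rule measurable_compose[OF assms borel_measurable_continuous_onI]) (intro continuous_intros)

lemma borel_measurable_det:
  fixes B :: "'a \<Rightarrow> real^'n^'n"
  assumes "\<And>i j. (\<lambda>x. B x $ i $ j) \<in> borel_measurable N"
  shows "(\<lambda>x. det (B x)) \<in> borel_measurable N"
  unfolding det_def by (intro borel_measurable_sum borel_measurable_times borel_measurable_const borel_measurable_prod assms)

lemma borel_measurable_mahalanobis_sq [measurable (raw)]:
  fixes f :: "'a \<Rightarrow> real^'n^'n"
  assumes [measurable]: "f \<in> borel_measurable N" "g \<in> borel_measurable N"
  shows "(\<lambda>x. mahalanobis_sq (f x) (g x)) \<in> borel_measurable N"
proof -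
  have "(\<lambda>x. det (\<chi> i j. if j = k then g x $ i else f x $ i $ j)) \<in> borel_measurable N" for k
  proof (rule borel_measurable_det)
    fix i j
    show "(\<lambda>x. (\<chi> i j. if j = k then g x $ i else f x $ i $ j) $ i $ j) \<in> borel_measurable N"
      by (cases "j = k") simp_all
  qed
  moreover have "(\<lambda>x. det (f x)) \<in> borel_measurable N" by (rule borel_measurable_det) measurable
  ultimately show ?thesis
    unfolding mahalanobis_sq_def inner_vec_def by simp
qed

definition whitened_cov :: "real \<Rightarrow> real^'n^'n \<Rightarrow> nat \<Rightarrow> nat \<Rightarrow> (nat \<Rightarrow> real^'n) \<Rightarrow> real^'n^'n" where
  "whitened_cov \<theta> A k s x =
     (1 / real k) *\<^sub>R (\<Sum>i=1..k. trunc_weight \<theta> (sqrt (mahalanobis_sq A (x (s + i)))) *\<^sub>R outer (x (s + i)))"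

lemma whitened_cov_whitener:
  fixes A K :: "real^'n^'n"
  assumes "pd A" "K ** A ** transpose K = mat 1"
  shows "whitened_cov \<theta> A k s x = (1 / real k) *\<^sub>R (\<Sum>i=1..k. trunc_weight \<theta> (norm (K *v x (s + i))) *\<^sub>R outer (x (s + i)))"
  unfolding whitened_cov_def norm_whitened_eq_mahalanobis[OF assms] ..

lemma trunc_cov_eq_whitened_cov: "pd A \<Longrightarrow> trunc_cov \<theta> A k s x = whitened_cov \<theta> A k s x"
  unfolding trunc_cov_def by (rule whitened_cov_whitener[OF _ cholesky_whitens, symmetric])

lemma whitened_cov_cong:
  assumes "\<And>i. i \<in> {s+1..s+k} \<Longrightarrow> x i = y i"
  shows "whitened_cov \<theta> A k s x = whitened_cov \<theta> A k s y"
  unfolding whitened_cov_def by (intro arg_cong2[of _ _ _ _ "(*\<^sub>R)"] refl sum.cong) (auto simp: assms)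

lemma psd_add: "psd A \<Longrightarrow> psd B \<Longrightarrow> psd (A + B)"
  by (simp add: psd_def linear_add[OF bounded_linear.linear[OF bounded_linear_transpose]] matrix_vector_mult_add_rdistrib inner_add_right)

lemma psd_scaleR: "psd A \<Longrightarrow> 0 \<le> c \<Longrightarrow> psd (c *\<^sub>R A)"
  by (simp add: psd_def transpose_scalar scaleR_matrix_vector_assoc[symmetric])

lemma psd_0: "psd 0" by (simp add: psd_def transpose_def vec_eq_iff)

lemma psd_sum: "(\<And>i. i \<in> I \<Longrightarrow> psd (f i)) \<Longrightarrow> psd (\<Sum>i\<in>I. f i)"
  by (induction I rule: infinite_finite_induct) (auto simp: psd_0 intro: psd_add)

lemma psd_whitened_cov: "0 < \<theta> \<Longrightarrow> psd (whitened_cov \<theta> A k s x)"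
  unfolding whitened_cov_def by (intro psd_scaleR psd_sum psd_weighted_outer trunc_weight_bounds) auto

lemma borel_measurable_whitened_cov:
  assumes [measurable]: "f \<in> borel_measurable N" and "\<And>i. i \<in> {s+1..s+k} \<Longrightarrow> (\<lambda>\<omega>. x \<omega> i) \<in> borel_measurable N"
  shows "(\<lambda>\<omega>. whitened_cov \<theta> (f \<omega>) k s (x \<omega>)) \<in> borel_measurable N"
proof -
  have "(\<lambda>\<omega>. trunc_weight \<theta> (sqrt (mahalanobis_sq (f \<omega>) (x \<omega> (s + i)))) *\<^sub>R outer (x \<omega> (s + i))) \<in> borel_measurable N"
    if "i \<in> {1..k}" for i
  proof -
    have [measurable]: "(\<lambda>\<omega>. x \<omega> (s + i)) \<in> borel_measurable N" using assms(2)[of "s + i"] that by auto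
    show ?thesis by measurable
  qed
  then show ?thesis unfolding whitened_cov_def by (intro borel_measurable_scaleR[OF borel_measurable_const] borel_measurable_sum)
qed

lemma pd_scaled_identity: "0 < L \<Longrightarrow> pd (L *\<^sub>R mat 1)"
  by (simp add: pd_def transpose_scalar scaleR_matrix_vector_assoc[symmetric])

text \<open>The matrix by which the batch with number \<open>t\<close>, counted from \<open>0\<close>, is whitened.  Starting from \<open>L I\<close> makes
  the initial batch, which is only rescaled by \<open>sqrt L\<close>, a round like the others.\<close>

primrec iter_whitener ::
  "real \<Rightarrow> real \<Rightarrow> nat \<Rightarrow> (nat \<Rightarrow> real^'d::{finite,linorder}) \<Rightarrow> nat \<Rightarrow> real^'d::{finite,linorder}^'d::{finite,linorder}" where
  "iter_whitener \<theta> L m x 0 = L *\<^sub>R mat 1"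
| "iter_whitener \<theta> L m x (Suc t) = reg (reg_level L t) (whitened_cov \<theta> (iter_whitener \<theta> L m x t) m (m * t) x)"

lemma reg_level_eq: "reg_level L t = L / 2 ^ t"
  by (induction t) auto

lemma pd_iter_whitener: "0 < L \<Longrightarrow> 0 < \<theta> \<Longrightarrow> pd (iter_whitener \<theta> L m x t)"
  by (cases t) (auto intro!: pd_reg psd_whitened_cov pd_scaled_identity simp: reg_level_eq)

lemma transpose_iter_whitener: "0 < L \<Longrightarrow> 0 < \<theta> \<Longrightarrow> transpose (iter_whitener \<theta> L m x t) = iter_whitener \<theta> L m x t"
  using pd_iter_whitener unfolding pd_def by blast

lemma cov_iter_eq_whitened_cov:
  assumes "0 < L" "0 < \<theta>"
  shows "cov_iter \<theta> L m x t = whitened_cov \<theta> (iter_whitener \<theta> L m x t) m (m * t) x"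
proof (induction t)
  case 0
  let ?K = "(1 / sqrt L) *\<^sub>R (mat 1 :: real^'d::{finite,linorder}^'d::{finite,linorder})"
  have "?K ** (L *\<^sub>R mat 1) ** transpose ?K = mat 1"
    using assms(1)
    by (simp add: transpose_scalar matrix_eq matrix_vector_mul_assoc[symmetric] scaleR_matrix_vector_assoc[symmetric] matrix_vector_mult_scaleR)
  from whitened_cov_whitener[OF pd_scaled_identity[OF assms(1)] this, of \<theta> m 0 x]
  show ?case using assms(1) by (simp add: scaleR_matrix_vector_assoc[symmetric])
next
  case (Suc t)
  have "cov_iter \<theta> L m x (Suc t) = trunc_cov \<theta> (iter_whitener \<theta> L m x (Suc t)) m (m * Suc t) x"
    by (simp add: Suc)
  then show ?case by (simp only: trunc_cov_eq_whitened_cov[OF pd_iter_whitener[OF assms]])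
qed

lemma algorithm_A_eq_whitened_cov:
  fixes x :: "nat \<Rightarrow> real^'d::{finite,linorder}"
  assumes "0 < L" "0 < \<theta>" and T: "T = num_rounds lam L" and m: "m = n div (2 * (T + 1))"
  shows "algorithm_A n \<delta> lam L \<theta> x =
    whitened_cov (final_level \<delta> CARD('d) T \<theta>) (iter_whitener \<theta> L m x (Suc T)) (n - m * (T + 1)) (m * (T + 1)) x"
proof -
  have "m * (T + 1) \<le> n"
  proof -
    have "m * (2 * (T + 1)) \<le> n" unfolding m by (rule div_times_less_eq_dividend)
    then show ?thesis by (simp add: algebra_simps)
  qed
  then have "n - (n - m * (T + 1)) = m * (T + 1)" by simp
  moreover have "reg (reg_level L T) (cov_iter \<theta> L m x T) = iter_whitener \<theta> L m x (Suc T)"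
    by (simp add: cov_iter_eq_whitened_cov[OF assms(1,2)])
  ultimately show ?thesis
    unfolding algorithm_A_def Let_def T[symmetric] m[symmetric]
    by (simp only: trunc_cov_eq_whitened_cov[OF pd_iter_whitener[OF assms(1,2)]])
qed

lemma iter_whitener_cong:
  assumes "\<And>i. i \<in> {1..m * t} \<Longrightarrow> x i = y i"
  shows "iter_whitener \<theta> L m x t = iter_whitener \<theta> L m y t"
  using assms
proof (induction t)
  case (Suc t)
  have "iter_whitener \<theta> L m x t = iter_whitener \<theta> L m y t" using Suc.prems by (intro Suc.IH) auto
  moreover have "whitened_cov \<theta> A m (m * t) x = whitened_cov \<theta> A m (m * t) y" for A
    using Suc.prems by (intro whitened_cov_cong) auto
  ultimately show ?case by simp
qed simp

lemma borel_measurable_iter_whitener: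
  assumes "\<And>i. i \<in> {1..m * t} \<Longrightarrow> (\<lambda>\<omega>. x \<omega> i) \<in> borel_measurable N"
  shows "(\<lambda>\<omega>. iter_whitener \<theta> L m (x \<omega>) t) \<in> borel_measurable N"
  using assms
proof (induction t)
  case (Suc t)
  have [measurable]: "(\<lambda>\<omega>. iter_whitener \<theta> L m (x \<omega>) t) \<in> borel_measurable N" using Suc.prems by (intro Suc.IH) auto
  have [measurable]: "(\<lambda>\<omega>. whitened_cov \<theta> (iter_whitener \<theta> L m (x \<omega>) t) m (m * t) (x \<omega>)) \<in> borel_measurable N"
    using Suc.prems by (intro borel_measurable_whitened_cov) auto
  show ?case by (simp add: reg_def)
qed simp

section \<open>Independence of the batches and the invariant of the iteration\<close>

definition relative_error_le :: "real \<Rightarrow> real^'n^'n \<Rightarrow> real^'n^'n \<Rightarrow> real^'n^'n \<Rightarrow> bool" where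
  "relative_error_le e A W S \<longleftrightarrow> (\<forall>u. \<bar>u \<bullet> ((W - S) *v u)\<bar> \<le> e * (u \<bullet> (A *v u)))"

lemma relative_error_le_measurable [measurable (raw)]:
  fixes f g :: "'a \<Rightarrow> real^'n^'n"
  assumes [measurable]: "f \<in> borel_measurable N" "g \<in> borel_measurable N"
  shows "Measurable.pred N (\<lambda>\<omega>. relative_error_le e (f \<omega>) (g \<omega>) S)"
proof -
  have *: "relative_error_le e A W S \<longleftrightarrow> (\<forall>u. u \<bullet> ((W - S - e *\<^sub>R A) *v u) \<le> 0 * (u \<bullet> u)) \<and> (\<forall>u. u \<bullet> ((S - W - e *\<^sub>R A) *v u) \<le> 0 * (u \<bullet> u))"
    for A W :: "real^'n^'n"
    unfolding relative_error_le_def abs_le_iff all_conj_distrib[symmetric]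
    by (simp add: matrix_vector_mult_diff_rdistrib inner_diff_right scaleR_matrix_vector_assoc[symmetric] algebra_simps)
  show ?thesis unfolding * by measurable
qed

definition loewner_le :: "real^'n^'n \<Rightarrow> real^'n^'n \<Rightarrow> bool" where
  "loewner_le A B \<longleftrightarrow> (\<forall>u. u \<bullet> (A *v u) \<le> u \<bullet> (B *v u))"

lemma loewner_le_measurable [measurable (raw)]:
  fixes f g :: "'a \<Rightarrow> real^'n^'n"
  assumes [measurable]: "f \<in> borel_measurable N" "g \<in> borel_measurable N"
  shows "Measurable.pred N (\<lambda>\<omega>. loewner_le (f \<omega>) (g \<omega>))"
proof -
  have *: "loewner_le A B \<longleftrightarrow> (\<forall>u. u \<bullet> ((A - B) *v u) \<le> 0 * (u \<bullet> u))" for A B :: "real^'n^'n"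
    by (simp add: loewner_le_def matrix_vector_mult_diff_rdistrib inner_diff_right)
  show ?thesis unfolding * by measurable
qed

text \<open>Fubini for the joint distribution of independent \<open>U\<close> and \<open>V\<close>: if for every admissible value \<open>u\<close> of \<open>U\<close> the
  event \<open>Q u V\<close> has small probability, so does the event that \<open>U\<close> is admissible and \<open>Q U V\<close> occurs.\<close>

lemma (in prob_space) conditional_bad_event_le:
  assumes ind: "indep_var N1 U N2 V" and G: "G \<in> sets N1"
    and Q: "{p \<in> space (N1 \<Otimes>\<^sub>M N2). Q (fst p) (snd p)} \<in> sets (N1 \<Otimes>\<^sub>M N2)"
    and le: "\<And>u. u \<in> G \<Longrightarrow> prob {\<omega> \<in> space M. Q u (V \<omega>)} \<le> e" and e: "0 \<le> e"
  shows "prob {\<omega> \<in> space M. U \<omega> \<in> G \<and> Q (U \<omega>) (V \<omega>)} \<le> e"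
proof -
  have [measurable]: "U \<in> measurable M N1" "V \<in> measurable M N2"
    using ind by (auto dest: indep_var_rv1 indep_var_rv2)
  define D where "D = {p \<in> space (N1 \<Otimes>\<^sub>M N2). fst p \<in> G \<and> Q (fst p) (snd p)}"
  have D: "D \<in> sets (N1 \<Otimes>\<^sub>M N2)"
  proof -
    have "D = {p \<in> space (N1 \<Otimes>\<^sub>M N2). Q (fst p) (snd p)} \<inter> (fst -` G \<inter> space (N1 \<Otimes>\<^sub>M N2))" by (auto simp: D_def)
    then show ?thesis using Q measurable_sets[OF measurable_fst G, of N2] by auto
  qed
  interpret U: prob_space "distr M N1 U" by (rule prob_space_distr) measurable
  interpret V: prob_space "distr M N2 V" by (rule prob_space_distr) measurable
  have joint: "distr M N1 U \<Otimes>\<^sub>M distr M N2 V = distr M (N1 \<Otimes>\<^sub>M N2) (\<lambda>\<omega>. (U \<omega>, V \<omega>))"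
    using ind by (simp add: indep_var_distribution_eq)
  have "emeasure M {\<omega> \<in> space M. U \<omega> \<in> G \<and> Q (U \<omega>) (V \<omega>)} = emeasure (distr M (N1 \<Otimes>\<^sub>M N2) (\<lambda>\<omega>. (U \<omega>, V \<omega>))) D"
    using measurable_space[OF \<open>U \<in> measurable M N1\<close>] measurable_space[OF \<open>V \<in> measurable M N2\<close>]
    by (subst emeasure_distr[OF _ D], measurable)
      (auto simp: D_def space_pair_measure intro!: arg_cong[of _ _ "emeasure M"])
  also have "\<dots> = (\<integral>\<^sup>+u. emeasure (distr M N2 V) (Pair u -` D) \<partial>distr M N1 U)"
    unfolding joint[symmetric] by (rule V.emeasure_pair_measure_alt) (use D in simp)
  also have "\<dots> \<le> (\<integral>\<^sup>+u. ennreal e \<partial>distr M N1 U)"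
  proof (rule nn_integral_mono)
    fix u assume "u \<in> space (distr M N1 U)"
    then have u: "u \<in> space N1" by simp
    have sec: "Pair u -` D \<in> sets N2" by (rule sets_Pair1[OF D])
    show "emeasure (distr M N2 V) (Pair u -` D) \<le> ennreal e"
    proof (cases "u \<in> G")
      case True
      have "emeasure (distr M N2 V) (Pair u -` D) = emeasure M (V -` (Pair u -` D) \<inter> space M)"
        by (rule emeasure_distr[OF _ sec]) measurable
      also have "V -` (Pair u -` D) \<inter> space M = {\<omega> \<in> space M. Q u (V \<omega>)}"
        using u True measurable_space[OF \<open>V \<in> measurable M N2\<close>] by (auto simp: D_def space_pair_measure)
      finally show ?thesis using le[OF True] by (simp add: emeasure_eq_measure ennreal_leI)
    next
      case False
      then have "Pair u -` D = {}" by (auto simp: D_def)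
      then show ?thesis by simp
    qed
  qed
  also have "\<dots> = ennreal e" by (simp add: U.emeasure_space_1[simplified])
  finally show ?thesis using e by (simp add: emeasure_eq_measure)
qed

text \<open>Moments of one-dimensional marginals, as they enter the estimates; \<open>k\<close> stands for the fourth power of the kurtosis
  constant.\<close>

locale kurtosis_sample = prob_space M for M :: "'w measure" +
  fixes X :: "nat \<Rightarrow> 'w \<Rightarrow> real^'d::{finite,linorder}" and n :: nat
    and S :: "real^'d::{finite,linorder}^'d::{finite,linorder}" and k lam :: real
  assumes indep: "indep_vars (\<lambda>_. borel) X {1..n}"
    and second_moment: "\<And>i u. i \<in> {1..n} \<Longrightarrow> integrable M (\<lambda>\<omega>. (X i \<omega> \<bullet> u)\<^sup>2)"
      "\<And>i u. i \<in> {1..n} \<Longrightarrow> (\<integral>\<omega>. (X i \<omega> \<bullet> u)\<^sup>2 \<partial>M) = u \<bullet> (S *v u)"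
    and fourth_moment: "\<And>i u. i \<in> {1..n} \<Longrightarrow> integrable M (\<lambda>\<omega>. (X i \<omega> \<bullet> u) ^ 4)"
      "\<And>i u. i \<in> {1..n} \<Longrightarrow> (\<integral>\<omega>. (X i \<omega> \<bullet> u) ^ 4 \<partial>M) \<le> k * (u \<bullet> (S *v u))\<^sup>2"
    and k_nonneg: "0 \<le> k" and psd_S: "psd S" and lam_pos: "0 < lam"
begin

lemma measurable_X: "i \<in> {1..n} \<Longrightarrow> X i \<in> borel_measurable M"
  by (rule indep_vars_measurable[OF indep])

lemma measurable_iter_whitener:
  assumes "m * t \<le> n" shows "(\<lambda>\<omega>. iter_whitener \<theta> L m (\<lambda>i. X i \<omega>) t) \<in> borel_measurable M"
  by (rule borel_measurable_iter_whitener) (use assms in \<open>auto intro!: measurable_X\<close>)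

lemma measurable_batch_cov:
  assumes "A \<in> borel_measurable M" "s + b \<le> n"
  shows "(\<lambda>\<omega>. whitened_cov \<theta> (A \<omega>) b s (\<lambda>i. X i \<omega>)) \<in> borel_measurable M"
  by (rule borel_measurable_whitened_cov[OF assms(1)]) (use assms(2) in \<open>auto intro!: measurable_X\<close>)

lemma fixed_batch_deviation:
  assumes A: "transpose A = A" "loewner_le (reg mu S) (2 *\<^sub>R A)"
    and mu: "0 < mu" "lam \<le> c * mu" "1 \<le> c" and sb: "s + b \<le> n" "0 < b" and \<theta>: "0 < \<theta>"
  shows "prob {\<omega> \<in> space M. \<not> relative_error_le (\<theta> * l / real b + 8 * c * k * df lam S / \<theta>) A (whitened_cov \<theta> A b s (\<lambda>i. X i \<omega>)) S}
    \<le> 2 * real CARD('d) * exp (- l)"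
proof -
  have le: "x \<bullet> (reg mu S *v x) \<le> 2 * (x \<bullet> (A *v x))" for x
    using A(2) by (simp add: loewner_le_def scaleR_matrix_vector_assoc[symmetric])
  have "0 < x \<bullet> (A *v x)" if "x \<noteq> 0" for x
  proof -
    have "0 < x \<bullet> (reg mu S *v x)" using pd_reg[OF psd_S mu(1)] that by (simp add: pd_def)
    then show ?thesis using le[of x] by linarith
  qed
  then have pd: "pd A" using A(1) by (simp add: pd_def)
  note K = cholesky_whitens[OF pd]
  have ind: "indep_vars (\<lambda>_. borel) X {s+1..s+b}"
    by (rule indep_vars_subset[OF indep]) (use sb in auto)
  have sub: "i \<in> {1..n}" if "i \<in> {s+1..s+b}" for i using that sb by auto
  have "(\<Sum>i\<in>{s+1..s+b}. f i) = (\<Sum>i=1..b. f (s + i))" for f :: "nat \<Rightarrow> real^'d::{finite,linorder}^'d::{finite,linorder}"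
    by (rule sum.reindex_bij_witness[of _ "\<lambda>i. s + i" "\<lambda>i. i - s"]) auto
  then have eq: "whitened_cov \<theta> A b s (\<lambda>i. X i \<omega>) = (1 / real (card {s+1..s+b})) *\<^sub>R
      (\<Sum>i\<in>{s+1..s+b}. trunc_weight \<theta> (norm (matrix_inv (cholesky A) *v X i \<omega>)) *\<^sub>R outer (X i \<omega>))" for \<omega>
    by (simp add: whitened_cov_whitener[OF pd K])
  have card: "card {s+1..s+b} = b" by simp
  have "prob {\<omega> \<in> space M. \<not> (\<forall>u. \<bar>u \<bullet> (((1 / real (card {s+1..s+b})) *\<^sub>R
        (\<Sum>i\<in>{s+1..s+b}. trunc_weight \<theta> (norm (matrix_inv (cholesky A) *v X i \<omega>)) *\<^sub>R outer (X i \<omega>)) - S) *v u)\<bar>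
          \<le> (\<theta> * l / real (card {s+1..s+b}) + 8 * c * k * df lam S / \<theta>) * (u \<bullet> (A *v u)))}
    \<le> 2 * real CARD('d) * exp (- l)"
    using sb by (intro whitened_truncated_covariance_deviation[OF ind _ _ _ _ _ _ k_nonneg psd_S lam_pos mu K le \<theta>]
        second_moment fourth_moment sub) auto
  then show ?thesis unfolding relative_error_le_def eq card .
qed

text \<open>The whitening matrix is a function \<open>A\<close> of the first \<open>p\<close> observations, hence independent of the batch; on
  the event that it dominates the regularized covariance it may be treated as fixed.\<close>

lemma batch_deviation:
  assumes A: "A \<in> borel_measurable (PiM {1..p} (\<lambda>_. borel))"
    and sym: "\<And>x. transpose (A x) = A x" and past: "\<And>x. A (restrict x {1..p}) = A x"
    and mu: "0 < mu" "lam \<le> c * mu" "1 \<le> c" and sb: "p \<le> s" "s + b \<le> n" "0 < b" and \<theta>: "0 < \<theta>"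
  shows "prob {\<omega> \<in> space M. loewner_le (reg mu S) (2 *\<^sub>R A (\<lambda>i. X i \<omega>)) \<and>
      \<not> relative_error_le (\<theta> * l / real b + 8 * c * k * df lam S / \<theta>) (A (\<lambda>i. X i \<omega>))
          (whitened_cov \<theta> (A (\<lambda>i. X i \<omega>)) b s (\<lambda>i. X i \<omega>)) S}
    \<le> 2 * real CARD('d) * exp (- l)"
proof -
  let ?B = "{s+1..s+b}" and ?N2 = "PiM {s+1..s+b} (\<lambda>_. borel) :: (nat \<Rightarrow> real^'d::{finite,linorder}) measure"
  let ?e = "\<theta> * l / real b + 8 * c * k * df lam S / \<theta>"
  let ?Q = "\<lambda>A v. \<not> relative_error_le ?e A (whitened_cov \<theta> A b s v) S"
  let ?N1 = "PiM {1..p} (\<lambda>_. borel) :: (nat \<Rightarrow> real^'d::{finite,linorder}) measure"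
  define G where "G = {x \<in> space ?N1. loewner_le (reg mu S) (2 *\<^sub>R A x)}"
  have ind: "indep_var ?N1 (\<lambda>\<omega>. restrict (\<lambda>i. X i \<omega>) {1..p}) ?N2 (\<lambda>\<omega>. restrict (\<lambda>i. X i \<omega>) ?B)"
    using sb by (intro indep_var_restrict[OF indep]) auto
  note A[measurable]
  have G: "G \<in> sets ?N1" unfolding G_def by measurable
  have Q: "{p \<in> space (?N1 \<Otimes>\<^sub>M ?N2). ?Q (A (fst p)) (snd p)} \<in> sets (?N1 \<Otimes>\<^sub>M ?N2)"
  proof -
    have [measurable]: "(\<lambda>p. whitened_cov \<theta> (A (fst p)) b s (snd p)) \<in> borel_measurable (?N1 \<Otimes>\<^sub>M ?N2)"
      by (rule borel_measurable_whitened_cov) measurable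
    show ?thesis by measurable
  qed
  have wc: "whitened_cov \<theta> B b s (restrict x ?B) = whitened_cov \<theta> B b s x" for B x
    by (rule whitened_cov_cong) auto
  have "prob {\<omega> \<in> space M. restrict (\<lambda>i. X i \<omega>) {1..p} \<in> G \<and>
      ?Q (A (restrict (\<lambda>i. X i \<omega>) {1..p})) (restrict (\<lambda>i. X i \<omega>) ?B)} \<le> 2 * real CARD('d) * exp (- l)"
  proof (rule conditional_bad_event_le[OF ind G Q])
    fix u assume "u \<in> G"
    then show "prob {\<omega> \<in> space M. ?Q (A u) (restrict (\<lambda>i. X i \<omega>) ?B)} \<le> 2 * real CARD('d) * exp (- l)"
      unfolding wc using sb by (intro fixed_batch_deviation[OF sym _ mu _ _ \<theta>]) (auto simp: G_def)
  qed simp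
  moreover have "restrict x {1..p} \<in> G \<longleftrightarrow> loewner_le (reg mu S) (2 *\<^sub>R A x)" for x
    by (simp add: G_def space_PiM past del: One_nat_def)
  ultimately show ?thesis by (simp only: wc past)
qed

text \<open>The deviation is at most \<open>(1/6) (3/2) (S + mu I) \<le> (1/2) (S + mu' I)\<close>, where the last step uses
  \<open>mu \<le> 2 mu'\<close>.\<close>

lemma refinement_step:
  assumes good: "loewner_le (2 *\<^sub>R A) (3 *\<^sub>R reg mu S)" and mu: "0 < mu" "mu \<le> 2 * mu'"
    and close: "relative_error_le e A W S" and e: "0 \<le> e" "e \<le> 1 / 6"
  shows "loewner_le (reg mu' S) (2 *\<^sub>R reg mu' W) \<and> loewner_le (2 *\<^sub>R reg mu' W) (3 *\<^sub>R reg mu' S)"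
proof -
  have "u \<bullet> (reg mu' S *v u) \<le> 2 * (u \<bullet> (reg mu' W *v u)) \<and> 2 * (u \<bullet> (reg mu' W *v u)) \<le> 3 * (u \<bullet> (reg mu' S *v u))" for u
  proof -
    let ?s = "u \<bullet> (S *v u)" and ?w = "u \<bullet> (W *v u)" and ?a = "u \<bullet> (A *v u)" and ?u = "u \<bullet> u"
    have s: "0 \<le> ?s" using psd_S by (simp add: psd_def)
    have a: "2 * ?a \<le> 3 * (?s + mu * ?u)"
      using good by (simp add: loewner_le_def scaleR_matrix_vector_assoc[symmetric] quadratic_form_reg)
    have "\<bar>?w - ?s\<bar> \<le> e * ?a" using close by (simp add: relative_error_le_def matrix_vector_mult_diff_rdistrib inner_diff_right)
    also have "\<dots> \<le> e * (3 / 2 * (?s + mu * ?u))" using a e by (intro mult_left_mono) auto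
    also have "\<dots> \<le> 1 / 6 * (3 / 2 * (?s + mu * ?u))" using s mu e by (intro mult_right_mono) auto
    also have "\<dots> \<le> 1 / 6 * (3 / 2 * (2 * ?s + 2 * (mu' * ?u)))"
      using s mult_right_mono[OF mu(2), of ?u] by simp
    finally have "\<bar>?w - ?s\<bar> \<le> (?s + mu' * ?u) / 2" by simp
    then have "?w - ?s \<le> (?s + mu' * ?u) / 2" "?s - ?w \<le> (?s + mu' * ?u) / 2"
      unfolding abs_le_iff by simp_all
    then show ?thesis unfolding quadratic_form_reg by (intro conjI; argo)
  qed
  then show ?thesis by (simp add: loewner_le_def scaleR_matrix_vector_assoc[symmetric])
qed

text \<open>The matrix that whitens batch \<open>t\<close> is regularized at level \<open>L / 2\<^bsup>t - 1\<^esup>\<close>; truncated subtraction gives the level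
  \<open>L\<close> for both \<open>t = 0\<close> and \<open>t = 1\<close>, as the algorithm has it.\<close>

lemma iteration_failure_bound:
  assumes L: "0 < L" "\<And>u. u \<bullet> (S *v u) \<le> L * (u \<bullet> u)" and \<theta>: "0 < \<theta>" and m: "0 < m" "m * t \<le> n"
    and lam: "\<And>j. j < t \<Longrightarrow> lam \<le> L / 2 ^ (j - 1)"
    and e: "\<theta> * l / real m + 8 * k * df lam S / \<theta> \<le> 1 / 6" "0 \<le> \<theta> * l / real m + 8 * k * df lam S / \<theta>"
  shows "prob {\<omega> \<in> space M. \<not> (loewner_le (reg (L / 2 ^ (t - 1)) S) (2 *\<^sub>R iter_whitener \<theta> L m (\<lambda>i. X i \<omega>) t) \<and>
      loewner_le (2 *\<^sub>R iter_whitener \<theta> L m (\<lambda>i. X i \<omega>) t) (3 *\<^sub>R reg (L / 2 ^ (t - 1)) S))}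
    \<le> real t * (2 * real CARD('d) * exp (- l))"
  using m(2) lam
proof (induction t)
  case 0
  have "loewner_le (reg L S) (2 *\<^sub>R (L *\<^sub>R mat 1))" "loewner_le (2 *\<^sub>R (L *\<^sub>R mat 1)) (3 *\<^sub>R reg L S)"
  proof -
    have s: "0 \<le> u \<bullet> (S *v u)" for u using psd_S by (simp add: psd_def)
    have "u \<bullet> (S *v u) + L * (u \<bullet> u) \<le> 2 * (L * (u \<bullet> u))" "2 * (L * (u \<bullet> u)) \<le> 3 * (u \<bullet> (S *v u) + L * (u \<bullet> u))" for u
      using L(2)[of u] s[of u] mult_nonneg_nonneg[of L "u \<bullet> u"] L(1) by auto
    then show "loewner_le (reg L S) (2 *\<^sub>R (L *\<^sub>R mat 1))" "loewner_le (2 *\<^sub>R (L *\<^sub>R mat 1)) (3 *\<^sub>R reg L S)"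
      unfolding loewner_le_def by (simp_all add: quadratic_form_reg scaleR_matrix_vector_assoc[symmetric])
  qed
  then show ?case by simp
next
  case (Suc t)
  let ?A = "\<lambda>t \<omega>. iter_whitener \<theta> L m (\<lambda>i. X i \<omega>) t"
  let ?mu = "\<lambda>t::nat. L / 2 ^ (t - 1)"
  let ?good = "\<lambda>t \<omega>. loewner_le (reg (?mu t) S) (2 *\<^sub>R ?A t \<omega>) \<and> loewner_le (2 *\<^sub>R ?A t \<omega>) (3 *\<^sub>R reg (?mu t) S)"
  let ?e = "\<theta> * l / real m + 8 * k * df lam S / \<theta>"
  let ?W = "\<lambda>\<omega>. whitened_cov \<theta> (?A t \<omega>) m (m * t) (\<lambda>i. X i \<omega>)"
  let ?bad = "{\<omega> \<in> space M. loewner_le (reg (?mu t) S) (2 *\<^sub>R ?A t \<omega>) \<and> \<not> relative_error_le ?e (?A t \<omega>) (?W \<omega>) S}"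
  have mt: "m * t \<le> n" using Suc.prems(1) by simp
  have [measurable]: "?A t \<in> borel_measurable M" "?A (Suc t) \<in> borel_measurable M"
    by (rule measurable_iter_whitener, use mt Suc.prems(1) in simp)+
  have [measurable]: "?W \<in> borel_measurable M"
    by (rule measurable_batch_cov) (use Suc.prems(1) in simp_all)
  have IH: "prob {\<omega> \<in> space M. \<not> ?good t \<omega>} \<le> real t * (2 * real CARD('d) * exp (- l))"
    using Suc.prems by (intro Suc.IH mt) auto
  have mu: "0 < ?mu t" "lam \<le> 1 * ?mu t" using L Suc.prems(2)[of t] by auto
  have mu': "?mu t \<le> 2 * ?mu (Suc t)" using L by (cases t) auto
  have bad: "prob ?bad \<le> 2 * real CARD('d) * exp (- l)"
  proof -
    have "prob {\<omega> \<in> space M. loewner_le (reg (?mu t) S) (2 *\<^sub>R ?A t \<omega>) \<and>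
        \<not> relative_error_le (\<theta> * l / real m + 8 * 1 * k * df lam S / \<theta>) (?A t \<omega>) (?W \<omega>) S} \<le> 2 * real CARD('d) * exp (- l)"
    proof (rule batch_deviation[where p = "m * t" and A = "\<lambda>x. iter_whitener \<theta> L m x t"])
      show "(\<lambda>x. iter_whitener \<theta> L m x t) \<in> borel_measurable (PiM {1..m * t} (\<lambda>_. borel))"
        by (rule borel_measurable_iter_whitener) measurable
      show "transpose (iter_whitener \<theta> L m x t) = iter_whitener \<theta> L m x t" for x
        by (rule transpose_iter_whitener[OF L(1) \<theta>])
      show "iter_whitener \<theta> L m (restrict x {1..m * t}) t = iter_whitener \<theta> L m x t" for x
        by (rule iter_whitener_cong) auto
    qed (use mu m(1) Suc.prems \<theta> in auto)
    then show ?thesis by simp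
  qed
  have "prob {\<omega> \<in> space M. \<not> ?good (Suc t) \<omega>} \<le> prob ({\<omega> \<in> space M. \<not> ?good t \<omega>} \<union> ?bad)"
  proof (rule finite_measure_mono)
    have "?good (Suc t) \<omega>" if "?good t \<omega>" "relative_error_le ?e (?A t \<omega>) (?W \<omega>) S" for \<omega>
      using refinement_step[OF _ mu(1) mu' that(2) e(2,1)] that(1) by (simp add: reg_level_eq)
    then show "{\<omega> \<in> space M. \<not> ?good (Suc t) \<omega>} \<subseteq> {\<omega> \<in> space M. \<not> ?good t \<omega>} \<union> ?bad" by blast
  qed measurable
  also have "\<dots> \<le> prob {\<omega> \<in> space M. \<not> ?good t \<omega>} + prob ?bad" by (rule measure_Un_le; measurable)
  also have "\<dots> \<le> real (Suc t) * (2 * real CARD('d) * exp (- l))" using IH bad by (simp add: algebra_simps)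
  finally show ?case .
qed

text \<open>Here \<open>c = 2\<close>, since the last level may be as small as \<open>lam / 2\<close>; the invariant turns the error relative to the
  whitening matrix into \<open>3/2\<close> times the error relative to \<open>S + lam I\<close>.\<close>

lemma final_failure_bound:
  assumes L: "0 < L" "\<And>u. u \<bullet> (S *v u) \<le> L * (u \<bullet> u)" and \<theta>: "0 < \<theta>" "0 < \<theta>'"
    and m: "0 < m" "m * Suc T + r = n" "0 < r"
    and lam: "\<And>j. j \<le> T \<Longrightarrow> lam \<le> L / 2 ^ (j - 1)" "L / 2 ^ T \<le> lam" "lam \<le> 2 * (L / 2 ^ T)"
    and e: "\<theta> * l / real m + 8 * k * df lam S / \<theta> \<le> 1 / 6" "0 \<le> \<theta> * l / real m + 8 * k * df lam S / \<theta>"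
    and e': "0 \<le> \<theta>' * l' / real r + 16 * k * df lam S / \<theta>'"
  shows "prob {\<omega> \<in> space M. \<not> relative_error_le (3 / 2 * (\<theta>' * l' / real r + 16 * k * df lam S / \<theta>')) (reg lam S)
        (whitened_cov \<theta>' (iter_whitener \<theta> L m (\<lambda>i. X i \<omega>) (Suc T)) r (m * Suc T) (\<lambda>i. X i \<omega>)) S}
    \<le> real (Suc T) * (2 * real CARD('d) * exp (- l)) + 2 * real CARD('d) * exp (- l')"
proof -
  let ?A = "\<lambda>\<omega>. iter_whitener \<theta> L m (\<lambda>i. X i \<omega>) (Suc T)"
  let ?mu = "L / 2 ^ T"
  let ?good = "\<lambda>\<omega>. loewner_le (reg ?mu S) (2 *\<^sub>R ?A \<omega>) \<and> loewner_le (2 *\<^sub>R ?A \<omega>) (3 *\<^sub>R reg ?mu S)"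
  let ?e = "\<theta>' * l' / real r + 8 * 2 * k * df lam S / \<theta>'"
  let ?W = "\<lambda>\<omega>. whitened_cov \<theta>' (?A \<omega>) r (m * Suc T) (\<lambda>i. X i \<omega>)"
  let ?bad = "{\<omega> \<in> space M. loewner_le (reg ?mu S) (2 *\<^sub>R ?A \<omega>) \<and> \<not> relative_error_le ?e (?A \<omega>) (?W \<omega>) S}"
  have [measurable]: "?A \<in> borel_measurable M"
    by (rule measurable_iter_whitener) (use m in simp)
  have [measurable]: "?W \<in> borel_measurable M"
    by (rule measurable_batch_cov[OF \<open>?A \<in> borel_measurable M\<close>]) (use m in simp)
  have iter: "prob {\<omega> \<in> space M. \<not> ?good \<omega>} \<le> real (Suc T) * (2 * real CARD('d) * exp (- l))"
    using iteration_failure_bound[OF L \<theta>(1) m(1), of "Suc T" l] m(2) lam(1) e by simp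
  have bad: "prob ?bad \<le> 2 * real CARD('d) * exp (- l')"
  proof (rule batch_deviation[where p = "m * Suc T" and A = "\<lambda>x. iter_whitener \<theta> L m x (Suc T)"])
    show "(\<lambda>x. iter_whitener \<theta> L m x (Suc T)) \<in> borel_measurable (PiM {1..m * Suc T} (\<lambda>_. borel))"
      by (rule borel_measurable_iter_whitener) measurable
    show "transpose (iter_whitener \<theta> L m x (Suc T)) = iter_whitener \<theta> L m x (Suc T)" for x
      by (rule transpose_iter_whitener[OF L(1) \<theta>(1)])
    show "iter_whitener \<theta> L m (restrict x {1..m * Suc T}) (Suc T) = iter_whitener \<theta> L m x (Suc T)" for x
      by (rule iter_whitener_cong) auto
  qed (use L m lam \<theta> in auto)
  have "prob {\<omega> \<in> space M. \<not> relative_error_le (3 / 2 * ?e) (reg lam S) (?W \<omega>) S} \<le> prob ({\<omega> \<in> space M. \<not> ?good \<omega>} \<union> ?bad)"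
  proof (rule finite_measure_mono)
    have "relative_error_le (3 / 2 * ?e) (reg lam S) (?W \<omega>) S" if g: "?good \<omega>" and c: "relative_error_le ?e (?A \<omega>) (?W \<omega>) S" for \<omega>
      unfolding relative_error_le_def
    proof
      fix u
      have "\<bar>u \<bullet> ((?W \<omega> - S) *v u)\<bar> \<le> ?e * (u \<bullet> (?A \<omega> *v u))" using c by (simp only: relative_error_le_def)
      also have "\<dots> \<le> ?e * (3 / 2 * (u \<bullet> (reg lam S *v u)))"
      proof (rule mult_left_mono)
        have "2 * (u \<bullet> (?A \<omega> *v u)) \<le> 3 * (u \<bullet> (reg ?mu S *v u))"
          using g by (simp only: loewner_le_def scaleR_matrix_vector_assoc[symmetric] inner_scaleR_right)
        also have "\<dots> \<le> 3 * (u \<bullet> (reg lam S *v u))"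
          using mult_right_mono[OF lam(2), of "u \<bullet> u"] by (simp add: quadratic_form_reg)
        finally show "u \<bullet> (?A \<omega> *v u) \<le> 3 / 2 * (u \<bullet> (reg lam S *v u))" by simp
        show "0 \<le> ?e" using e' by simp
      qed
      finally show "\<bar>u \<bullet> ((?W \<omega> - S) *v u)\<bar> \<le> 3 / 2 * ?e * (u \<bullet> (reg lam S *v u))" by (simp only: mult.assoc mult.left_commute)
    qed
    then show "{\<omega> \<in> space M. \<not> relative_error_le (3 / 2 * ?e) (reg lam S) (?W \<omega>) S} \<subseteq> {\<omega> \<in> space M. \<not> ?good \<omega>} \<union> ?bad" by blast
  qed measurable
  also have "\<dots> \<le> prob {\<omega> \<in> space M. \<not> ?good \<omega>} + prob ?bad" by (rule measure_Un_le; measurable)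
  also have "\<dots> \<le> real (Suc T) * (2 * real CARD('d) * exp (- l)) + 2 * real CARD('d) * exp (- l')" using iter bad by (rule add_mono)
  finally show ?thesis by simp
qed

end

section \<open>Choice of the parameters and conclusion\<close>

lemma spectral_norm_le_iff: "spectral_norm B \<le> c \<longleftrightarrow> (\<forall>x. norm (B *v x) \<le> c * norm x)"
proof
  assume "spectral_norm B \<le> c"
  then show "\<forall>x. norm (B *v x) \<le> c * norm x"
    using norm_mult_le_spectral_norm[of B] by (meson mult_right_mono norm_ge_zero order_trans)
qed (auto simp: spectral_norm_def intro!: onorm_le)

lemma closed_spectral_norm_le: "closed {B :: real^'n^'n. spectral_norm B \<le> c}"
  unfolding spectral_norm_le_iff
  by (intro closed_Collect_all closed_Collect_le continuous_intros linear_continuous_on bounded_linear_matrix_vector_left)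

lemma spectral_norm_whitened_le:
  assumes S: "psd S" and W: "psd W" and lam: "0 < lam" and close: "relative_error_le e (reg lam S) W S"
  shows "spectral_norm (inv_sqrt (reg lam S) ** (W - S) ** inv_sqrt (reg lam S)) \<le> e"
proof -
  let ?K = "inv_sqrt (reg lam S)"
  note K = inv_sqrt_whitens[OF pd_reg[OF S lam]]
  have sym: "transpose (W - S) = W - S"
    using S W linear_diff[OF bounded_linear.linear[OF bounded_linear_transpose], of W S] by (simp add: psd_def)
  have quad: "y \<bullet> ((?K ** B ** ?K) *v y) = (?K *v y) \<bullet> (B *v (?K *v y))" for B y
    by (simp add: matrix_vector_mul_assoc[symmetric] symmetric_inner[OF K(1)])
  show ?thesis
  proof (rule spectral_norm_le)
    show "transpose (?K ** (W - S) ** ?K) = ?K ** (W - S) ** ?K"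
      by (simp only: matrix_transpose_mul K(1) sym matrix_mul_assoc)
    fix y
    have "\<bar>y \<bullet> ((?K ** (W - S) ** ?K) *v y)\<bar> \<le> e * ((?K *v y) \<bullet> (reg lam S *v (?K *v y)))"
      unfolding quad using close by (simp only: relative_error_le_def)
    also have "\<dots> = e * (y \<bullet> y)" by (simp only: quad[symmetric] K(2) matrix_vector_mul_lid)
    finally show "\<bar>y \<bullet> ((?K ** (W - S) ** ?K) *v y)\<bar> \<le> e * (y \<bullet> y)" .
  qed
qed

text \<open>The level \<open>\<theta> = a \<kappa>\<^sup>2 sqrt (n D / l)\<close> makes the fluctuation and the variance term proportional to the same rate
  \<open>sqrt (D l / n)\<close>; \<open>c\<close> compares the sample size with the batch size.\<close>

lemma truncation_tradeoff:
  fixes n D l b c w a \<kappa> :: real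
  assumes pos: "0 < n" "0 < D" "0 < l" "0 < b" "0 < a" "0 < \<kappa>" and nb: "n \<le> c * b"
    and \<theta>: "\<theta> = a * \<kappa>\<^sup>2 * sqrt (n * D / l)"
  shows "\<theta> * l / b + w * \<kappa> ^ 4 * D / \<theta> \<le> (a * c + w / a) * \<kappa>\<^sup>2 * sqrt (D * l / n)"
proof -
  define s where "s = sqrt (D * l / n)"
  have s: "s > 0" "s * s = D * l / n" using pos by (simp_all add: s_def)
  have "sqrt (n * D / l) = n * s / l"
  proof (rule real_sqrt_unique)
    show "(n * s / l)\<^sup>2 = n * D / l"
      using pos s(2) by (simp add: power2_eq_square field_simps)
  qed (use pos s in simp)
  then have th: "\<theta> = a * \<kappa>\<^sup>2 * (n * s / l)" by (simp add: \<theta>)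
  have "\<theta> * l / b = a * \<kappa>\<^sup>2 * s * (n / b)" using pos by (simp add: th)
  also have "\<dots> \<le> a * \<kappa>\<^sup>2 * s * c" using pos s nb by (intro mult_left_mono) (auto simp: pos_divide_le_eq)
  finally have 1: "\<theta> * l / b \<le> a * \<kappa>\<^sup>2 * s * c" .
  have "w * \<kappa> ^ 4 * D / \<theta> = w / a * \<kappa>\<^sup>2 * (D * l / n / s)"
    using pos s(1) by (simp add: th field_simps power2_eq_square power4_eq_xxxx)
  also have "D * l / n / s = s" using s by (metis nonzero_mult_div_cancel_right less_irrefl)
  finally show ?thesis using 1 by (simp add: s_def[symmetric] algebra_simps)
qed

lemma num_rounds_bounds:
  assumes "0 < lam" "lam \<le> L" and T: "T = num_rounds lam L"
  shows "L / 2 ^ T \<le> lam" "lam \<le> 2 * (L / 2 ^ T)" "j \<le> T \<Longrightarrow> lam \<le> L / 2 ^ (j - 1)"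
proof -
  define y where "y = log 2 (L / lam)"
  have ratio: "1 \<le> L / lam" using assms by simp
  have y: "0 \<le> y" "2 powr y = L / lam" using ratio by (simp_all add: y_def)
  have T': "real T = of_int \<lceil>y\<rceil>" using y(1) by (simp add: T num_rounds_def y_def[symmetric])
  have Ty: "y \<le> real T" "real T \<le> y + 1" unfolding T' by linarith+
  have "L / lam \<le> 2 powr real T" unfolding y(2)[symmetric] using Ty by (intro powr_mono) auto
  then show "L / 2 ^ T \<le> lam" using assms by (simp add: powr_realpow field_simps)
  have "2 powr real T \<le> 2 powr (y + 1)" using Ty by (intro powr_mono) auto
  then have "2 ^ T \<le> 2 * (L / lam)" by (simp add: powr_realpow powr_add y mult.commute)
  from mult_right_mono[OF this, of lam] have "2 ^ T * lam \<le> 2 * L" using assms by simp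
  then show "lam \<le> 2 * (L / 2 ^ T)" by (simp add: pos_le_divide_eq mult.commute)
  assume j: "j \<le> T"
  have "real (j - 1) \<le> y"
  proof (cases j)
    case (Suc i)
    then have "int i < \<lceil>y\<rceil>" using j T' by linarith
    then show ?thesis using Suc by (simp add: less_ceiling_iff)
  qed (use y in simp)
  then have "2 powr real (j - 1) \<le> 2 powr y" by (intro powr_mono) auto
  then have "2 ^ (j - 1) \<le> L / lam" by (simp add: powr_realpow y)
  then show "lam \<le> L / 2 ^ (j - 1)" using assms by (simp add: field_simps)
qed

lemma kurtosis_from_powr:
  fixes a b \<kappa> :: real
  assumes "0 \<le> a" "0 \<le> b" "0 \<le> \<kappa>" and le: "a powr (1/4) \<le> \<kappa> * b powr (1/2)"
  shows "a \<le> \<kappa> ^ 4 * b\<^sup>2"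
proof -
  have "(a powr (1/4)) ^ 4 \<le> (\<kappa> * b powr (1/2)) ^ 4" using le by (intro power_mono) auto
  moreover have "(a powr (1/4)) ^ 4 = a"
    using powr_power[of a "1/4" 4] assms by (cases "a = 0") simp_all
  moreover have "(b powr (1/2)) ^ 4 = b\<^sup>2"
    using powr_power[of b "1/2" 4] assms by (cases "b = 0") (simp_all add: powr_numeral)
  ultimately show ?thesis by (simp add: power_mult_distrib)
qed

text \<open>The correction factors of the final level replace \<open>q ln (4 q d / \<delta>)\<close> by \<open>ln (4 d / \<delta>)\<close> under the root.\<close>

lemma final_level_eq:
  fixes \<kappa> D \<delta> \<theta> :: real and n d T :: nat
  assumes q: "q = T + 1" and l': "0 < ln (4 * real d / \<delta>)" and \<delta>: "0 < \<delta>" and d: "0 < d"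
    and \<theta>: "\<theta> = 2 * \<kappa>\<^sup>2 * sqrt (real n * D / (real q * ln (4 * real q * real d / \<delta>)))"
    and D: "0 < D"
  shows "final_level \<delta> d T \<theta> = 4 * \<kappa>\<^sup>2 * sqrt (real n * D / ln (4 * real d / \<delta>))"
proof -
  let ?l = "ln (4 * real q * real d / \<delta>)" and ?l' = "ln (4 * real d / \<delta>)"
  have q0: "1 \<le> real q" using q by simp
  have "?l = ln ((4 * real d / \<delta>) * real q)" by (simp add: mult.commute mult.left_commute)
  also have "\<dots> = ?l' + ln (real q)" using \<delta> d q0 by (intro ln_mult_pos) auto
  finally have l: "?l = ?l' + ln (real q)" .
  have lpos: "0 < ?l" using l l' ln_ge_zero[OF q0] by linarith
  have r: "1 + ln (real q) / ?l' = ?l / ?l'" using l' by (simp add: l add_divide_distrib)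
  have "sqrt (real n * D / (real q * ?l)) * sqrt (real q) * sqrt (?l / ?l') = sqrt (real n * D / (real q * ?l) * real q * (?l / ?l'))"
    by (simp only: real_sqrt_mult)
  also have "real n * D / (real q * ?l) * real q * (?l / ?l') = real n * D / ?l'"
    using q0 lpos l' by (simp add: field_simps)
  finally show ?thesis unfolding final_level_def q[symmetric] r \<theta> by (simp add: mult.assoc)
qed

theorem corollary4p1:
  fixes M :: "'w measure"
    and X :: "nat \<Rightarrow> 'w \<Rightarrow> real^'d::{finite,linorder}"
    and S :: "real^'d::{finite,linorder}^'d::{finite,linorder}"
    and n q :: nat
    and \<kappa> \<delta> lam L \<theta> :: real
  assumes "prob_space M"
    and "n \<ge> 1"
    and "prob_space.indep_vars M (\<lambda>_. borel) X {1..n}"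
    and "\<And>i j. i \<in> {1..n} \<Longrightarrow> j \<in> {1..n} \<Longrightarrow> distr M borel (X i) = distr M borel (X j)"
    and "\<And>i. i \<in> {1..n} \<Longrightarrow> integrable M (X i) \<and> (\<integral>\<omega>. X i \<omega> \<partial>M) = 0"
    and "\<And>i. i \<in> {1..n} \<Longrightarrow> integrable M (\<lambda>\<omega>. outer (X i \<omega>)) \<and> (\<integral>\<omega>. outer (X i \<omega>) \<partial>M) = S"
    and "\<kappa> \<ge> 1"
    and "\<And>i u. i \<in> {1..n} \<Longrightarrow>
           integrable M (\<lambda>\<omega>. (X i \<omega> \<bullet> u) ^ 4) \<and>
           (\<integral>\<omega>. (X i \<omega> \<bullet> u) ^ 4 \<partial>M) powr (1/4) \<le> \<kappa> * (\<integral>\<omega>. (X i \<omega> \<bullet> u)\<^sup>2 \<partial>M) powr (1/2)"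
    and "0 < \<delta>" "\<delta> \<le> 1"
    and "0 < lam" "lam \<le> spectral_norm S" "spectral_norm S \<le> L"
    and "q = nat \<lceil>log 2 (L / lam)\<rceil> + 1"
    and "real n \<ge> 96\<^sup>2 * \<kappa> ^ 4 * real q * df lam S * ln (4 * real q * real CARD('d) / \<delta>)"
    and "\<theta> = 2 * \<kappa>\<^sup>2 * sqrt (real n * df lam S / (real q * ln (4 * real q * real CARD('d) / \<delta>)))"
  shows "measure M {\<omega> \<in> space M.
           spectral_norm (inv_sqrt (reg lam S) ** (algorithm_A n \<delta> lam L \<theta> (\<lambda>i. X i \<omega>) - S) ** inv_sqrt (reg lam S))
             \<le> 48 * \<kappa>\<^sup>2 * sqrt (df lam S * ln (4 * real CARD('d) / \<delta>) / real n)} \<ge> 1 - \<delta>"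
proof -
  interpret prob_space M by (rule assms(1))
  note n1 = assms(2) and delta = assms(9,10) and lam = assms(11-13) and q = assms(14) and nbig = assms(15) and theta = assms(16)
  let ?k = "\<kappa> ^ 4" and ?d = "real CARD('d)" and ?D = "df lam S"
  let ?l = "ln (4 * real q * ?d / \<delta>)" and ?l' = "ln (4 * ?d / \<delta>)"
  have kap: "1 \<le> \<kappa>" by (rule assms(7))
  have one: "1 \<in> {1..n}" using n1 by simp
  have outer: "integrable M (\<lambda>\<omega>. outer (X i \<omega>))" "(\<integral>\<omega>. outer (X i \<omega>) \<partial>M) = S" if "i \<in> {1..n}" for i
    using assms(6)[OF that] by auto
  have m2: "integrable M (\<lambda>\<omega>. (X i \<omega> \<bullet> u)\<^sup>2)" "(\<integral>\<omega>. (X i \<omega> \<bullet> u)\<^sup>2 \<partial>M) = u \<bullet> (S *v u)" if "i \<in> {1..n}" for i u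
    using integral_quadratic_form[OF outer(1)[OF that], of u] outer(2)[OF that] by (simp_all add: inner_outer)
  have m4: "integrable M (\<lambda>\<omega>. (X i \<omega> \<bullet> u) ^ 4)" "(\<integral>\<omega>. (X i \<omega> \<bullet> u) ^ 4 \<partial>M) \<le> ?k * (u \<bullet> (S *v u))\<^sup>2" if "i \<in> {1..n}" for i u
  proof -
    show "integrable M (\<lambda>\<omega>. (X i \<omega> \<bullet> u) ^ 4)" using assms(8)[OF that] by blast
    show "(\<integral>\<omega>. (X i \<omega> \<bullet> u) ^ 4 \<partial>M) \<le> ?k * (u \<bullet> (S *v u))\<^sup>2"
      unfolding m2(2)[OF that, symmetric]
      by (rule kurtosis_from_powr) (use assms(8)[OF that, of u] kap in auto)
  qed
  have S: "psd S"
  proof -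
    have "transpose S = S"
      unfolding outer(2)[OF one, symmetric] by (rule integral_transpose_eq[OF outer(1)[OF one]]) (simp add: transpose_outer)
    moreover have "0 \<le> u \<bullet> (S *v u)" for u unfolding m2(2)[OF one, symmetric] by simp
    ultimately show ?thesis by (simp add: psd_def)
  qed
  interpret kurtosis_sample M X n S ?k lam
    by unfold_locales (use assms(3) m2 m4 S lam in auto)
  have D: "1 / 2 \<le> ?D" by (rule df_ge_half[OF S lam(1,2)])
  have d1: "1 \<le> ?d" by (simp add: Suc_le_eq)
  define T where "T = num_rounds lam L"
  have qT: "q = T + 1" by (simp add: q T_def num_rounds_def)
  have q1: "1 \<le> real q" by (simp add: qT)
  have log1: "1 \<le> ln y" if "4 \<le> y" for y :: real
  proof -
    have "exp 1 \<le> y" using exp_le that by linarith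
    then show ?thesis using that by (subst ln_ge_iff) auto
  qed
  have l1: "1 \<le> ?l'" "1 \<le> ?l"
  proof -
    have "4 * \<delta> \<le> 4 * ?d" using d1 delta by linarith
    then show "1 \<le> ?l'" using delta by (intro log1) (simp add: pos_le_divide_eq)
    have "\<delta> \<le> real q * ?d" using d1 delta q1 mult_mono[OF q1 d1] by simp
    then show "1 \<le> ?l" using delta by (intro log1) (simp add: pos_le_divide_eq)
  qed
  have n0: "0 < real n" using n1 by simp
  have n4q: "4 * real q \<le> real n"
  proof -
    have k1: "1 \<le> \<kappa> ^ 4" using kap by simp
    have "1 * (1 / 2) * 1 \<le> \<kappa> ^ 4 * ?D * ?l" using k1 D l1 by (intro mult_mono) auto
    then have "real q * (1 / 2) \<le> real q * (\<kappa> ^ 4 * ?D * ?l)" using q1 by (intro mult_left_mono) auto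
    then have "96\<^sup>2 * (real q * (1 / 2)) \<le> 96\<^sup>2 * (real q * (\<kappa> ^ 4 * ?D * ?l))" by (rule mult_left_mono) simp
    also have "\<dots> \<le> real n" using nbig by (simp only: mult_ac)
    finally show ?thesis using q1 by simp
  qed
  define m where "m = n div (2 * (T + 1))"
  define r where "r = n - m * (T + 1)"
  have mq: "2 * (m * q) \<le> n"
    using div_times_less_eq_dividend[of n "2 * (T + 1)"] by (simp add: m_def qT algebra_simps)
  have nm: "real n \<le> 4 * (real q * real m)"
  proof -
    have "n < m * (2 * q) + 2 * q" unfolding m_def qT using dividend_less_div_times[of "2 * (T + 1)" n] by simp
    then have "real n < real (m * (2 * q) + 2 * q)" by (simp only: of_nat_less_iff)
    then show ?thesis using n4q by (simp add: algebra_simps)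
  qed
  have m0: "0 < m" using nm n0 by (cases m) auto
  have nr: "n \<le> 2 * r" "m * Suc T + r = n" using mq by (simp_all add: r_def qT)
  then have rn: "real n \<le> 2 * real r" "m * Suc T + r = n" by linarith+
  have r0: "0 < r" using rn(1) n0 by (cases r) auto
  have lamL: "lam \<le> L" using lam by linarith
  have L0: "0 < L" using lam by linarith
  have SL: "u \<bullet> (S *v u) \<le> L * (u \<bullet> u)" for u
    using quadratic_form_le_spectral_norm[of u S] mult_right_mono[OF lam(3), of "u \<bullet> u"] by simp
  note rounds = num_rounds_bounds[OF lam(1) lamL T_def]
  define th' where "th' = final_level \<delta> CARD('d) T \<theta>"
  have th'_eq: "th' = 4 * \<kappa>\<^sup>2 * sqrt (real n * ?D / ?l')"
    unfolding th'_def by (rule final_level_eq[OF qT _ delta(1) _ theta]) (use l1 D in auto)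
  have th0: "0 < \<theta>" unfolding theta using kap n0 D q1 l1 by (intro mult_pos_pos) auto
  have th'0: "0 < th'" unfolding th'_eq using kap n0 D l1 by (intro mult_pos_pos) auto
  have e: "\<theta> * ?l / real m + 8 * ?k * ?D / \<theta> \<le> 1 / 6"
  proof -
    \<comment> \<open>Expanding by \<open>q\<close> puts the first term into the form of the tradeoff, with \<open>q l\<close> for the
      logarithm and \<open>q m \<ge> n / 4\<close> for the batch size.\<close>
    have "\<theta> * (real q * ?l) / (real q * real m) + 8 * \<kappa> ^ 4 * ?D / \<theta>
        \<le> (2 * 4 + 8 / 2) * \<kappa>\<^sup>2 * sqrt (?D * (real q * ?l) / real n)"
      by (rule truncation_tradeoff) (use n0 D q1 l1 m0 kap nm theta in auto)
    \<comment> \<open>This is the sample size assumption; it yields \<open>12 / 96\<close>, below the required \<open>1 / 6\<close>.\<close>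
    moreover have "\<kappa>\<^sup>2 * sqrt (?D * (real q * ?l) / real n) \<le> 1 / 96"
    proof -
      have "\<kappa>\<^sup>2 * sqrt (?D * (real q * ?l) / real n) = sqrt ((\<kappa>\<^sup>2)\<^sup>2 * (?D * (real q * ?l) / real n))"
        by (simp only: real_sqrt_mult real_sqrt_abs abs_power2)
      also have "\<dots> \<le> sqrt ((1 / 96)\<^sup>2)"
      proof (rule real_sqrt_le_mono)
        have "96\<^sup>2 * (\<kappa> ^ 4 * (?D * (real q * ?l))) \<le> real n" using nbig by (simp add: mult_ac)
        then show "(\<kappa>\<^sup>2)\<^sup>2 * (?D * (real q * ?l) / real n) \<le> (1 / 96)\<^sup>2"
          using n0 by (simp add: power_divide divide_simps mult_ac flip: power_mult)
      qed
      finally show ?thesis by simp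
    qed
    moreover have "\<theta> * (real q * ?l) / (real q * real m) = \<theta> * ?l / real m" using q1 m0 by simp
    ultimately show ?thesis by simp
  qed
  have e0: "0 \<le> \<theta> * ?l / real m + 8 * ?k * ?D / \<theta>"
    using th0 l1 D kap by (intro add_nonneg_nonneg divide_nonneg_nonneg mult_nonneg_nonneg) auto
  have e': "th' * ?l' / real r + 16 * ?k * ?D / th' \<le> 12 * \<kappa>\<^sup>2 * sqrt (?D * ?l' / real n)"
  proof -
    have "th' * ?l' / real r + 16 * \<kappa> ^ 4 * ?D / th' \<le> (4 * 2 + 16 / 4) * \<kappa>\<^sup>2 * sqrt (?D * ?l' / real n)"
      by (rule truncation_tradeoff) (use n0 D l1 r0 kap rn th'_eq in auto)
    then show ?thesis by simp
  qed
  have e'0: "0 \<le> th' * ?l' / real r + 16 * ?k * ?D / th'"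
    using th'0 l1 D kap by (intro add_nonneg_nonneg divide_nonneg_nonneg mult_nonneg_nonneg) auto
  let ?bound = "48 * \<kappa>\<^sup>2 * sqrt (?D * ?l' / real n)"
  let ?K = "inv_sqrt (reg lam S)"
  define W where "W \<omega> = whitened_cov th' (iter_whitener \<theta> L m (\<lambda>i. X i \<omega>) (Suc T)) r (m * Suc T) (\<lambda>i. X i \<omega>)" for \<omega>
  have alg: "algorithm_A n \<delta> lam L \<theta> (\<lambda>i. X i \<omega>) = W \<omega>" for \<omega>
    unfolding algorithm_A_eq_whitened_cov[OF L0 th0 T_def m_def] W_def r_def th'_def by simp
  have [measurable]: "W \<in> borel_measurable M"
    unfolding W_def[abs_def] by (intro measurable_batch_cov measurable_iter_whitener) (use rn in simp_all)
  let ?c = "3 / 2 * (th' * ?l' / real r + 16 * ?k * ?D / th')"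
  let ?bad = "{\<omega> \<in> space M. \<not> relative_error_le ?c (reg lam S) (W \<omega>) S}"
  let ?good = "{\<omega> \<in> space M. spectral_norm (?K ** (W \<omega> - S) ** ?K) \<le> ?bound}"
  have good_event: "?good \<in> events"
  proof -
    have "Measurable.pred borel (\<lambda>B :: real^'d::{finite,linorder}^'d::{finite,linorder}. spectral_norm B \<le> ?bound)"
      using borel_closed[OF closed_spectral_norm_le] by (simp add: pred_def)
    have "(\<lambda>\<omega>. ?K ** (W \<omega> - S) ** ?K) \<in> borel_measurable M"
      by (intro borel_measurable_matrix_mult borel_measurable_diff borel_measurable_const) measurable
    from measurable_compose[OF this \<open>Measurable.pred borel (\<lambda>B. spectral_norm B \<le> ?bound)\<close>]
    show ?thesis by (simp add: pred_def)
  qed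
  have "prob ?bad \<le> real (Suc T) * (2 * ?d * exp (- ?l)) + 2 * ?d * exp (- ?l')"
    unfolding W_def
    by (rule final_failure_bound[OF L0 SL th0 th'0 m0 rn(2) r0 _ rounds(1,2) e e0 e'0]) (rule rounds(3))
  also have "\<dots> = \<delta>"
  proof -
    have "exp (- ?l) = \<delta> / (4 * real q * ?d)" "exp (- ?l') = \<delta> / (4 * ?d)"
      using delta d1 q1 by (simp_all add: exp_minus inverse_eq_divide)
    moreover have "real (Suc T) = real q" by (simp add: qT)
    ultimately show ?thesis using q1 d1 by (simp add: field_simps)
  qed
  finally have bad: "prob ?bad \<le> \<delta>" .
  have "1 - \<delta> \<le> 1 - prob ?bad" using bad by simp
  also have "\<dots> = prob (space M - ?bad)" by (rule prob_compl[symmetric]) measurable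
  also have "\<dots> \<le> prob ?good"
  proof (rule finite_measure_mono[OF _ good_event])
    show "space M - ?bad \<subseteq> ?good"
    proof
      fix \<omega> assume "\<omega> \<in> space M - ?bad"
      then have w: "\<omega> \<in> space M" and "relative_error_le ?c (reg lam S) (W \<omega>) S" by auto
      then have "spectral_norm (?K ** (W \<omega> - S) ** ?K) \<le> ?c"
        by (intro spectral_norm_whitened_le[OF S _ lam(1)]) (auto simp: W_def intro!: psd_whitened_cov th'0 simp del: iter_whitener.simps)
      also have "\<dots> \<le> 3 / 2 * (12 * \<kappa>\<^sup>2 * sqrt (?D * ?l' / real n))" by (intro mult_left_mono e') simp
      also have "\<dots> \<le> ?bound"
      proof -
        have "0 \<le> \<kappa>\<^sup>2 * sqrt (?D * ?l' / real n)" using D l1 by simp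
        then show ?thesis by simp
      qed
      finally show "\<omega> \<in> ?good" using w by simp
    qed
  qed
  finally show ?thesis by (simp only: alg)
qed

end
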